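(* Let $P\in\mathbb{C}[\xi_1,\ldots,\xi_d]\setminus\{0\}$. Let $K\subseteq\mathbb{R}^d$ be compact and convex, and let $Y\subseteq\mathbb{R}^d$ be open with $K\subseteq Y$. Then, for all compact $L\subseteq Y$ with $K\subseteq\operatorname{int}L$, all compact $M\subseteq\mathbb{R}^d$, and all $r_1,r_2\in\mathbb{N}_0$ there are $s,C>0$ such that for all $f\in\mathscr{E}_P(Y)$ and all $\varepsilon\in(0,1)$ there exists $h_\varepsilon\in\mathscr{E}_P(\mathbb{R}^d)$ with $$\|f-h_\varepsilon\|_{K,r_1}\leq\varepsilon\|f\|_{L,r_1+1}\quad\text{and}\quad\|h_\varepsilon\|_{M,r_2}\leq\frac{C}{\varepsilon^s}\|f\|_{L}.$$ If moreover $P(D)$ is hypoelliptic, then for all compact $L\subseteq Y$ with $K\subseteq\operatorname{int}L$ and all compact $M\subseteq\mathbb{R}^d$ there are $s,C>0$ such that for all $f\in\mathscr{E}_P(Y)$ and all $\varepsilon\in(0,1)$ there exists $h_\varepsilon\in\mathscr{E}_P(\mathbb{R}^d)$ with $$\|f-h_\varepsilon\|_{K}\leq\varepsilon\|f\|_{L}\quad\text{and}\quad\|h_\varepsilon\|_{M}\leq\frac{C}{\varepsilon^s}\|f\|_{L}.$$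
   Context: For a polynomial $P\in\mathbb{C}[\xi_1,\ldots,\xi_d]$, $P(D)=P(-i\frac{\partial}{\partial x_1},\ldots,-i\frac{\partial}{\partial x_d})$ is the corresponding constant coefficient differential operator. For $X\subseteq\mathbb{R}^d$ open, $\mathscr{E}(X)$ is the space of (complex-valued) smooth functions on $X$, and $\mathscr{E}_P(X)=\{f\in\mathscr{E}(X): P(D)f=0\}$. For $K\subseteq X$ compact and $r\in\mathbb{N}_0$, $\|f\|_{K,r}=\sup_{x\in K,|\alpha|\leq r}|\partial^\alpha f(x)|$ and $\|f\|_K=\|f\|_{K,0}$. *)

theory Defs
  imports "HOL-Analysis.Analysis" "HOL-Library.Poly_Mapping"
begin

section \<open>Partial derivatives and smooth functions\<close>

definition partial_deriv :: "'n::finite \<Rightarrow> (real^'n \<Rightarrow> complex) \<Rightarrow> real^'n \<Rightarrow> complex" where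
  "partial_deriv i f x = frechet_derivative f (at x) (axis i 1)"

definition iter_deriv :: "'n::finite list \<Rightarrow> (real^'n \<Rightarrow> complex) \<Rightarrow> real^'n \<Rightarrow> complex" where
  "iter_deriv is f = foldr partial_deriv is f"

text \<open>
  Functions on an open set are represented by total functions whose values outside
  the set are irrelevant.  Since a differentiable function is continuous, requiring
  (total) differentiability of every iterated partial derivative is the same as requiring that
  all iterated partial derivatives exist and are continuous.
\<close>

definition smooth_fns :: "(real^'n::finite) set \<Rightarrow> (real^'n \<Rightarrow> complex) set" where
  "smooth_fns X = {f. \<forall>is. iter_deriv is f differentiable_on X}"

text \<open>Multi-indices \<open>\<alpha> \<in> \<nat>\<^sup>d\<close> are elements of \<open>'n \<Rightarrow>\<^sub>0 nat\<close> with \<open>'n\<close> the finite type of coordinates.\<close>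

definition mdeg :: "('n::finite \<Rightarrow>\<^sub>0 nat) \<Rightarrow> nat" where
  "mdeg \<alpha> = (\<Sum>i\<in>UNIV. Poly_Mapping.lookup \<alpha> i)"

text \<open>
  The coordinate type carries no order, so the partial derivatives are taken in
  an arbitrary order; for smooth functions the order does not matter (lemma \<open>mderiv_eq\<close> below).
\<close>

definition mderiv :: "('n::finite \<Rightarrow>\<^sub>0 nat) \<Rightarrow> (real^'n \<Rightarrow> complex) \<Rightarrow> real^'n \<Rightarrow> complex" where
  "mderiv \<alpha> f = iter_deriv (SOME is. count_list is = Poly_Mapping.lookup \<alpha>) f"


section \<open>Independence of the order of differentiation\<close>

lemma iter_deriv_Nil [simp]: "iter_deriv [] f = f"
  and iter_deriv_Cons [simp]: "iter_deriv (i # is) f = partial_deriv i (iter_deriv is f)"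
  by (simp_all add: iter_deriv_def)

lemma iter_deriv_append: "iter_deriv (is @ js) f = iter_deriv is (iter_deriv js f)"
  by (simp add: iter_deriv_def)

lemma iter_deriv_smooth: "f \<in> smooth_fns X \<Longrightarrow> iter_deriv is f \<in> smooth_fns X"
  unfolding smooth_fns_def by (simp flip: iter_deriv_append)

lemma smooth_differentiable_at:
  assumes "f \<in> smooth_fns X" "open X" "x \<in> X"
  shows "iter_deriv is f differentiable (at x)"
  using assms unfolding smooth_fns_def differentiable_on_def
  by (metis (no_types, lifting) at_within_open mem_Collect_eq)

lemma partial_deriv_cong_open:
  assumes "open X" "x \<in> X" "f differentiable (at x)" "\<And>y. y \<in> X \<Longrightarrow> f y = g y"
  shows "partial_deriv i f x = partial_deriv i g x"
  unfolding partial_deriv_def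
  using frechet_derivative_transform_within_open[of f x X g] assms by simp

lemma has_derivative_along:
  fixes f :: "real^'n::finite \<Rightarrow> complex"
  assumes "f differentiable (at (y + s *\<^sub>R axis i 1))"
  shows "((\<lambda>s. f (y + s *\<^sub>R axis i 1)) has_vector_derivative partial_deriv i f (y + s *\<^sub>R axis i 1))
          (at s within S)"
proof -
  let ?D = "frechet_derivative f (at (y + s *\<^sub>R axis i 1))"
  have D: "(f has_derivative ?D) (at (y + s *\<^sub>R axis i 1))"
    using assms by (simp add: frechet_derivative_works)
  have "((\<lambda>s. y + s *\<^sub>R axis i 1) has_derivative (\<lambda>h. h *\<^sub>R axis i 1)) (at s within S)"
    by (auto intro!: derivative_eq_intros)
  then have "((\<lambda>s. f (y + s *\<^sub>R axis i 1)) has_derivative (\<lambda>h. ?D (h *\<^sub>R axis i 1))) (at s within S)"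
    using D by (rule has_derivative_compose)
  moreover have "?D (h *\<^sub>R axis i 1) = h *\<^sub>R ?D (axis i 1)" for h
    using D by (simp add: has_derivative_linear linear_scale)
  ultimately show ?thesis
    by (simp add: has_vector_derivative_def partial_deriv_def)
qed

lemma second_difference:
  fixes f :: "real^'n::finite \<Rightarrow> complex"
  assumes "open X" "x \<in> X" and diff: "\<And>y. y \<in> X \<Longrightarrow> f differentiable (at y)"
    and diff2: "partial_deriv i f differentiable (at x)" and "e > 0"
  shows "\<exists>d>0. \<forall>h. 0 < h \<and> h < d \<longrightarrow>
    norm (f (x + h *\<^sub>R axis i 1 + h *\<^sub>R axis j 1) - f (x + h *\<^sub>R axis i 1)
          - f (x + h *\<^sub>R axis j 1) + f x - h\<^sup>2 *\<^sub>R partial_deriv j (partial_deriv i f) x) \<le> e * h\<^sup>2"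
proof -
  let ?g = "partial_deriv i f"
  let ?D = "frechet_derivative ?g (at x)"
  let ?a = "axis i 1 :: real^'n" and ?b = "axis j 1 :: real^'n"
  have D: "(?g has_derivative ?D) (at x)"
    using diff2 by (simp add: frechet_derivative_works)
  then have lin: "linear ?D" by (rule has_derivative_linear)
  obtain d1 where d1: "d1 > 0" "\<And>y. norm (y - x) < d1 \<Longrightarrow>
      norm (?g y - ?g x - ?D (y - x)) \<le> e/3 * norm (y - x)"
    using D[unfolded has_derivative_at_alt, THEN conjunct2, rule_format, of "e/3"] \<open>e > 0\<close> by auto
  obtain d2 where d2: "d2 > 0" "ball x d2 \<subseteq> X"
    using \<open>open X\<close> \<open>x \<in> X\<close> openE by blast
  define d where "d = min d1 d2 / 2"
  have "d > 0" using d1 d2 by (simp add: d_def)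
  moreover have "norm (f (x + h *\<^sub>R ?a + h *\<^sub>R ?b) - f (x + h *\<^sub>R ?a)
          - f (x + h *\<^sub>R ?b) + f x - h\<^sup>2 *\<^sub>R partial_deriv j ?g x) \<le> e * h\<^sup>2"
    if h: "0 < h" "h < d" for h
  proof -
    define \<phi> where "\<phi> s = f ((x + h *\<^sub>R ?b) + s *\<^sub>R ?a) - f (x + s *\<^sub>R ?a)
          - (s * h) *\<^sub>R ?D ?b" for s
    define \<phi>' where "\<phi>' s = ?g ((x + h *\<^sub>R ?b) + s *\<^sub>R ?a) - ?g (x + s *\<^sub>R ?a)
          - h *\<^sub>R ?D ?b" for s
    have n2: "norm (h *\<^sub>R ?b + s *\<^sub>R ?a) \<le> 2 * h" and n1: "norm (s *\<^sub>R ?a) \<le> h"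
      if "s \<in> {0..h}" for s
    proof -
      show "norm (s *\<^sub>R ?a) \<le> h" using that by simp
      then show "norm (h *\<^sub>R ?b + s *\<^sub>R ?a) \<le> 2 * h"
        using norm_triangle_ineq[of "h *\<^sub>R ?b" "s *\<^sub>R ?a"] h by simp
    qed
    have hd: "2 * h < d1" "2 * h < d2" using h by (auto simp: d_def)
    have der: "(\<phi> has_vector_derivative \<phi>' s) (at s within {0..h})" if s: "s \<in> {0..h}" for s
    proof -
      have "dist x (x + (h *\<^sub>R ?b + s *\<^sub>R ?a)) < d2" "dist x (x + s *\<^sub>R ?a) < d2"
        unfolding dist_norm norm_minus_commute[of x] add_diff_cancel_left'
        using n2[OF s] n1[OF s] hd h by linarith+
      then have "x + h *\<^sub>R ?b + s *\<^sub>R ?a \<in> X" "x + s *\<^sub>R ?a \<in> X"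
        using d2(2) by (auto simp: subset_iff add.assoc)
      note A = has_derivative_along[OF diff[OF this(1)]] has_derivative_along[OF diff[OF this(2)]]
      have "((\<lambda>s. (s * h) *\<^sub>R ?D ?b) has_vector_derivative h *\<^sub>R ?D ?b) (at s within {0..h})"
        by (auto intro!: derivative_eq_intros simp: has_vector_derivative_def)
      with A show ?thesis
        unfolding \<phi>_def \<phi>'_def by (intro has_vector_derivative_diff)
    qed
    have bnd: "norm (\<phi>' s) \<le> e * h" if s: "s \<in> {0..h}" for s
    proof -
      let ?r = "\<lambda>y. ?g y - ?g x - ?D (y - x)"
      have "\<phi>' s = ?r ((x + h *\<^sub>R ?b) + s *\<^sub>R ?a) - ?r (x + s *\<^sub>R ?a)"
        by (simp add: \<phi>'_def linear_add[OF lin] linear_scale[OF lin] add.assoc)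
      then have "norm (\<phi>' s) \<le> norm (?r ((x + h *\<^sub>R ?b) + s *\<^sub>R ?a)) + norm (?r (x + s *\<^sub>R ?a))"
        by (simp only: norm_triangle_ineq4)
      also have "\<dots> \<le> e/3 * norm (h *\<^sub>R ?b + s *\<^sub>R ?a) + e/3 * norm (s *\<^sub>R ?a)"
      proof (rule add_mono)
        have eq: "(x + h *\<^sub>R ?b) + s *\<^sub>R ?a - x = h *\<^sub>R ?b + s *\<^sub>R ?a" "x + s *\<^sub>R ?a - x = s *\<^sub>R ?a"
          by (simp_all only: add.assoc add_diff_cancel_left')
        have lt: "norm (h *\<^sub>R ?b + s *\<^sub>R ?a) < d1" "norm (s *\<^sub>R ?a) < d1"
          using n2[OF s] n1[OF s] hd h by linarith+
        show "norm (?r ((x + h *\<^sub>R ?b) + s *\<^sub>R ?a)) \<le> e/3 * norm (h *\<^sub>R ?b + s *\<^sub>R ?a)"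
          using d1(2)[of "(x + h *\<^sub>R ?b) + s *\<^sub>R ?a"] lt(1) unfolding eq by blast
        show "norm (?r (x + s *\<^sub>R ?a)) \<le> e/3 * norm (s *\<^sub>R ?a)"
          using d1(2)[of "x + s *\<^sub>R ?a"] lt(2) unfolding eq by blast
      qed
      also have "\<dots> \<le> e/3 * (2 * h) + e/3 * h"
        using n2[OF s] n1[OF s] \<open>e > 0\<close> by (intro add_mono mult_left_mono) auto
      finally show ?thesis by simp
    qed
    have "norm (\<phi> h - \<phi> 0) \<le> e * h * norm (h - 0)"
    proof (rule differentiable_bound[where f' = "\<lambda>s t. t *\<^sub>R \<phi>' s" and S = "{0..h}"])
      show "(\<phi> has_derivative (\<lambda>t. t *\<^sub>R \<phi>' s)) (at s within {0..h})" if "s \<in> {0..h}" for s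
        using der[OF that] by (simp add: has_vector_derivative_def)
      show "onorm (\<lambda>t. t *\<^sub>R \<phi>' s) \<le> e * h" if "s \<in> {0..h}" for s
        using bnd[OF that] by (simp add: onorm_scaleR_left onorm_id)
    qed (use h in auto)
    moreover have "\<phi> h - \<phi> 0 = f (x + h *\<^sub>R ?a + h *\<^sub>R ?b) - f (x + h *\<^sub>R ?a)
          - f (x + h *\<^sub>R ?b) + f x - h\<^sup>2 *\<^sub>R partial_deriv j ?g x"
      by (simp add: \<phi>_def partial_deriv_def[of j] power2_eq_square algebra_simps)
    ultimately show ?thesis
      using h by (simp add: power2_eq_square)
  qed
  ultimately show ?thesis by blast
qed

lemma partial_deriv_commute:
  fixes f :: "real^'n::finite \<Rightarrow> complex"
  assumes "f \<in> smooth_fns X" "open X" "x \<in> X"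
  shows "partial_deriv i (partial_deriv j f) x = partial_deriv j (partial_deriv i f) x"
proof (rule ccontr)
  let ?p = "partial_deriv i (partial_deriv j f) x" and ?q = "partial_deriv j (partial_deriv i f) x"
  assume "?p \<noteq> ?q"
  define e where "e = norm (?p - ?q) / 3"
  have e: "e > 0" using \<open>?p \<noteq> ?q\<close> by (simp add: e_def)
  have d1: "f differentiable (at y)" if "y \<in> X" for y
    using smooth_differentiable_at[OF assms(1,2) that, of "[]"] by simp
  have d2: "partial_deriv k f differentiable (at x)" for k
    using smooth_differentiable_at[OF assms, of "[k]"] by simp
  let ?\<Delta> = "\<lambda>h i j. f (x + h *\<^sub>R axis i 1 + h *\<^sub>R axis j 1) - f (x + h *\<^sub>R axis i 1)
          - f (x + h *\<^sub>R axis j 1) + f x"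
  obtain a where a: "a > 0" "\<And>h. 0 < h \<Longrightarrow> h < a \<Longrightarrow> norm (?\<Delta> h i j - h\<^sup>2 *\<^sub>R ?q) \<le> e * h\<^sup>2"
    using second_difference[OF assms(2,3) d1 d2 e, of i j] by blast
  obtain b where b: "b > 0" "\<And>h. 0 < h \<Longrightarrow> h < b \<Longrightarrow> norm (?\<Delta> h j i - h\<^sup>2 *\<^sub>R ?p) \<le> e * h\<^sup>2"
    using second_difference[OF assms(2,3) d1 d2 e, of j i] by blast
  define h where "h = min a b / 2"
  have h: "0 < h" "h < a" "h < b" using a b by (auto simp: h_def)
  have sym: "?\<Delta> h j i = ?\<Delta> h i j" by (simp add: algebra_simps)
  have "h\<^sup>2 * norm (?p - ?q) = norm ((?\<Delta> h i j - h\<^sup>2 *\<^sub>R ?q) - (?\<Delta> h j i - h\<^sup>2 *\<^sub>R ?p))"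
    unfolding sym by (simp flip: scaleR_diff_right)
  also have "\<dots> \<le> e * h\<^sup>2 + e * h\<^sup>2"
    using a(2)[OF h(1,2)] b(2)[OF h(1,3)] by (rule norm_triangle_le_diff[OF add_mono])
  finally have "norm (?p - ?q) * h\<^sup>2 \<le> 2 * e * h\<^sup>2" by (simp add: mult.commute)
  then have "norm (?p - ?q) \<le> 2 * e" using h by simp
  then show False using e by (simp add: e_def)
qed

lemma iter_deriv_cong_open:
  assumes "f \<in> smooth_fns X" "open X" "\<And>y. y \<in> X \<Longrightarrow> f y = g y" "x \<in> X"
  shows "iter_deriv is f x = iter_deriv is g x"
  using assms(4)
proof (induction "is" arbitrary: x)
  case Nil
  then show ?case using assms by simp
next
  case (Cons i "is")
  have "partial_deriv i (iter_deriv is f) x = partial_deriv i (iter_deriv is g) x"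
    by (rule partial_deriv_cong_open[OF assms(2) Cons.prems])
      (use Cons smooth_differentiable_at[OF assms(1,2)] in auto)
  then show ?case by simp
qed

lemma iter_deriv_permute:
  assumes f: "f \<in> smooth_fns X" "open X" and "mset is = mset js" "x \<in> X"
  shows "iter_deriv is f x = iter_deriv js f x"
  using assms(3,4)
proof (induction "is" arbitrary: js x)
  case Nil
  then show ?case by simp
next
  case (Cons i "is")
  have move: "iter_deriv (as @ i # bs) f y = iter_deriv (i # as @ bs) f y" if "y \<in> X" for as bs y
    using that
  proof (induction as arbitrary: y)
    case Nil
    then show ?case by simp
  next
    case (Cons a as)
    have "iter_deriv ((a # as) @ i # bs) f y = partial_deriv a (iter_deriv (i # as @ bs) f) y"
      unfolding append_Cons iter_deriv_Cons
      by (rule partial_deriv_cong_open[OF f(2) Cons.prems smooth_differentiable_at[OF f Cons.prems]])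
        (use Cons.IH in auto)
    also have "\<dots> = partial_deriv i (partial_deriv a (iter_deriv (as @ bs) f)) y"
      using partial_deriv_commute[OF iter_deriv_smooth[OF f(1)] f(2) Cons.prems] by simp
    finally show ?case by simp
  qed
  obtain as bs where js: "js = as @ i # bs"
    using Cons.prems(1) by (metis list.set_intros(1) mset_eq_setD split_list)
  have IH: "iter_deriv is f y = iter_deriv (as @ bs) f y" if "y \<in> X" for y
    using Cons.IH[of "as @ bs" y] Cons.prems(1) that by (simp add: js)
  have "iter_deriv (i # is) f x = partial_deriv i (iter_deriv (as @ bs) f) x"
    unfolding iter_deriv_Cons
    by (rule partial_deriv_cong_open[OF f(2) Cons.prems(2) smooth_differentiable_at[OF f Cons.prems(2)]])
      (use IH in auto)
  also have "\<dots> = iter_deriv js f x"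
    using move[OF Cons.prems(2), of as bs] by (simp add: js)
  finally show ?case .
qed

lemma mderiv_eq:
  fixes \<alpha> :: "'n::finite \<Rightarrow>\<^sub>0 nat"
  assumes "f \<in> smooth_fns X" "open X" "x \<in> X" "count_list is = Poly_Mapping.lookup \<alpha>"
  shows "mderiv \<alpha> f x = iter_deriv is f x"
proof -
  have "count_list (SOME is. count_list is = Poly_Mapping.lookup \<alpha>) = Poly_Mapping.lookup \<alpha>"
    using assms(4) by (rule someI)
  then have "mset (SOME is. count_list is = Poly_Mapping.lookup \<alpha>) = mset is"
    using assms(4) by (simp add: multiset_eq_iff count_mset)
  then show ?thesis
    unfolding mderiv_def by (rule iter_deriv_permute[OF assms(1,2) _ assms(3)])
qed

lemma ex_count_list: "\<exists>is. count_list is = Poly_Mapping.lookup (\<alpha> :: 'n::finite \<Rightarrow>\<^sub>0 nat)"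
proof -
  obtain "is" where "mset is = Abs_multiset (Poly_Mapping.lookup \<alpha>)" using ex_mset by blast
  then have "count (mset is) = Poly_Mapping.lookup \<alpha>" by simp
  then have "count_list is = Poly_Mapping.lookup \<alpha>" by (metis count_mset ext)
  then show ?thesis by blast
qed


section \<open>Constant coefficient differential operators\<close>

text \<open>A polynomial in \<open>\<complex>[\<xi>\<^sub>1, \<dots>, \<xi>\<^sub>d]\<close> is given by its finitely many coefficients.\<close>

type_synonym 'n cpoly = "('n \<Rightarrow>\<^sub>0 nat) \<Rightarrow>\<^sub>0 complex"

definition diff_op :: "'n::finite cpoly \<Rightarrow> (real^'n \<Rightarrow> complex) \<Rightarrow> real^'n \<Rightarrow> complex" where
  "diff_op P f x = (\<Sum>\<alpha>\<in>Poly_Mapping.keys P. Poly_Mapping.lookup P \<alpha> * (- \<i>) ^ mdeg \<alpha> * mderiv \<alpha> f x)"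

definition zero_sols :: "'n::finite cpoly \<Rightarrow> (real^'n) set \<Rightarrow> (real^'n \<Rightarrow> complex) set" where
  "zero_sols P X = {f \<in> smooth_fns X. \<forall>x\<in>X. diff_op P f x = 0}"

text \<open>The element 0 is inserted so that the norm over the empty set is 0.\<close>

definition Cr_norm :: "(real^'n::finite) set \<Rightarrow> nat \<Rightarrow> (real^'n \<Rightarrow> complex) \<Rightarrow> real" where
  "Cr_norm K r f = Sup (insert 0 {norm (mderiv \<alpha> f x) | \<alpha> x. x \<in> K \<and> mdeg \<alpha> \<le> r})"


section \<open>Distributions and hypoellipticity\<close>

definition test_fns_in :: "(real^'n::finite) set \<Rightarrow> (real^'n \<Rightarrow> complex) set" where
  "test_fns_in K = {\<phi> \<in> smooth_fns UNIV. \<forall>x. x \<notin> K \<longrightarrow> \<phi> x = 0}"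

definition test_fns :: "(real^'n::finite) set \<Rightarrow> (real^'n \<Rightarrow> complex) set" where
  "test_fns X = (\<Union>K \<in> {K. compact K \<and> K \<subseteq> X}. test_fns_in K)"

text \<open>
  A distribution on \<open>X\<close> is represented by a functional on all functions, of which only the values
  on \<^term>\<open>test_fns X\<close> matter.
\<close>

definition distribution_on :: "(real^'n::finite) set \<Rightarrow> ((real^'n \<Rightarrow> complex) \<Rightarrow> complex) \<Rightarrow> bool" where
  "distribution_on X u \<longleftrightarrow>
     (\<forall>\<phi>\<in>test_fns X. \<forall>\<psi>\<in>test_fns X. u (\<lambda>x. \<phi> x + \<psi> x) = u \<phi> + u \<psi>) \<and>
     (\<forall>c. \<forall>\<phi>\<in>test_fns X. u (\<lambda>x. c * \<phi> x) = c * u \<phi>) \<and>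
     (\<forall>K. compact K \<and> K \<subseteq> X \<longrightarrow>
        (\<exists>C N. \<forall>\<phi>\<in>test_fns_in K. norm (u \<phi>) \<le> C * Cr_norm K N \<phi>))"

text \<open>\<open>P(D)u\<close>, where \<open>(\<partial>\<^sup>\<alpha>u)(\<phi>) = (-1)\<^bsup>|\<alpha>|\<^esup> u(\<partial>\<^sup>\<alpha>\<phi>)\<close>.\<close>

definition distr_diff_op ::
  "'n::finite cpoly \<Rightarrow> ((real^'n \<Rightarrow> complex) \<Rightarrow> complex) \<Rightarrow> (real^'n \<Rightarrow> complex) \<Rightarrow> complex" where
  "distr_diff_op P u \<phi> =
     (\<Sum>\<alpha>\<in>Poly_Mapping.keys P. Poly_Mapping.lookup P \<alpha> * (- \<i>) ^ mdeg \<alpha> * ((- 1) ^ mdeg \<alpha> * u (mderiv \<alpha> \<phi>)))"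

definition smooth_distr :: "(real^'n::finite) set \<Rightarrow> ((real^'n \<Rightarrow> complex) \<Rightarrow> complex) \<Rightarrow> bool" where
  "smooth_distr X u \<longleftrightarrow>
     (\<exists>g\<in>smooth_fns X. \<forall>\<phi>\<in>test_fns X. u \<phi> = (LINT x|lborel. g x * \<phi> x))"

definition hypoelliptic :: "'n::finite cpoly \<Rightarrow> bool" where
  "hypoelliptic P \<longleftrightarrow>
     (\<forall>X u. open X \<and> distribution_on X u \<and> smooth_distr X (distr_diff_op P u) \<longrightarrow> smooth_distr X u)"

end

theory Submission
  imports Defs "HOL-Probability.Probability"
begin

text \<open>
  A solution \<open>f\<close> near the convex compact set \<open>K\<close> is cut off sharply and mollified (twice) at scale
  \<open>\<delta>\<close>, giving a test function \<open>u\<close>; this costs one derivative and \<open>O(\<delta>)\<close> on \<open>K\<close>, and every other norm of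
  \<open>u\<close> is at most a power of \<open>1/\<delta>\<close> times the sup norm of \<open>f\<close>. The right hand side \<open>g = P(D)u\<close> vanishes near
  \<open>K\<close>, so it splits into finitely many pieces separated from \<open>K\<close> by hyperplanes. For a piece lying in
  \<open>{\<tau> \<bullet> y \<ge> b + \<kappa>}\<close> with \<open>K \<subseteq> {\<tau> \<bullet> x \<le> b}\<close> one solves \<open>P(D)v = g\<close> with an estimate weighted by
  \<open>exp (t \<tau> \<bullet> (x - y))\<close> that is uniform in \<open>t\<close>: then \<open>v\<close> is exponentially small in \<open>t\<close> on \<open>K\<close>,
  exponentially bounded elsewhere, and \<open>h = u - v\<close> with \<open>t\<close> proportional to \<open>log (1/\<epsilon>)\<close> is the approximation.

  The uniform solvability comes from the explicit fundamental solution of Koenig and Ortner--Wagner,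
  a linear combination of Fourier integrals of \<open>conj p / p\<close> along shifted contours \<open>\<tau> + j \<eta> / 2 + i \<xi>\<close>;
  shifting by \<open>\<tau>\<close> leaves the principal part of the symbol unchanged. In the hypoelliptic case the loss of a
  derivative is removed by an a priori estimate, obtained by a uniform boundedness argument.
\<close>

section \<open>Smooth functions\<close>

text \<open>The obstacle is uniformity: the estimate for \<open>P(D)v = g\<close> must survive
  arbitrarily large weights. The quotient \<open>cnj p / p\<close> has modulus at most 1, so zeros
  of the symbol cost nothing and no lower bound for it is used. Applying \<open>P(D)\<close> leaves
  the factor \<open>cnj p\<close>, which on the contour is a polynomial in z and so acts on g as a
  differential operator; a finite-difference combination over j collapses these operators to a
  nonzero constant read off from the principal part, the same for every \<tau>. The half step
  \<open>j / 2\<close> is there because conjugation on \<open>Re z = \<theta>\<close> doubles the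
  shift. The two mollifications have different purposes: the first repairs the sharp cut-off, so
  that \<open>P(D)u\<close> makes sense; the second makes the pieces of that source, cut out by
  indicator functions, smooth again. Convexity of K enters through hyperplane separation.
  Hypoellipticity is a qualitative statement about distributions, while an estimate is wanted. The
  solutions with the sup norm over L need not form a complete space, so the limit in the uniform
  boundedness argument is only a distributional solution, and it is there that hypoellipticity
  acts.\<close>

lemma partial_deriv_eq:
  "(f has_derivative D) (at x) \<Longrightarrow> partial_deriv i f x = D (axis i 1)"
  unfolding partial_deriv_def by (simp add: frechet_derivative_at[symmetric])

text \<open>Unlike \<open>partial_deriv_cong_open\<close> this also covers points without
  differentiability: \<open>f\<close> and \<open>g\<close> have the same derivatives at
  \<open>x\<close>, hence \<open>frechet_derivative\<close> makes the same choice for both.\<close>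

lemma partial_deriv_cong:
  assumes "open X" "x \<in> X" "\<And>y. y \<in> X \<Longrightarrow> f y = g y"
  shows "partial_deriv i f x = partial_deriv i g x"
proof -
  have "(f has_derivative D) (at x) \<longleftrightarrow> (g has_derivative D) (at x)" for D
    using assms by (metis has_derivative_transform_within_open)
  then show ?thesis by (simp add: partial_deriv_def frechet_derivative_def)
qed

lemma differentiable_cong_open:
  assumes "open X" "x \<in> X" "\<And>y. y \<in> X \<Longrightarrow> f y = g y"
  shows "f differentiable (at x) \<longleftrightarrow> g differentiable (at x)"
  unfolding differentiable_def
  using assms by (metis has_derivative_transform_within_open)

lemma iter_deriv_cong:
  assumes "open X" "x \<in> X" "\<And>y. y \<in> X \<Longrightarrow> f y = g y"
  shows "iter_deriv is f x = iter_deriv is g x"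
  using assms(2)
proof (induction "is" arbitrary: x)
  case Nil
  then show ?case using assms by simp
next
  case (Cons i "is")
  then show ?case by (auto intro: partial_deriv_cong[OF assms(1)])
qed

lemma smooth_iff:
  assumes "open X"
  shows "f \<in> smooth_fns X \<longleftrightarrow> (\<forall>is. \<forall>x\<in>X. iter_deriv is f differentiable (at x))"
  unfolding smooth_fns_def differentiable_on_def
  by (simp add: at_within_open[OF _ assms] cong: ball_cong)

lemma smooth_cong:
  assumes "open X" "f \<in> smooth_fns X" "\<And>y. y \<in> X \<Longrightarrow> f y = g y"
  shows "g \<in> smooth_fns X"
  unfolding smooth_iff[OF assms(1)]
proof (intro allI ballI)
  fix "is" x assume x: "x \<in> X"
  have "iter_deriv is f y = iter_deriv is g y" if "y \<in> X" for y
    using iter_deriv_cong[OF assms(1) that assms(3)] .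
  then show "iter_deriv is g differentiable at x"
    using differentiable_cong_open[OF assms(1) x, of "iter_deriv is f" "iter_deriv is g"]
      assms(2) x unfolding smooth_iff[OF assms(1)] by blast
qed

lemma smooth_subset: "f \<in> smooth_fns X \<Longrightarrow> Y \<subseteq> X \<Longrightarrow> f \<in> smooth_fns Y"
  unfolding smooth_fns_def using differentiable_on_subset by blast

lemma smooth_Un:
  assumes "open X" "open Y" "f \<in> smooth_fns X" "f \<in> smooth_fns Y"
  shows "f \<in> smooth_fns (X \<union> Y)"
  using assms by (auto simp: smooth_iff open_Un)

text \<open>Replaces induction over derivative lists by a one-step closure check. Later smoothness
  proofs pick a family that absorbs differentiation, such as all convolutions
  \<open>conv F \<phi>\<close> with a fixed \<open>F\<close>.\<close>

lemma smooth_coinduct: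
  assumes X: "open X" and "f \<in> S"
    and diff: "\<And>f x. f \<in> S \<Longrightarrow> x \<in> X \<Longrightarrow> f differentiable (at x)"
    and step: "\<And>f i. f \<in> S \<Longrightarrow> \<exists>g\<in>S. \<forall>x\<in>X. partial_deriv i f x = g x"
  shows "f \<in> smooth_fns X"
proof -
  have ex: "\<forall>f\<in>S. \<exists>g\<in>S. \<forall>x\<in>X. iter_deriv is f x = g x" for "is"
  proof (induction "is")
    case Nil
    then show ?case by auto
  next
    case (Cons i "is")
    show ?case
    proof
      fix f assume "f \<in> S"
      then obtain g where g: "g \<in> S" "\<And>x. x \<in> X \<Longrightarrow> iter_deriv is f x = g x"
        using Cons by blast
      from step[OF g(1)] obtain h where h: "h \<in> S" "\<And>x. x \<in> X \<Longrightarrow> partial_deriv i g x = h x"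
        by blast
      have "iter_deriv (i # is) f x = h x" if "x \<in> X" for x
        using partial_deriv_cong[OF X that g(2)] h(2)[OF that] by simp
      with h show "\<exists>g\<in>S. \<forall>x\<in>X. iter_deriv (i # is) f x = g x" by blast
    qed
  qed
  have "iter_deriv is f differentiable (at x)" if "x \<in> X" for x "is"
  proof -
    obtain g where "g \<in> S" "\<forall>x\<in>X. iter_deriv is f x = g x"
      using ex assms(2) by blast
    then show ?thesis
      using differentiable_cong_open[OF X that, of "iter_deriv is f" g] diff[OF _ that] by blast
  qed
  then show ?thesis using smooth_iff[OF X] by blast
qed

lemma smooth_partial_deriv: "f \<in> smooth_fns X \<Longrightarrow> partial_deriv i f \<in> smooth_fns X"
  using iter_deriv_smooth[of f X "[i]"] by simp

lemma smooth_has_derivative: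
  fixes f :: "real^'n::finite \<Rightarrow> complex"
  assumes "f differentiable (at x)"
  shows "(f has_derivative (\<lambda>h. \<Sum>i\<in>UNIV. of_real (h$i) * partial_deriv i f x)) (at x)"
proof -
  let ?D = "frechet_derivative f (at x)"
  have D: "(f has_derivative ?D) (at x)" using assms frechet_derivative_works by blast
  then have lin: "linear ?D" by (rule has_derivative_linear)
  have "?D h = (\<Sum>i\<in>UNIV. of_real (h$i) * partial_deriv i f x)" for h
  proof -
    have "h = (\<Sum>i\<in>UNIV. (h$i) *\<^sub>R axis i 1)"
      using basis_expansion[of h] by (simp add: scalar_mult_eq_scaleR)
    then have "?D h = ?D (\<Sum>i\<in>UNIV. (h$i) *\<^sub>R axis i 1)" by simp
    also have "\<dots> = (\<Sum>i\<in>UNIV. (h$i) *\<^sub>R ?D (axis i 1))"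
      by (simp add: linear_sum[OF lin] linear_scale[OF lin])
    finally show ?thesis by (simp add: partial_deriv_def scaleR_conv_of_real)
  qed
  then have "?D = (\<lambda>h. \<Sum>i\<in>UNIV. of_real (h$i) * partial_deriv i f x)" by blast
  with D show ?thesis by simp
qed

lemma smooth_differentiable: "open X \<Longrightarrow> f \<in> smooth_fns X \<Longrightarrow> x \<in> X \<Longrightarrow> f differentiable (at x)"
  using smooth_differentiable_at[of f X x "[]"] by simp

lemma smooth_continuous_on: "f \<in> smooth_fns X \<Longrightarrow> continuous_on X (iter_deriv is f)"
  unfolding smooth_fns_def using differentiable_imp_continuous_on by blast

section \<open>Algebra of smooth functions and their iterated derivatives\<close>

lemma partial_deriv_add:
  assumes "f differentiable (at x)" "g differentiable (at x)"
  shows "partial_deriv i (\<lambda>x. f x + g x) x = partial_deriv i f x + partial_deriv i g x"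
proof -
  from assms obtain F G where *: "(f has_derivative F) (at x)" "(g has_derivative G) (at x)"
    by (auto simp: differentiable_def)
  show ?thesis
    by (simp add: partial_deriv_eq[OF has_derivative_add[OF *]] partial_deriv_eq[OF *(1)]
      partial_deriv_eq[OF *(2)])
qed

lemma partial_deriv_mult:
  assumes "f differentiable (at x)" "g differentiable (at x)"
  shows "partial_deriv i (\<lambda>x. f x * g x) x = f x * partial_deriv i g x + partial_deriv i f x * g x"
proof -
  from assms obtain F G where *: "(f has_derivative F) (at x)" "(g has_derivative G) (at x)"
    by (auto simp: differentiable_def)
  show ?thesis
    using partial_deriv_eq[OF has_derivative_mult[OF *]] partial_deriv_eq[OF *(1)]
      partial_deriv_eq[OF *(2)] by simp
qed

lemma partial_deriv_const [simp]: "partial_deriv i (\<lambda>x. c) x = 0"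
  using partial_deriv_eq[OF has_derivative_const] by fastforce

lemma partial_deriv_cmult:
  assumes "f differentiable (at x)"
  shows "partial_deriv i (\<lambda>x. c * f x) x = c * partial_deriv i f x"
  using partial_deriv_mult[OF _ assms, of "\<lambda>x. c"] by simp

lemma smooth_const [simp]:
  assumes "open X"
  shows "(\<lambda>x. c) \<in> smooth_fns X"
  by (rule smooth_coinduct[where S="range (\<lambda>c x. c)", OF assms]) auto

lemma smooth_add:
  assumes X: "open X" and "f \<in> smooth_fns X" "g \<in> smooth_fns X"
  shows "(\<lambda>x. f x + g x) \<in> smooth_fns X"
proof (rule smooth_coinduct[where S="{(\<lambda>x. f x + g x) |f g. f \<in> smooth_fns X \<and> g \<in> smooth_fns X}", OF X])
  show "(\<lambda>x. f x + g x) \<in> {(\<lambda>x. f x + g x) |f g. f \<in> smooth_fns X \<and> g \<in> smooth_fns X}"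
    using assms by blast
next
  fix h x assume "h \<in> {(\<lambda>x. f x + g x) |f g. f \<in> smooth_fns X \<and> g \<in> smooth_fns X}" "x \<in> X"
  then show "h differentiable at x"
    using smooth_differentiable[OF X] by (auto intro!: differentiable_add)
next
  fix h i assume "h \<in> {(\<lambda>x. f x + g x) |f g. f \<in> smooth_fns X \<and> g \<in> smooth_fns X}"
  then obtain f g where h: "h = (\<lambda>x. f x + g x)" and fg: "f \<in> smooth_fns X" "g \<in> smooth_fns X" by blast
  then have "\<forall>x\<in>X. partial_deriv i h x = partial_deriv i f x + partial_deriv i g x"
    using partial_deriv_add smooth_differentiable[OF X] by blast
  with fg smooth_partial_deriv
  show "\<exists>g\<in>{(\<lambda>x. f x + g x) |f g. f \<in> smooth_fns X \<and> g \<in> smooth_fns X}. \<forall>x\<in>X. partial_deriv i h x = g x"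
    by (intro bexI[of _ "\<lambda>x. partial_deriv i f x + partial_deriv i g x"]) blast+
qed

text \<open>By the Leibniz rule products alone are not closed under differentiation; adding sums
  makes the family fit for \<open>smooth_coinduct\<close>.\<close>

inductive_set smooth_prods :: "(real^'n::finite) set \<Rightarrow> (real^'n \<Rightarrow> complex) set" for X where
  "f \<in> smooth_fns X \<Longrightarrow> g \<in> smooth_fns X \<Longrightarrow> (\<lambda>x. f x * g x) \<in> smooth_prods X"
| "f \<in> smooth_prods X \<Longrightarrow> g \<in> smooth_prods X \<Longrightarrow> (\<lambda>x. f x + g x) \<in> smooth_prods X"

lemma smooth_mult:
  assumes X: "open X" and "f \<in> smooth_fns X" "g \<in> smooth_fns X"
  shows "(\<lambda>x. f x * g x) \<in> smooth_fns X"
proof (rule smooth_coinduct[where S="smooth_prods X", OF X])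
  show "(\<lambda>x. f x * g x) \<in> smooth_prods X"
    using assms by (blast intro: smooth_prods.intros)
next
  have D: "h differentiable at x" if "h \<in> smooth_prods X" "x \<in> X" for h x
    using that
  proof (induction rule: smooth_prods.induct)
    case (1 f g)
    then show ?case
      using smooth_differentiable[OF X] by (auto intro!: differentiable_mult)
  next
    case (2 f g)
    then show ?case by (auto intro!: differentiable_add)
  qed
  show "h differentiable at x" if "h \<in> smooth_prods X" "x \<in> X" for h x using D that .
  show "\<exists>g\<in>smooth_prods X. \<forall>x\<in>X. partial_deriv i h x = g x" if "h \<in> smooth_prods X" for h i
    using that
  proof (induction rule: smooth_prods.induct)
    case (1 f g)
    show ?case
    proof (rule bexI[of _ "\<lambda>x. f x * partial_deriv i g x + partial_deriv i f x * g x"])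
      show "\<forall>x\<in>X. partial_deriv i (\<lambda>x. f x * g x) x = f x * partial_deriv i g x + partial_deriv i f x * g x"
        using 1 partial_deriv_mult smooth_differentiable[OF X] by blast
    qed (use 1 in \<open>auto intro!: smooth_prods.intros smooth_partial_deriv\<close>)
  next
    case (2 f g)
    then obtain f' g' where "f' \<in> smooth_prods X" "\<And>x. x \<in> X \<Longrightarrow> partial_deriv i f x = f' x"
      "g' \<in> smooth_prods X" "\<And>x. x \<in> X \<Longrightarrow> partial_deriv i g x = g' x" by blast
    with 2 show ?case
      by (intro bexI[of _ "\<lambda>x. f' x + g' x"]) (auto simp: partial_deriv_add D intro!: smooth_prods.intros)
  qed
qed

lemma smooth_cmult: "open X \<Longrightarrow> f \<in> smooth_fns X \<Longrightarrow> (\<lambda>x. c * f x) \<in> smooth_fns X"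
  by (intro smooth_mult) auto

lemma smooth_diff:
  "open X \<Longrightarrow> f \<in> smooth_fns X \<Longrightarrow> g \<in> smooth_fns X \<Longrightarrow> (\<lambda>x. f x - g x) \<in> smooth_fns X"
  using smooth_add[OF _ _ smooth_cmult[where c="-1"]] by fastforce

lemma smooth_sum:
  assumes "open X" "\<And>a. a \<in> A \<Longrightarrow> f a \<in> smooth_fns X"
  shows "(\<lambda>x. \<Sum>a\<in>A. f a x) \<in> smooth_fns X"
  using assms(2) by (induction A rule: infinite_finite_induct) (auto intro!: smooth_add smooth_const assms(1))

lemma smooth_prod:
  assumes "open X" "\<And>a. a \<in> A \<Longrightarrow> f a \<in> smooth_fns X"
  shows "(\<lambda>x. \<Prod>a\<in>A. f a x) \<in> smooth_fns X"
  using assms(2) by (induction A rule: infinite_finite_induct) (auto intro!: smooth_mult smooth_const assms(1))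

lemma iter_deriv_add:
  assumes X: "open X" and "f \<in> smooth_fns X" "g \<in> smooth_fns X" "x \<in> X"
  shows "iter_deriv is (\<lambda>x. f x + g x) x = iter_deriv is f x + iter_deriv is g x"
  using assms(4)
proof (induction "is" arbitrary: x)
  case (Cons i "is")
  have "partial_deriv i (iter_deriv is (\<lambda>x. f x + g x)) x
      = partial_deriv i (\<lambda>x. iter_deriv is f x + iter_deriv is g x) x"
    by (rule partial_deriv_cong[OF X]) (use Cons in auto)
  then show ?case
    using partial_deriv_add[of "iter_deriv is f" x "iter_deriv is g" i]
      smooth_differentiable_at[OF _ X Cons.prems] assms(2,3) by simp
qed simp

lemma iter_deriv_cmult:
  assumes X: "open X" and "f \<in> smooth_fns X" "x \<in> X"
  shows "iter_deriv is (\<lambda>x. c * f x) x = c * iter_deriv is f x"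
  using assms(3)
proof (induction "is" arbitrary: x)
  case (Cons i "is")
  have "partial_deriv i (iter_deriv is (\<lambda>x. c * f x)) x
      = partial_deriv i (\<lambda>x. c * iter_deriv is f x) x"
    by (rule partial_deriv_cong[OF X]) (use Cons in auto)
  then show ?case
    using partial_deriv_cmult[of "iter_deriv is f" x i c]
      smooth_differentiable_at[OF _ X Cons.prems] assms(2) by simp
qed simp

lemma iter_deriv_diff:
  assumes X: "open X" and "f \<in> smooth_fns X" "g \<in> smooth_fns X" "x \<in> X"
  shows "iter_deriv is (\<lambda>x. f x - g x) x = iter_deriv is f x - iter_deriv is g x"
  using iter_deriv_add[OF X assms(2) smooth_cmult[OF X assms(3), of "-1"] assms(4)]
    iter_deriv_cmult[OF X assms(3,4), of _ "-1"] by simp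

lemma iter_deriv_const: "iter_deriv is (\<lambda>x. 0) = (\<lambda>x. 0)"
  by (induction "is") auto

lemma iter_deriv_sum:
  assumes X: "open X" and "\<And>a. a \<in> A \<Longrightarrow> f a \<in> smooth_fns X" "x \<in> X"
  shows "iter_deriv is (\<lambda>x. \<Sum>a\<in>A. f a x) x = (\<Sum>a\<in>A. iter_deriv is (f a) x)"
  using assms(2)
  by (induction A rule: infinite_finite_induct)
    (simp_all add: iter_deriv_const iter_deriv_add[OF X _ smooth_sum[OF X] assms(3)])

lemma iter_deriv_zero_outside:
  assumes "closed K" "\<And>x. x \<notin> K \<Longrightarrow> f x = 0" "x \<notin> K"
  shows "iter_deriv is f x = 0"
  using iter_deriv_cong[of "-K" x f "\<lambda>x. 0"] assms by (simp add: iter_deriv_const open_Compl)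

lemma test_fns_in_iter_deriv:
  "closed K \<Longrightarrow> f \<in> test_fns_in K \<Longrightarrow> iter_deriv is f \<in> test_fns_in K"
  by (simp add: test_fns_in_def iter_deriv_smooth iter_deriv_zero_outside)

lemma test_fns_in_partial_deriv:
  "closed K \<Longrightarrow> f \<in> test_fns_in K \<Longrightarrow> partial_deriv i f \<in> test_fns_in K"
  using test_fns_in_iter_deriv[of K f "[i]"] by simp

text \<open>\<open>f\<close> is arbitrary off \<open>X\<close>, but the product vanishes off
  \<open>K\<close>; smoothness is glued from the open cover of the space by \<open>X\<close> and
  \<open>- K\<close>.\<close>

lemma smooth_mult_test:
  assumes "open X" "closed K" "K \<subseteq> X" "f \<in> smooth_fns X" "\<psi> \<in> test_fns_in K"
  shows "(\<lambda>x. f x * \<psi> x) \<in> test_fns_in K"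
proof -
  have *: "\<psi> \<in> smooth_fns UNIV" "\<And>x. x \<notin> K \<Longrightarrow> \<psi> x = 0" using assms by (auto simp: test_fns_in_def)
  have "(\<lambda>x. f x * \<psi> x) \<in> smooth_fns X"
    using assms smooth_subset[OF *(1)] by (intro smooth_mult) auto
  moreover have "(\<lambda>x. f x * \<psi> x) \<in> smooth_fns (- K)"
    by (rule smooth_cong[of _ "\<lambda>x. 0"]) (use assms * in \<open>auto intro!: smooth_const\<close>)
  ultimately have "(\<lambda>x. f x * \<psi> x) \<in> smooth_fns (X \<union> - K)"
    using assms by (intro smooth_Un) auto
  moreover have "X \<union> - K = UNIV" using assms by auto
  ultimately show ?thesis using * by (simp add: test_fns_in_def)
qed

lemma smooth_coord:
  assumes D: "\<And>n t. (D n has_vector_derivative D (Suc n) t) (at t)"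
  shows "(\<lambda>x::real^'n::finite. D 0 (x$i)) \<in> smooth_fns UNIV"
proof -
  \<comment> \<open>The zero function is the partial derivative in every coordinate other than
    \<open>i\<close>.\<close>
  define S where "S = insert (\<lambda>x. 0) (range (\<lambda>n (x::real^'n). D n (x$i)))"
  have der: "((\<lambda>x::real^'n. D n (x$i)) has_derivative (\<lambda>h. (h$i) *\<^sub>R D (Suc n) (x$i))) (at x)" for n x
  proof -
    have "((\<lambda>x::real^'n. x$i) has_derivative (\<lambda>h. h$i)) (at x)"
      by (rule bounded_linear_imp_has_derivative[OF bounded_linear_vec_nth])
    from has_derivative_compose[OF this D[of n "x$i", unfolded has_vector_derivative_def]]
    show ?thesis .
  qed
  show ?thesis
  proof (rule smooth_coinduct[where S=S])
    show "f differentiable at x" if "f \<in> S" for f x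
      using that der unfolding S_def differentiable_def by (auto intro: has_derivative_const)
    show "\<exists>g\<in>S. \<forall>x\<in>UNIV. partial_deriv j f x = g x" if f: "f \<in> S" for f j
    proof (cases "f = (\<lambda>x. 0)")
      case True
      then show ?thesis by (intro bexI[of _ "\<lambda>x. 0"]) (auto simp: S_def)
    next
      case False
      then obtain n where n: "f = (\<lambda>x. D n (x$i))" using f by (auto simp: S_def)
      have "partial_deriv j f x = (if j = i then D (Suc n) (x$i) else 0)" for x
        unfolding n by (subst partial_deriv_eq[OF der]) (auto simp: axis_def)
      then show ?thesis
        by (cases "j = i") (auto simp: S_def)
    qed
  qed (auto simp: S_def)
qed

section \<open>Mollifiers\<close>

text \<open>The class of functions \<open>p (1/t) exp (-1/t)\<close>, extended by 0 to \<open>t \<le> 0\<close>, is closed under differentiation.\<close>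

definition flat_fn :: "real poly \<Rightarrow> real \<Rightarrow> real" where
  "flat_fn p t = (if t > 0 then poly p (1/t) * exp (-1/t) else 0)"

lemma flat_fn_tendsto_0: "((\<lambda>t. poly p (1/t) * exp (-1/t)) \<longlongrightarrow> 0) (at_right (0::real))"
proof -
  have "((\<lambda>s::real. s ^ k / exp s) \<longlongrightarrow> 0) at_top" for k
    by (rule tendsto_power_div_exp_0)
  then have "((\<lambda>s. \<Sum>k\<le>degree p. coeff p k * (s ^ k / exp s)) \<longlongrightarrow> (\<Sum>k\<le>degree p. coeff p k * 0)) at_top"
    by (intro tendsto_sum tendsto_mult tendsto_const)
  then have *: "((\<lambda>s. poly p s * exp (-s)) \<longlongrightarrow> 0) at_top"
    by (simp add: poly_altdef exp_minus field_simps sum_distrib_right sum_divide_distrib)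
  have "((\<lambda>t. poly p (inverse t) * exp (-inverse t)) \<longlongrightarrow> 0) (at_right 0)"
    by (rule filterlim_compose[OF * filterlim_inverse_at_top_right])
  then show ?thesis by (simp add: inverse_eq_divide)
qed

text \<open>With s = 1/t the chain rule turns p(s) exp(-s) into s^2 (p(s) - p'(s)) exp(-s). At 0 the
  right-hand difference quotient is again of the flat form, for the polynomial s p(s), and so tends
  to 0.\<close>

lemma flat_fn_deriv:
  "(flat_fn p has_real_derivative flat_fn ([:0,0,1:] * (p - pderiv p)) t) (at t)"
proof -
  consider "t > 0" | "t < 0" | "t = 0" by linarith
  then show ?thesis
  proof cases
    case 1
    have "((\<lambda>t. poly p (1/t) * exp (-1/t)) has_real_derivative
       poly ([:0,0,1:] * (p - pderiv p)) (1/t) * exp (-1/t)) (at t)"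
      using 1 by (auto intro!: derivative_eq_intros poly_DERIV[THEN DERIV_chain2]
          simp: field_simps power2_eq_square)
    then have "((\<lambda>t. poly p (1/t) * exp (-1/t)) has_real_derivative
       flat_fn ([:0,0,1:] * (p - pderiv p)) t) (at t)"
      using 1 by (simp only: flat_fn_def if_True)
    then show ?thesis
      by (rule has_field_derivative_transform_within_open[where S="{0<..}"])
        (use 1 in \<open>auto simp: flat_fn_def\<close>)
  next
    case 2
    have "((\<lambda>t. 0) has_real_derivative flat_fn ([:0,0,1:] * (p - pderiv p)) t) (at t)"
      using 2 by (simp add: flat_fn_def)
    then show ?thesis
      by (rule has_field_derivative_transform_within_open[where S="{..<0}"])
        (use 2 in \<open>auto simp: flat_fn_def\<close>)
  next
    case 3
    have "((\<lambda>h. (flat_fn p (0 + h) - flat_fn p 0) / h) \<longlongrightarrow> 0) (at_right 0)"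
    proof (rule Lim_transform_eventually[OF flat_fn_tendsto_0[of "[:0,1:] * p"]])
      show "\<forall>\<^sub>F h in at_right 0. poly ([:0, 1:] * p) (1 / h) * exp (- 1 / h)
        = (flat_fn p (0 + h) - flat_fn p 0) / h"
        by (auto simp: eventually_at_filter flat_fn_def)
    qed
    moreover have "((\<lambda>h. (flat_fn p (0 + h) - flat_fn p 0) / h) \<longlongrightarrow> 0) (at_left 0)"
      by (rule Lim_transform_eventually[OF tendsto_const])
        (auto simp: eventually_at_filter flat_fn_def)
    ultimately have "((\<lambda>h. (flat_fn p (0 + h) - flat_fn p 0) / h) \<longlongrightarrow> 0) (at 0)"
      by (simp add: filterlim_at_split)
    then show ?thesis using 3 by (simp add: DERIV_def flat_fn_def)
  qed
qed

lemma flat_fn_smooth: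
  fixes i :: "'n::finite"
  assumes "s = 1 \<or> s = -1"
  shows "(\<lambda>x::real^'n. complex_of_real (flat_fn p (1 + s * x$i))) \<in> smooth_fns UNIV"
proof -
  define q where "q n = ((\<lambda>p. [:0,0,1:] * (p - pderiv p)) ^^ n) p" for n
  define D where "D n t = complex_of_real (s ^ n * flat_fn (q n) (1 + s * t))" for n t
  have "(D n has_vector_derivative D (Suc n) t) (at t)" for n t
  proof -
    have "((\<lambda>t. s ^ n * flat_fn (q n) (1 + s * t)) has_real_derivative
      s ^ n * (flat_fn (q (Suc n)) (1 + s * t) * s)) (at t)"
      unfolding q_def by (auto intro!: derivative_eq_intros flat_fn_deriv[THEN DERIV_chain2])
    then have "((\<lambda>t. s ^ n * flat_fn (q n) (1 + s * t)) has_real_derivative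
      s ^ Suc n * flat_fn (q (Suc n)) (1 + s * t)) (at t)"
      by (simp add: mult_ac)
    then show ?thesis
      unfolding D_def by (rule has_vector_derivative_of_real)
  qed
  from smooth_coord[of D, OF this] show ?thesis
    by (simp add: D_def q_def)
qed

lemma ex_bump:
  "\<exists>b::real^'n::finite \<Rightarrow> real. (\<lambda>x. complex_of_real (b x)) \<in> test_fns_in (cbox (\<chi> i. -1) (\<chi> i. 1)) \<and>
     (\<forall>x. b x \<ge> 0) \<and> (\<forall>x\<in>box (\<chi> i. -1) (\<chi> i. 1). b x > 0)"
proof -
  define b :: "real^'n \<Rightarrow> real" where "b x = (\<Prod>i\<in>UNIV. flat_fn 1 (1 + 1 * x$i) * flat_fn 1 (1 + (-1) * x$i))" for x
  have "(\<lambda>x. \<Prod>i\<in>UNIV. complex_of_real (flat_fn 1 (1 + 1 * x$i)) * complex_of_real (flat_fn 1 (1 + (-1) * x$i)))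
      \<in> smooth_fns (UNIV :: (real^'n) set)"
    by (intro smooth_prod smooth_mult flat_fn_smooth) auto
  then have "(\<lambda>x. complex_of_real (b x)) \<in> smooth_fns UNIV"
    by (simp add: b_def)
  moreover have "b x = 0" if "x \<notin> cbox (\<chi> i. -1) (\<chi> i. 1)" for x
  proof -
    from that obtain i where "x$i < -1 \<or> x$i > 1" by (auto simp: mem_box_cart not_le)
    then have "flat_fn 1 (1 + 1 * x$i) * flat_fn 1 (1 + (-1) * x$i) = 0"
      by (auto simp: flat_fn_def)
    then show ?thesis unfolding b_def by (intro prod_zero bexI[of _ i]) simp_all
  qed
  moreover have "b x \<ge> 0" for x unfolding b_def by (intro prod_nonneg) (auto simp: flat_fn_def)
  moreover have "b x > 0" if "x \<in> box (\<chi> i. -1) (\<chi> i. 1)" for x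
  proof -
    have "0 < 1 + 1 * x$i \<and> 0 < 1 + (-1) * x$i" for i
      using that by (simp add: mem_box_cart) (smt (verit))
    then show ?thesis unfolding b_def by (intro prod_pos) (simp add: flat_fn_def)
  qed
  ultimately show ?thesis by (intro exI[of _ b]) (auto simp: test_fns_in_def)
qed

section \<open>Integration by parts and convolution\<close>

lemma lborel_integral_affine:
  fixes f :: "'a::euclidean_space \<Rightarrow> 'b::{banach, second_countable_topology}"
  assumes "f \<in> borel_measurable borel" "c \<noteq> 0"
  shows "(LINT x|lborel. f x) = \<bar>c\<bar> ^ DIM('a) *\<^sub>R (LINT x|lborel. f (t + c *\<^sub>R x))"
proof -
  have "(LINT x|lborel. f x)
      = integral\<^sup>L (density (distr lborel borel (\<lambda>x. t + c *\<^sub>R x)) (\<lambda>_. \<bar>c\<bar>^DIM('a))) f"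
    using lborel_affine[OF assms(2), of t] by simp
  also have "\<dots> = (LINT x|lborel. \<bar>c\<bar>^DIM('a) *\<^sub>R f (t + c *\<^sub>R x))"
    using assms(1) by (subst integral_density) (auto simp: integral_distr)
  finally show ?thesis by simp
qed

lemma integrable_compact_support:
  fixes f :: "'a::euclidean_space \<Rightarrow> 'b::{banach, second_countable_topology}"
  assumes "compact K" "continuous_on K f" "\<And>x. x \<notin> K \<Longrightarrow> f x = 0"
  shows "integrable lborel f"
proof -
  have "integrable lborel (\<lambda>x. indicator K x *\<^sub>R f x)"
    by (rule borel_integrable_compact[OF assms(1,2)])
  moreover have "(\<lambda>x. indicator K x *\<^sub>R f x) = f"
    using assms(3) by (auto simp: indicator_def)
  ultimately show ?thesis by simp
qed

section \<open>Test functions: bounds, Lipschitz estimates and Taylor remainders\<close>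

lemma test_continuous: "\<phi> \<in> test_fns_in K \<Longrightarrow> continuous_on UNIV \<phi>"
  using smooth_continuous_on[of \<phi> UNIV "[]"] by (simp add: test_fns_in_def)

lemma test_measurable: "\<phi> \<in> test_fns_in K \<Longrightarrow> \<phi> \<in> borel_measurable borel"
  using test_continuous borel_measurable_continuous_onI by blast

lemma test_integrable:
  assumes "compact K" "\<phi> \<in> test_fns_in K"
  shows "integrable lborel \<phi>"
  using assms continuous_on_subset[OF test_continuous[OF assms(2)], of K]
  by (intro integrable_compact_support[of K]) (auto simp: test_fns_in_def)

lemma test_differentiable: "\<phi> \<in> test_fns_in K \<Longrightarrow> \<phi> differentiable (at x)"
  using smooth_differentiable[of UNIV] by (auto simp: test_fns_in_def)

lemma test_bounded:
  assumes "compact K" "\<phi> \<in> test_fns_in K"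
  shows "\<exists>B\<ge>0. \<forall>x. norm (\<phi> x) \<le> B"
proof -
  have "compact (\<phi> ` K)"
    using assms test_continuous continuous_on_subset compact_continuous_image by (metis subset_UNIV)
  then obtain B where "\<And>x. x \<in> K \<Longrightarrow> norm (\<phi> x) \<le> B" "B > 0"
    using compact_imp_bounded bounded_pos by (metis imageI)
  then show ?thesis using assms(2) by (intro exI[of _ B]) (force simp: test_fns_in_def)
qed

lemma test_bounded_deriv:
  assumes "compact K" "\<phi> \<in> test_fns_in K"
  shows "\<exists>B\<ge>0. \<forall>x. norm (iter_deriv is \<phi> x) \<le> B"
  using test_bounded[OF assms(1) test_fns_in_iter_deriv[OF compact_imp_closed assms(2)]] assms(1) by blast

lemma norm_linear_comb_le:
  fixes c :: "'n::finite \<Rightarrow> complex"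
  shows "norm (\<Sum>i\<in>UNIV. of_real (h$i) * c i) \<le> (\<Sum>i\<in>UNIV. norm (c i)) * norm (h::real^'n)"
proof -
  have "norm (\<Sum>i\<in>UNIV. of_real (h$i) * c i) \<le> (\<Sum>i\<in>UNIV. \<bar>h$i\<bar> * norm (c i))"
    by (rule order_trans[OF norm_sum]) (simp add: norm_mult)
  also have "\<dots> \<le> (\<Sum>i\<in>UNIV. norm (c i) * norm h)"
    by (intro sum_mono) (simp add: mult.commute[of "norm (c _)"] component_le_norm_cart mult_right_mono)
  finally show ?thesis by (simp add: sum_distrib_right)
qed

lemma bounded_linear_comb:
  fixes c :: "'n::finite \<Rightarrow> complex"
  shows "bounded_linear (\<lambda>h::real^'n. \<Sum>i\<in>UNIV. of_real (h$i) * c i)"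
  by (intro bounded_linear_sum bounded_linear_mult_const
      bounded_linear_compose[OF bounded_linear_of_real bounded_linear_vec_nth])

lemma differentiable_Lipschitz:
  fixes f :: "real^'n::finite \<Rightarrow> complex"
  assumes "convex S" "\<And>x. x \<in> S \<Longrightarrow> f differentiable (at x)"
    "\<And>x i. x \<in> S \<Longrightarrow> norm (partial_deriv i f x) \<le> B" "x \<in> S" "y \<in> S"
  shows "norm (f x - f y) \<le> real CARD('n) * B * norm (x - y)"
proof (rule differentiable_bound[OF assms(1) _ _ assms(4,5)])
  show "(f has_derivative (\<lambda>h. \<Sum>i\<in>UNIV. of_real (h$i) * partial_deriv i f x)) (at x within S)"
    if "x \<in> S" for x
    using smooth_has_derivative[OF assms(2)[OF that]] has_derivative_at_withinI by blast
  show "onorm (\<lambda>h. \<Sum>i\<in>UNIV. of_real (h$i) * partial_deriv i f x) \<le> real CARD('n) * B" if "x \<in> S" for x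
  proof (rule onorm_le)
    fix h :: "real^'n"
    have "(\<Sum>i\<in>UNIV. norm (partial_deriv i f x)) \<le> (\<Sum>i\<in>(UNIV::'n set). B)"
      using assms(3)[OF that] by (intro sum_mono) auto
    then show "norm (\<Sum>i\<in>UNIV. of_real (h$i) * partial_deriv i f x) \<le> real CARD('n) * B * norm h"
      by (intro order_trans[OF norm_linear_comb_le] mult_right_mono) auto
  qed
qed

text \<open>Compact support bounds all second derivatives, so the remainder is uniform in
  \<open>x\<close>. This is the form in which \<open>has_derivative_integral_param\<close> is
  applied to convolutions.\<close>

lemma test_taylor:
  fixes \<phi> :: "real^'n::finite \<Rightarrow> complex"
  assumes K: "compact K" and \<phi>: "\<phi> \<in> test_fns_in K"
  shows "\<exists>C\<ge>0. \<forall>x h. norm (\<phi> (x+h) - \<phi> x - (\<Sum>i\<in>UNIV. of_real (h$i) * partial_deriv i \<phi> x)) \<le> C * (norm h)\<^sup>2"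
proof -
  have "\<forall>i j. \<exists>B\<ge>0. \<forall>x. norm (partial_deriv j (partial_deriv i \<phi>) x) \<le> B"
    using test_bounded_deriv[OF assms, of "[j, i]" for i j] by simp
  then obtain B where B: "\<And>i j. B i j \<ge> 0" "\<And>i j x. norm (partial_deriv j (partial_deriv i \<phi>) x) \<le> B i j"
    by metis
  define B' where "B' = (\<Sum>i\<in>UNIV. \<Sum>j\<in>UNIV. B i j)"
  have B': "norm (partial_deriv j (partial_deriv i \<phi>) x) \<le> B'" for i j x
  proof -
    have "B i j \<le> (\<Sum>j\<in>UNIV. B i j)" using B(1) by (intro member_le_sum) auto
    also have "\<dots> \<le> B'" unfolding B'_def using B(1)
      by (intro member_le_sum[where f="\<lambda>i. \<Sum>j\<in>UNIV. B i j"] sum_nonneg) auto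
    finally show ?thesis using B(2) order_trans by blast
  qed
  have "B' \<ge> 0" using B' norm_ge_zero order_trans by blast
  define L where "L = real CARD('n) * B'"
  have "L \<ge> 0" using \<open>B' \<ge> 0\<close> by (simp add: L_def)
  have lip: "norm (partial_deriv i \<phi> x - partial_deriv i \<phi> y) \<le> L * norm (x - y)" for i x y
    unfolding L_def
    by (rule differentiable_Lipschitz[of UNIV])
      (use B' test_differentiable[OF test_fns_in_partial_deriv[OF compact_imp_closed[OF K] \<phi>]] in auto)
  show ?thesis
  proof (intro exI[of _ "real CARD('n) * L"] conjI allI)
    fix x h :: "real^'n"
    let ?D = "\<lambda>x h. \<Sum>i\<in>UNIV. of_real (h$i) * partial_deriv i \<phi> x"
    have "norm (\<phi> (x + h) - \<phi> x - ?D x ((x + h) - x)) \<le> norm ((x + h) - x) * (real CARD('n) * L * norm h)"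
    proof (rule differentiable_bound_linearization[where S="cball x (norm h)"])
      show "x + t *\<^sub>R (x + h - x) \<in> cball x (norm h)" if "t \<in> {0..1}" for t
        using that by (auto simp: dist_norm intro: mult_left_le_one_le)
      show "(\<phi> has_derivative ?D y) (at y within cball x (norm h))" for y
        using smooth_has_derivative[OF test_differentiable[OF \<phi>]] has_derivative_at_withinI by blast
      show "onorm (?D y - ?D x) \<le> real CARD('n) * L * norm h" if "y \<in> cball x (norm h)" for y
      proof (rule onorm_le)
        fix k :: "real^'n"
        have "norm ((?D y - ?D x) k) = norm (\<Sum>i\<in>UNIV. of_real (k$i) * (partial_deriv i \<phi> y - partial_deriv i \<phi> x))"
          by (simp add: sum_subtractf algebra_simps)
        also have "\<dots> \<le> (\<Sum>i\<in>UNIV. norm (partial_deriv i \<phi> y - partial_deriv i \<phi> x)) * norm k"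
          by (rule norm_linear_comb_le)
        also have "\<dots> \<le> (\<Sum>i\<in>(UNIV::'n set). L * norm h) * norm k"
        proof (intro mult_right_mono sum_mono order_trans[OF lip] mult_left_mono)
          show "norm (y - x) \<le> norm h" using that by (simp add: dist_norm norm_minus_commute)
        qed (use \<open>L \<ge> 0\<close> in auto)
        finally show "norm ((?D y - ?D x) k) \<le> real CARD('n) * L * norm h * norm k" by simp
      qed
    qed auto
    then show "norm (\<phi> (x + h) - \<phi> x - ?D x h) \<le> real CARD('n) * L * (norm h)\<^sup>2"
      by (simp add: power2_eq_square mult_ac)
  qed (use \<open>L \<ge> 0\<close> in auto)
qed

text \<open>A remainder of order |h|^2 with an integrable factor integrates to o(|h|), so the
  derivative passes under the integral with no limit theorem. The weight \<open>w\<close> may depend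
  on the base point \<open>x\<close>.\<close>

lemma has_derivative_integral_param:
  fixes k :: "real^'n::finite \<Rightarrow> 'b::euclidean_space \<Rightarrow> complex"
  assumes k: "\<And>x. integrable N (k x)" and k': "\<And>i. integrable N (k' i)" and w: "integrable N w"
    and rem: "\<And>h y. norm h \<le> 1 \<Longrightarrow>
      norm (k (x + h) y - k x y - (\<Sum>i\<in>UNIV. of_real (h$i) * k' i y)) \<le> (norm h)\<^sup>2 * w y"
  shows "((\<lambda>x. LINT y|N. k x y) has_derivative
    (\<lambda>h. \<Sum>i\<in>UNIV. of_real (h$i) * (LINT y|N. k' i y))) (at x)"
  unfolding has_derivative_at_alt
proof (intro conjI bounded_linear_comb allI impI)
  fix e :: real assume e: "e > 0"
  define W where "W = (LINT y|N. w y)"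
  have rem': "norm ((LINT y|N. k (x + h) y) - (LINT y|N. k x y) - (\<Sum>i\<in>UNIV. of_real (h$i) * (LINT y|N. k' i y)))
      \<le> (norm h)\<^sup>2 * W" if "norm h \<le> 1" for h
  proof -
    have "(LINT y|N. k (x + h) y) - (LINT y|N. k x y) - (\<Sum>i\<in>UNIV. of_real (h$i) * (LINT y|N. k' i y))
       = (LINT y|N. (k (x + h) y - k x y - (\<Sum>i\<in>UNIV. of_real (h$i) * k' i y)))"
      using k k' by simp
    also have "norm \<dots> \<le> (LINT y|N. (norm h)\<^sup>2 * w y)"
      by (rule Bochner_Integration.integral_norm_bound_integral) (use rem[OF that] k k' w in auto)
    finally show ?thesis by (simp add: W_def)
  qed
  define d where "d = min 1 (e / (\<bar>W\<bar> + 1))"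
  show "\<exists>d>0. \<forall>y. norm (y - x) < d \<longrightarrow>
      norm ((LINT z|N. k y z) - (LINT z|N. k x z) - (\<Sum>i\<in>UNIV. of_real ((y - x)$i) * (LINT y|N. k' i y)))
      \<le> e * norm (y - x)"
  proof (intro exI[of _ d] conjI allI impI)
    fix y assume y: "norm (y - x) < d"
    have *: "norm ((LINT z|N. k y z) - (LINT z|N. k x z) - (\<Sum>i\<in>UNIV. of_real ((y - x)$i) * (LINT y|N. k' i y)))
       \<le> (norm (y - x))\<^sup>2 * W"
      using rem'[of "y - x"] y by (simp add: d_def)
    have "norm (y - x) * (\<bar>W\<bar> + 1) \<le> e"
      using y by (simp add: d_def field_simps)
    then have "norm (y - x) * W \<le> e"
      by (smt (verit) mult_left_mono norm_ge_zero)
    then have "(norm (y - x))\<^sup>2 * W \<le> e * norm (y - x)"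
      unfolding power2_eq_square by (metis mult.assoc mult.commute mult_left_mono norm_ge_zero)
    with * show "norm ((LINT z|N. k y z) - (LINT z|N. k x z) - (\<Sum>i\<in>UNIV. of_real ((y - x)$i) * (LINT y|N. k' i y)))
      \<le> e * norm (y - x)" by linarith
  qed (use e in \<open>auto simp: d_def\<close>)
qed

lemma smooth_affine:
  fixes \<phi> :: "real^'n::finite \<Rightarrow> complex"
  assumes "\<phi> \<in> smooth_fns UNIV"
  shows "(\<lambda>y. \<phi> (a + c *\<^sub>R y)) \<in> smooth_fns UNIV"
    and "iter_deriv is (\<lambda>y. \<phi> (a + c *\<^sub>R y)) y = of_real c ^ length is * iter_deriv is \<phi> (a + c *\<^sub>R y)"
proof -
  have der: "((\<lambda>y. \<psi> (a + c *\<^sub>R y)) has_derivative (\<lambda>h. frechet_derivative \<psi> (at (a + c *\<^sub>R y)) (c *\<^sub>R h))) (at y)"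
    if "\<psi> \<in> smooth_fns UNIV" for \<psi> y
  proof (rule has_derivative_compose[where f="\<lambda>y. a + c *\<^sub>R y" and g=\<psi>])
    show "((\<lambda>y. a + c *\<^sub>R y) has_derivative (*\<^sub>R) c) (at y)"
      by (auto intro!: derivative_eq_intros)
    show "(\<psi> has_derivative frechet_derivative \<psi> (at (a + c *\<^sub>R y))) (at (a + c *\<^sub>R y))"
      using smooth_differentiable[OF _ that] frechet_derivative_works by blast
  qed
  have pd: "partial_deriv i (\<lambda>y. \<psi> (a + c *\<^sub>R y)) y = of_real c * partial_deriv i \<psi> (a + c *\<^sub>R y)"
    if "\<psi> \<in> smooth_fns UNIV" for \<psi> y i
  proof -
    have lin: "linear (frechet_derivative \<psi> (at (a + c *\<^sub>R y)))"
      using smooth_differentiable[OF _ that] linear_frechet_derivative by blast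
    have "partial_deriv i (\<lambda>y. \<psi> (a + c *\<^sub>R y)) y = c *\<^sub>R partial_deriv i \<psi> (a + c *\<^sub>R y)"
      unfolding partial_deriv_eq[OF der[OF that]] partial_deriv_def[of i \<psi>] by (rule linear_scale[OF lin])
    then show ?thesis by (simp only: scaleR_conv_of_real)
  qed
  define S where "S = {\<lambda>y. b * \<psi> (a + c *\<^sub>R y) |b \<psi>. \<psi> \<in> smooth_fns (UNIV :: (real^'n) set)}"
  show "(\<lambda>y. \<phi> (a + c *\<^sub>R y)) \<in> smooth_fns UNIV"
  proof (rule smooth_coinduct[where S=S])
    show "(\<lambda>y. \<phi> (a + c *\<^sub>R y)) \<in> S"
      unfolding S_def using assms by (intro CollectI exI[of _ 1] exI[of _ \<phi>]) auto
    fix f assume f: "f \<in> S"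
    obtain b \<psi> where *: "f = (\<lambda>y. b * \<psi> (a + c *\<^sub>R y))" "\<psi> \<in> smooth_fns UNIV"
      using f unfolding S_def by blast
    have d: "(\<lambda>y. \<psi> (a + c *\<^sub>R y)) differentiable at x" for x
      using der[OF *(2)] unfolding differentiable_def by blast
    show "f differentiable at x" for x
      unfolding *(1) using d by (intro differentiable_mult) auto
    have "partial_deriv i f x = (b * of_real c) * partial_deriv i \<psi> (a + c *\<^sub>R x)" for x i
      unfolding *(1) by (simp add: partial_deriv_cmult[OF d] pd[OF *(2)])
    moreover have "(\<lambda>x. (b * of_real c) * partial_deriv i \<psi> (a + c *\<^sub>R x)) \<in> S" for i
      unfolding S_def using smooth_partial_deriv[OF *(2)] by blast
    ultimately show "\<exists>g\<in>S. \<forall>x\<in>UNIV. partial_deriv i f x = g x" for i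
      by (intro bexI[of _ "\<lambda>x. (b * of_real c) * partial_deriv i \<psi> (a + c *\<^sub>R x)"]) auto
  qed auto
  show "iter_deriv is (\<lambda>y. \<phi> (a + c *\<^sub>R y)) y = of_real c ^ length is * iter_deriv is \<phi> (a + c *\<^sub>R y)"
  proof (induction "is" arbitrary: y)
    case (Cons i "is")
    have s: "iter_deriv is \<phi> \<in> smooth_fns UNIV" using assms iter_deriv_smooth by blast
    have "iter_deriv is (\<lambda>y. \<phi> (a + c *\<^sub>R y))
      = (\<lambda>y. of_real c ^ length is * iter_deriv is \<phi> (a + c *\<^sub>R y))"
      using Cons by blast
    then have "iter_deriv (i # is) (\<lambda>y. \<phi> (a + c *\<^sub>R y)) y
      = partial_deriv i (\<lambda>y. of_real c ^ length is * iter_deriv is \<phi> (a + c *\<^sub>R y)) y"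
      by simp
    also have "\<dots> = of_real c ^ length is * partial_deriv i (\<lambda>y. iter_deriv is \<phi> (a + c *\<^sub>R y)) y"
      by (rule partial_deriv_cmult) (use der[OF s] in \<open>auto simp: differentiable_def\<close>)
    finally show ?case by (simp add: pd[OF s])
  qed simp
qed

lemma test_fns_in_affine:
  fixes \<phi> :: "real^'n::finite \<Rightarrow> complex"
  assumes "\<phi> \<in> test_fns_in K" "\<And>y. a + c *\<^sub>R y \<in> K \<Longrightarrow> y \<in> K'"
  shows "(\<lambda>y. \<phi> (a + c *\<^sub>R y)) \<in> test_fns_in K'"
  using assms smooth_affine(1)[of \<phi> a c] by (auto simp: test_fns_in_def)

text \<open>By translation invariance the integral of every difference quotient vanishes.\<close>

lemma integral_partial_deriv_eq_0:
  fixes g :: "real^'n::finite \<Rightarrow> complex"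
  assumes K: "compact K" and g: "g \<in> test_fns_in K"
  shows "(LINT x|lborel. partial_deriv i g x) = 0"
proof -
  obtain R where R: "K \<subseteq> cball 0 R" "R > 0"
    using compact_imp_bounded[OF K] unfolding bounded_pos by (auto simp: subset_iff)
  obtain B where B: "B \<ge> 0" "\<And>x. norm (partial_deriv i g x) \<le> B"
    using test_bounded[OF K test_fns_in_partial_deriv[OF compact_imp_closed[OF K] g]] by blast
  define s where "s n y = of_real (real (Suc n)) * (g (axis i (1 / real (Suc n)) + y) - g y)" for n y
  have ax: "axis i t = t *\<^sub>R axis i (1::real)" for t by (simp add: vec_eq_iff axis_def)
  have int: "integrable lborel (\<lambda>y. g (axis i t + y))" for t
  proof (rule test_integrable)
    show "compact ((+) (- axis i t) ` K)" by (rule compact_translation[OF K])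
    show "(\<lambda>y. g (axis i t + y)) \<in> test_fns_in ((+) (- axis i t) ` K)"
      using test_fns_in_affine[OF g, of "axis i t" 1 "(+) (- axis i t) ` K"]
      by (force intro: rev_image_eqI)
  qed
  have s0: "(LINT y|lborel. s n y) = 0" for n
  proof -
    have "(LINT y|lborel. g y) = (LINT y|lborel. g (axis i (1 / real (Suc n)) + y))"
      using lborel_integral_affine[OF test_measurable[OF g], of 1 "axis i (1 / real (Suc n))"] by simp
    then show ?thesis unfolding s_def
      using int test_integrable[OF K g] by simp
  qed
  have "(\<lambda>n. LINT y|lborel. s n y) \<longlonglongrightarrow> (LINT y|lborel. partial_deriv i g y)"
  \<comment> \<open>The shifts have length at most 1, so all difference quotients are supported in
    one ball of radius \<open>R + 1\<close>; the mean value inequality bounds them by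
    \<open>B\<close>.\<close>
  proof (rule integral_dominated_convergence[where w="\<lambda>y. B * indicator (cball 0 (R+1)) y"])
    show "partial_deriv i g \<in> borel_measurable lborel"
      using test_measurable[OF test_fns_in_partial_deriv[OF compact_imp_closed[OF K] g]] by simp
    show "s n \<in> borel_measurable lborel" for n
      unfolding s_def using int[of "1 / real (Suc n)"] test_integrable[OF K g] by measurable
    show "integrable lborel (\<lambda>y. B * indicator (cball 0 (R+1)) y)"
      by (intro integrable_mult_right integrable_real_indicator)
        (use emeasure_lborel_cball_finite in auto)
    show "AE y in lborel. (\<lambda>n. s n y) \<longlonglongrightarrow> partial_deriv i g y"
    proof (rule AE_I2)
      fix y
      let ?p = "\<lambda>t::real. g (y + t *\<^sub>R axis i 1)"
      have "(?p has_vector_derivative partial_deriv i g (y + 0 *\<^sub>R axis i 1)) (at 0)"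
        by (rule has_derivative_along[OF test_differentiable[OF g]])
      then have "((\<lambda>h. norm (?p h - ?p 0 - h *\<^sub>R partial_deriv i g y) / \<bar>h\<bar>) \<longlongrightarrow> 0) (at 0)"
        by (simp add: has_vector_derivative_def has_derivative_at diff_diff_eq)
      then have "((\<lambda>h. norm ((?p (0 + h) - ?p 0) /\<^sub>R h - partial_deriv i g y)) \<longlongrightarrow> 0) (at 0)"
      proof (rule Lim_transform_eventually)
        have "norm (?p h - ?p 0 - h *\<^sub>R partial_deriv i g y) / \<bar>h\<bar>
          = norm ((?p (0 + h) - ?p 0) /\<^sub>R h - partial_deriv i g y)" if "h \<noteq> 0" for h
        proof -
          have "(?p (0 + h) - ?p 0) /\<^sub>R h - partial_deriv i g y
            = (?p h - ?p 0 - h *\<^sub>R partial_deriv i g y) /\<^sub>R h"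
            using that by (simp add: scaleR_diff_right)
          then show ?thesis by (simp only: norm_scaleR abs_inverse) (simp add: divide_inverse mult.commute)
        qed
        then show "\<forall>\<^sub>F h in at 0. norm (?p h - ?p 0 - h *\<^sub>R partial_deriv i g y) / \<bar>h\<bar>
          = norm ((?p (0 + h) - ?p 0) /\<^sub>R h - partial_deriv i g y)"
          by (simp add: eventually_at_filter)
      qed
      then have "((\<lambda>h. (?p (0 + h) - ?p 0) /\<^sub>R h) \<longlongrightarrow> partial_deriv i g y) (at 0)"
        by (rule LIM_zero_cancel[OF tendsto_norm_zero_cancel])
      moreover have "filterlim (\<lambda>n. 1 / real (Suc n)) (at 0) sequentially"
      proof (rule filterlim_atI)
        show "(\<lambda>n. 1 / real (Suc n)) \<longlonglongrightarrow> 0" by (rule LIMSEQ_Suc[OF lim_inverse_n'])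
      qed simp
      ultimately have "(\<lambda>n. (?p (0 + 1 / real (Suc n)) - ?p 0) /\<^sub>R (1 / real (Suc n))) \<longlonglongrightarrow> partial_deriv i g y"
        by (rule filterlim_compose)
      then show "(\<lambda>n. s n y) \<longlonglongrightarrow> partial_deriv i g y"
        unfolding s_def ax[of "1 / real (Suc n)" for n] by (simp add: scaleR_conv_of_real add.commute)
    qed
    show "AE y in lborel. norm (s n y) \<le> B * indicator (cball 0 (R+1)) y" for n
    proof (rule AE_I2)
      fix y :: "real^'n"
      show "norm (s n y) \<le> B * indicator (cball 0 (R+1)) y"
      proof (cases "y \<in> cball 0 (R+1)")
        case True
        let ?h = "1 / real (Suc n)"
        have "norm (g (y + ?h *\<^sub>R axis i 1) - g (y + 0 *\<^sub>R axis i 1)) \<le> B * norm (?h - 0)"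
        proof (rule differentiable_bound[where f'="\<lambda>s t. t *\<^sub>R partial_deriv i g (y + s *\<^sub>R axis i 1)" and S=UNIV])
          show "((\<lambda>s. g (y + s *\<^sub>R axis i 1)) has_derivative (\<lambda>t. t *\<^sub>R partial_deriv i g (y + s *\<^sub>R axis i 1))) (at s within UNIV)" for s
            using has_derivative_along[OF test_differentiable[OF g]] by (simp add: has_vector_derivative_def)
          show "onorm (\<lambda>t. t *\<^sub>R partial_deriv i g (y + s *\<^sub>R axis i 1)) \<le> B" for s
            using B by (simp add: onorm_scaleR_left onorm_id)
        qed auto
        then have "real (Suc n) * norm (g (y + ?h *\<^sub>R axis i 1) - g y) \<le> B"
          by (simp add: field_simps)
        then show ?thesis using True unfolding s_def ax[of ?h]
          by (simp add: norm_mult add.commute del: of_nat_Suc)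
      next
        case False
        then have y: "norm y > R + 1" by simp
        have "norm y \<le> norm (axis i (1 / real (Suc n)) + y) + norm (axis i (1 / real (Suc n)) :: real^'n)"
          using norm_triangle_ineq4[of "axis i (1 / real (Suc n)) + y" "axis i (1 / real (Suc n))"] by simp
        moreover have "norm (axis i (1 / real (Suc n)) :: real^'n) \<le> 1"
          by (subst ax) (simp add: norm_axis_1 del: of_nat_Suc)
        ultimately have "norm (axis i (1 / real (Suc n)) + y) > R" using y by linarith
        then have "axis i (1 / real (Suc n)) + y \<notin> K" "y \<notin> K" using R y by auto
        then have "s n y = 0" using g by (simp add: s_def test_fns_in_def)
        then show ?thesis using B(1) by (simp add: indicator_def)
      qed
    qed
  qed
  then have "(\<lambda>n. 0::complex) \<longlonglongrightarrow> (LINT y|lborel. partial_deriv i g y)" by (simp add: s0)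
  then show ?thesis using LIMSEQ_unique tendsto_const by blast
qed

text \<open>\<open>f\<close> is smooth only near \<open>K\<close>, yet its product with
  \<open>\<psi>\<close> is a global test function, whose partial derivatives have integral
  0.\<close>

lemma integration_by_parts:
  fixes f \<psi> :: "real^'n::finite \<Rightarrow> complex"
  assumes X: "open X" and K: "compact K" "K \<subseteq> X" and f: "f \<in> smooth_fns X" and \<psi>: "\<psi> \<in> test_fns_in K"
  shows "(LINT y|lborel. f y * partial_deriv i \<psi> y) = - (LINT y|lborel. partial_deriv i f y * \<psi> y)"
proof -
  note cl = compact_imp_closed[OF K(1)]
  have 1: "(\<lambda>y. f y * partial_deriv i \<psi> y) \<in> test_fns_in K" "(\<lambda>y. partial_deriv i f y * \<psi> y) \<in> test_fns_in K"
    using smooth_mult_test[OF X cl K(2)] f \<psi> smooth_partial_deriv test_fns_in_partial_deriv[OF cl] by blast+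
  have 2: "(\<lambda>y. f y * \<psi> y) \<in> test_fns_in K" using smooth_mult_test[OF X cl K(2) f \<psi>] .
  have "partial_deriv i (\<lambda>y. f y * \<psi> y) y = f y * partial_deriv i \<psi> y + partial_deriv i f y * \<psi> y" for y
  proof (cases "y \<in> K")
    case True
    then show ?thesis using K(2) X f test_differentiable[OF \<psi>]
      by (intro partial_deriv_mult) (auto intro: smooth_differentiable)
  next
    case False
    then show ?thesis
      using test_fns_in_partial_deriv[OF cl 2, of i] test_fns_in_partial_deriv[OF cl \<psi>, of i] \<psi>
      by (simp add: test_fns_in_def)
  qed
  then have "(LINT y|lborel. f y * partial_deriv i \<psi> y + partial_deriv i f y * \<psi> y) = 0"
    using integral_partial_deriv_eq_0[OF K(1) 2, of i] by simp
  then show ?thesis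
    using test_integrable[OF K(1) 1(1)] test_integrable[OF K(1) 1(2)] by (simp add: add_eq_0_iff2)
qed

section \<open>Convolution with test functions\<close>

definition conv :: "(real^'n::finite \<Rightarrow> complex) \<Rightarrow> (real^'n \<Rightarrow> complex) \<Rightarrow> real^'n \<Rightarrow> complex" where
  "conv F \<phi> x = (LINT y|lborel. F y * \<phi> (x - y))"

text \<open>The class of sources to be mollified. It asks for neither continuity nor a closed
  carrier \<open>A\<close>, so it survives multiplication by the indicator function of a Borel
  set.\<close>

definition bounded_supp :: "real \<Rightarrow> (real^'n::finite) set \<Rightarrow> (real^'n \<Rightarrow> complex) \<Rightarrow> bool" where
  "bounded_supp B A F \<longleftrightarrow> F \<in> borel_measurable borel \<and> bounded A \<and> (\<forall>x. norm (F x) \<le> B) \<and> (\<forall>x. x \<notin> A \<longrightarrow> F x = 0)"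

lemma bounded_supp_integrable_bound:
  fixes F :: "real^'n::finite \<Rightarrow> complex"
  assumes F: "bounded_supp B (cball 0 R) F" and \<phi>: "\<phi> \<in> borel_measurable borel" "\<And>y. norm (\<phi> y) \<le> D"
  shows "integrable lborel (\<lambda>y. F y * \<phi> y)"
    and "norm (LINT y|lborel. F y * \<phi> y) \<le> B * D * measure lborel (cball (0::real^'n) R)"
proof -
  have "0 \<le> norm (F 0)" "0 \<le> norm (\<phi> 0)" by auto
  then have BD: "0 \<le> B" "0 \<le> D" using F \<phi>(2) order_trans unfolding bounded_supp_def by metis+
  have i: "integrable lborel (\<lambda>y. B * D * indicator (cball (0::real^'n) R) y)"
    by (intro integrable_mult_right integrable_real_indicator) (use emeasure_lborel_cball_finite in auto)
  have b: "norm (F y * \<phi> y) \<le> B * D * indicator (cball 0 R) y" for y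
  proof (cases "y \<in> cball 0 R")
    case True
    then show ?thesis using F \<phi>(2)[of y] BD by (auto simp: bounded_supp_def norm_mult intro: mult_mono)
  next
    case False
    then show ?thesis using F by (auto simp: bounded_supp_def)
  qed
  show int: "integrable lborel (\<lambda>y. F y * \<phi> y)"
  proof (rule Bochner_Integration.integrable_bound[OF i])
    show "(\<lambda>y. F y * \<phi> y) \<in> borel_measurable lborel"
      using F \<phi>(1) by (auto simp: bounded_supp_def)
    show "AE y in lborel. norm (F y * \<phi> y) \<le> norm (B * D * indicator (cball 0 R) y)"
      using b BD by (auto intro!: AE_I2 simp: abs_mult)
  qed
  have "norm (LINT y|lborel. F y * \<phi> y) \<le> (LINT y|lborel. B * D * indicator (cball (0::real^'n) R) y)"
    by (rule Bochner_Integration.integral_norm_bound_integral[OF int i]) (use b in auto)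
  then show "norm (LINT y|lborel. F y * \<phi> y) \<le> B * D * measure lborel (cball (0::real^'n) R)"
    by simp
qed

lemma bounded_supp_ball: "bounded_supp B A F \<Longrightarrow> \<exists>R>0. bounded_supp B (cball 0 R) F"
  unfolding bounded_supp_def by (meson bounded_cball bounded_pos mem_cball_0)

text \<open>All derivatives fall on \<open>\<phi>\<close>, so jumps of \<open>F\<close> do no harm;
  the integrable weight is the Taylor constant of \<open>\<phi>\<close> times |F|.\<close>

lemma conv_deriv:
  fixes F \<phi> :: "real^'n::finite \<Rightarrow> complex"
  assumes F: "bounded_supp B A F" and K: "compact K" and \<phi>: "\<phi> \<in> test_fns_in K"
  shows "conv F \<phi> differentiable (at x)" "partial_deriv i (conv F \<phi>) x = conv F (partial_deriv i \<phi>) x"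
proof -
  obtain R where R: "bounded_supp B (cball 0 R) F" using bounded_supp_ball[OF F] by blast
  obtain C where C: "C \<ge> 0" "\<And>x h. norm (\<phi> (x+h) - \<phi> x - (\<Sum>i\<in>UNIV. of_real (h$i) * partial_deriv i \<phi> x)) \<le> C * (norm h)\<^sup>2"
    using test_taylor[OF K \<phi>] by blast
  have int: "integrable lborel (\<lambda>y. F y * \<psi> (x - y))" if \<psi>: "\<psi> \<in> test_fns_in K" for \<psi> x
  proof -
    obtain D where D: "\<And>x. norm (\<psi> x) \<le> D" using test_bounded[OF K \<psi>] by blast
    show ?thesis
      by (rule bounded_supp_integrable_bound(1)[OF R _ D]) (use test_measurable[OF \<psi>] in measurable)
  qed
  have "((\<lambda>x. LINT y|lborel. F y * \<phi> (x - y)) has_derivative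
    (\<lambda>h. \<Sum>i\<in>UNIV. of_real (h$i) * (LINT y|lborel. F y * partial_deriv i \<phi> (x - y)))) (at x)"
  proof (rule has_derivative_integral_param[where w="\<lambda>y. norm (F y) * C"])
    show "integrable lborel (\<lambda>y. norm (F y) * C)"
      using bounded_supp_integrable_bound(1)[OF R, of "\<lambda>_. 1" 1] by (intro integrable_mult_left integrable_norm) simp
    fix h y
    have "norm (F y * \<phi> (x + h - y) - F y * \<phi> (x - y) - (\<Sum>i\<in>UNIV. of_real (h$i) * (F y * partial_deriv i \<phi> (x - y))))
      = norm (F y) * norm (\<phi> ((x - y) + h) - \<phi> (x - y) - (\<Sum>i\<in>UNIV. of_real (h$i) * partial_deriv i \<phi> (x - y)))"
      unfolding norm_mult[symmetric] by (simp add: algebra_simps sum_distrib_left)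
    also have "\<dots> \<le> norm (F y) * (C * (norm h)\<^sup>2)"
      by (intro mult_left_mono C(2)) auto
    finally show "norm (F y * \<phi> (x + h - y) - F y * \<phi> (x - y) - (\<Sum>i\<in>UNIV. of_real (h$i) * (F y * partial_deriv i \<phi> (x - y))))
      \<le> (norm h)\<^sup>2 * (norm (F y) * C)" by (simp add: mult_ac)
  qed (use int \<phi> test_fns_in_partial_deriv[OF compact_imp_closed[OF K]] in auto)
  then have *: "(conv F \<phi> has_derivative
    (\<lambda>h. \<Sum>i\<in>UNIV. of_real (h$i) * conv F (partial_deriv i \<phi>) x)) (at x)"
    unfolding conv_def[abs_def] .
  show "conv F \<phi> differentiable (at x)" using * by (auto simp: differentiable_def)
  show "partial_deriv i (conv F \<phi>) x = conv F (partial_deriv i \<phi>) x"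
    by (simp add: partial_deriv_eq[OF *] axis_def if_distrib[of of_real] if_distrib[of "\<lambda>x. x * _"] cong: if_cong)
qed

lemma conv_smooth:
  assumes F: "bounded_supp B A F" and K: "compact K" and \<phi>: "\<phi> \<in> test_fns_in K"
  shows "conv F \<phi> \<in> smooth_fns UNIV"
  by (rule smooth_coinduct[where S="conv F ` test_fns_in K"])
    (use \<phi> conv_deriv[OF F K] test_fns_in_partial_deriv[OF compact_imp_closed[OF K]] in auto)

lemma iter_deriv_conv:
  assumes F: "bounded_supp B A F" and K: "compact K" and \<phi>: "\<phi> \<in> test_fns_in K"
  shows "iter_deriv is (conv F \<phi>) x = conv F (iter_deriv is \<phi>) x"
proof (induction "is" arbitrary: x)
  case (Cons i "is")
  then have "iter_deriv is (conv F \<phi>) = conv F (iter_deriv is \<phi>)" by blast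
  then show ?case
    using conv_deriv(2)[OF F K test_fns_in_iter_deriv[OF compact_imp_closed[OF K] \<phi>]] by simp
qed simp

lemma norm_conv_le:
  fixes F :: "real^'n::finite \<Rightarrow> complex"
  assumes "bounded_supp B (cball 0 R) F" "\<phi> \<in> borel_measurable borel" "\<And>y. norm (\<phi> y) \<le> D"
  shows "norm (conv F \<phi> x) \<le> B * D * measure lborel (cball (0::real^'n) R)"
  unfolding conv_def
  by (rule bounded_supp_integrable_bound(2)[OF assms(1)]) (use assms(2,3) in measurable)

lemma conv_eq_0:
  assumes "\<And>y. y \<notin> A \<Longrightarrow> F y = 0" "\<And>y. y \<notin> cball 0 r \<Longrightarrow> \<phi> y = 0" "\<And>a. a \<in> A \<Longrightarrow> norm (x - a) > r"
  shows "conv F \<phi> x = 0"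
proof -
  have "F y * \<phi> (x - y) = 0" for y
    using assms(1)[of y] assms(2)[of "x - y"] assms(3)[of y] by force
  then have "(\<lambda>y. F y * \<phi> (x - y)) = (\<lambda>y. 0)" by blast
  then show ?thesis by (simp add: conv_def)
qed

lemma conv_cong:
  assumes "\<And>y. y \<notin> cball 0 r \<Longrightarrow> \<phi> y = 0" "\<And>y. y \<in> cball x r \<Longrightarrow> F y = G y"
  shows "conv F \<phi> x = conv G \<phi> x"
proof -
  have "F y * \<phi> (x - y) = G y * \<phi> (x - y)" for y
    using assms(1)[of "x - y"] assms(2)[of y] by (cases "y \<in> cball x r") (auto simp: dist_norm norm_minus_commute)
  then have "(\<lambda>y. F y * \<phi> (x - y)) = (\<lambda>y. G y * \<phi> (x - y))" by blast
  then show ?thesis by (simp only: conv_def)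
qed

text \<open>Integration by parts against the reflected translate \<open>\<phi> (x - y)\<close>; the
  sign from the reflection cancels the sign from the integration by parts. Only the ball of radius
  \<open>r\<close> about \<open>x\<close> matters, so \<open>f\<close> need be smooth only
  there.\<close>

lemma conv_partial_deriv:
  fixes f \<phi> :: "real^'n::finite \<Rightarrow> complex"
  assumes X: "open X" and f: "f \<in> smooth_fns X" and x: "cball x r \<subseteq> X" and \<phi>: "\<phi> \<in> test_fns_in (cball 0 r)"
  shows "conv f (partial_deriv i \<phi>) x = conv (partial_deriv i f) \<phi> x"
proof -
  define \<psi> where "\<psi> y = \<phi> (x + (-1) *\<^sub>R y)" for y
  have s: "\<phi> \<in> smooth_fns UNIV" using \<phi> by (simp add: test_fns_in_def)
  have \<psi>: "\<psi> \<in> test_fns_in (cball x r)"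
    unfolding \<psi>_def by (rule test_fns_in_affine[OF \<phi>]) (auto simp: dist_norm norm_minus_commute)
  have pd: "partial_deriv i \<psi> y = - partial_deriv i \<phi> (x - y)" for y
    using smooth_affine(2)[OF s, of "[i]" x "-1" y] by (simp add: \<psi>_def[abs_def])
  show ?thesis
    using integration_by_parts[OF X _ x f \<psi>, of i] by (simp add: conv_def pd, simp add: \<psi>_def)
qed

lemma conv_iter_deriv:
  fixes f \<phi> :: "real^'n::finite \<Rightarrow> complex"
  assumes X: "open X" and f: "f \<in> smooth_fns X" and x: "cball x r \<subseteq> X" and \<phi>: "\<phi> \<in> test_fns_in (cball 0 r)"
  shows "conv f (iter_deriv is \<phi>) x = conv (iter_deriv is f) \<phi> x"
  using f
proof (induction "is" arbitrary: f rule: rev_induct)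
  case (snoc i "is")
  have "conv f (iter_deriv (is @ [i]) \<phi>) x = conv (iter_deriv (is @ [i]) f) \<phi> x"
    if "f \<in> smooth_fns X" for f
  proof -
    \<comment> \<open>The derivative taken off \<open>\<phi>\<close> is its outermost one, but it
      lands innermost on \<open>f\<close>; commuting the derivatives of \<open>\<phi>\<close>
      repairs the order.\<close>
    have perm: "iter_deriv (is @ [i]) \<phi> y = iter_deriv (i # is) \<phi> y" for y
      by (rule iter_deriv_permute[of _ UNIV]) (use \<phi> in \<open>auto simp: test_fns_in_def\<close>)
    have "conv f (iter_deriv (is @ [i]) \<phi>) x = conv f (partial_deriv i (iter_deriv is \<phi>)) x"
      unfolding conv_def perm by simp
    also have "\<dots> = conv (partial_deriv i f) (iter_deriv is \<phi>) x"
      by (rule conv_partial_deriv[OF X that x test_fns_in_iter_deriv[OF _ \<phi>]]) simp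
    also have "\<dots> = conv (iter_deriv is (partial_deriv i f)) \<phi> x"
      by (rule snoc.IH[OF smooth_partial_deriv[OF that]])
    finally show ?thesis by (simp add: iter_deriv_append)
  qed
  with snoc.prems show ?case by blast
qed simp

section \<open>Fourier--Laplace transform\<close>

text \<open>No conjugation: the pairing is bilinear, so differentiating
  \<open>exp (zdot z x)\<close> multiplies it by a coordinate of \<open>z\<close>, without factors
  of \<i>.\<close>

definition zdot :: "complex^'n::finite \<Rightarrow> real^'n \<Rightarrow> complex" where
  "zdot z x = (\<Sum>i\<in>UNIV. of_real (x$i) * z$i)"

text \<open>\<open>zvec \<theta> \<xi>\<close> is the point \<open>\<theta> + i \<xi>\<close> of \<open>\<complex>\<^sup>n\<close>; \<open>I_op \<theta>\<close> is, up to the factor \<open>(2\<pi>)\<^sup>n\<close>, the inverse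
  of \<open>FL\<close> along the contour \<open>Re z = \<theta>\<close>.\<close>

definition zvec :: "real^'n::finite \<Rightarrow> real^'n \<Rightarrow> complex^'n" where
  "zvec \<theta> \<xi> = (\<chi> i. of_real (\<theta>$i) + \<i> * of_real (\<xi>$i))"

definition zmon :: "'n::finite list \<Rightarrow> complex^'n \<Rightarrow> complex" where
  "zmon is z = prod_list (map (\<lambda>i. z$i) is)"

definition FL :: "(real^'n::finite \<Rightarrow> complex) \<Rightarrow> complex^'n \<Rightarrow> complex" where
  "FL g z = (LINT y|lborel. exp (zdot (-z) y) * g y)"

definition I_op :: "real^'n::finite \<Rightarrow> (real^'n \<Rightarrow> complex) \<Rightarrow> real^'n \<Rightarrow> complex" where
  "I_op \<theta> M x = (LINT \<xi>|lborel. exp (zdot (zvec \<theta> \<xi>) x) * M \<xi>)"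

lemma zmon_simps [simp]: "zmon [] z = 1" "zmon (i # is) z = z$i * zmon is z"
  "zmon (is @ js) z = zmon is z * zmon js z"
  by (simp_all add: zmon_def)

lemma zdot_zvec: "zdot (zvec \<theta> \<xi>) x = of_real (\<theta> \<bullet> x) + \<i> * of_real (\<xi> \<bullet> x)"
  by (simp add: zdot_def zvec_def inner_vec_def distrib_left sum.distrib sum_distrib_left mult_ac)

lemma zdot_minus [simp]: "zdot (-z) x = - zdot z x"
  by (simp add: zdot_def sum_negf)

lemma zdot_add: "zdot z (x + y) = zdot z x + zdot z y"
  by (simp add: zdot_def distrib_right sum.distrib)

lemma norm_exp_zdot: "norm (exp (zdot (zvec \<theta> \<xi>) x)) = exp (\<theta> \<bullet> x)"
  by (simp add: zdot_zvec)

lemma bounded_linear_zdot: "bounded_linear (zdot z)"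
  unfolding zdot_def[abs_def] by (rule bounded_linear_comb)

lemma exp_zdot_has_derivative:
  "((\<lambda>x. exp (zdot z x)) has_derivative (\<lambda>h. zdot z h * exp (zdot z x))) (at x)"
proof -
  have "(zdot z has_derivative zdot z) (at x)"
    by (rule bounded_linear_imp_has_derivative[OF bounded_linear_zdot])
  moreover have "(exp has_derivative (\<lambda>h. h * exp (zdot z x))) (at (zdot z x))"
    using DERIV_exp[of "zdot z x"] by (simp add: has_field_derivative_def mult.commute[of _ "exp (zdot z x)"])
  ultimately show ?thesis by (rule has_derivative_compose)
qed

lemma partial_deriv_exp_zdot: "partial_deriv i (\<lambda>x. exp (zdot z x)) x = z$i * exp (zdot z x)"
  unfolding partial_deriv_eq[OF exp_zdot_has_derivative]
  by (simp add: zdot_def axis_def if_distrib[of of_real] if_distrib[of "\<lambda>x. x * _"] cong: if_cong)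

lemma exp_zdot_smooth: "(\<lambda>x. exp (zdot z x)) \<in> smooth_fns UNIV"
proof (rule smooth_coinduct[where S="range (\<lambda>c x. c * exp (zdot z x))"])
  show "(\<lambda>x. exp (zdot z x)) \<in> range (\<lambda>c x. c * exp (zdot z x))"
    by (rule range_eqI[of _ _ 1]) simp
  have d: "(\<lambda>x. exp (zdot z x)) differentiable at x" for x
    using exp_zdot_has_derivative unfolding differentiable_def by blast
  fix f assume "f \<in> range (\<lambda>c x. c * exp (zdot z x))"
  then obtain c where c: "f = (\<lambda>x. c * exp (zdot z x))" by blast
  show "f differentiable at x" for x
    unfolding c using d by (intro differentiable_mult) auto
  show "\<exists>g\<in>range (\<lambda>c x. c * exp (zdot z x)). \<forall>x\<in>UNIV. partial_deriv i f x = g x" for i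
    unfolding c
    by (intro bexI[of _ "\<lambda>x. (c * z$i) * exp (zdot z x)"])
      (auto simp: partial_deriv_cmult[OF d] partial_deriv_exp_zdot)
qed simp

lemma exp_zdot_test:
  "compact K \<Longrightarrow> g \<in> test_fns_in K \<Longrightarrow> (\<lambda>y. exp (zdot z y) * g y) \<in> test_fns_in K"
  by (rule smooth_mult_test[of UNIV]) (auto intro: compact_imp_closed exp_zdot_smooth)

lemma FL_partial_deriv:
  assumes K: "compact K" and g: "g \<in> test_fns_in K"
  shows "FL (partial_deriv i g) z = z$i * FL g z"
proof -
  have "FL (partial_deriv i g) z = - (LINT y|lborel. partial_deriv i (\<lambda>y. exp (zdot (-z) y)) y * g y)"
    unfolding FL_def by (rule integration_by_parts[OF _ K _ exp_zdot_smooth g]) auto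
  also have "\<dots> = - (LINT y|lborel. - z$i * (exp (zdot (-z) y) * g y))"
    unfolding partial_deriv_exp_zdot by (simp add: mult.assoc)
  also have "\<dots> = z$i * FL g z"
    unfolding FL_def integral_mult_right_zero by simp
  finally show ?thesis .
qed

lemma FL_iter_deriv:
  assumes K: "compact K" and g: "g \<in> test_fns_in K"
  shows "FL (iter_deriv is g) z = zmon is z * FL g z"
proof (induction "is")
  case (Cons i "is")
  then show ?case
    using FL_partial_deriv[OF K test_fns_in_iter_deriv[OF compact_imp_closed[OF K] g], of i "is" z] by simp
qed simp

lemma FL_add:
  assumes K: "compact K" and g: "g \<in> test_fns_in K" "h \<in> test_fns_in K"
  shows "FL (\<lambda>y. g y + h y) z = FL g z + FL h z"
  unfolding FL_def distrib_left
  using test_integrable[OF K exp_zdot_test[OF K g(1), of "-z"]]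
    test_integrable[OF K exp_zdot_test[OF K g(2), of "-z"]] by simp

lemma FL_cmult: "FL (\<lambda>y. c * g y) z = c * FL g z"
  unfolding FL_def by (simp add: mult.left_commute)

lemma FL_measurable:
  assumes K: "compact K" and g: "g \<in> test_fns_in K"
  shows "(\<lambda>\<xi>. FL g (zvec \<theta> \<xi>)) \<in> borel_measurable borel"
proof -
  have [measurable]: "g \<in> borel_measurable borel" using test_measurable[OF g] .
  have "(\<lambda>\<xi>. LINT y|lborel. exp (- (of_real (\<theta> \<bullet> y) + \<i> * of_real (\<xi> \<bullet> y))) * g y) \<in> borel_measurable borel"
    by measurable
  then show ?thesis by (simp add: FL_def zdot_zvec)
qed

lemma FL_bound:
  fixes g :: "real^'n::finite \<Rightarrow> complex"
  assumes K: "compact K" "K \<subseteq> cball 0 R" and g: "g \<in> test_fns_in K"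
    and B: "\<And>y. norm (g y) \<le> B" and E: "\<And>y. y \<in> K \<Longrightarrow> exp (- (\<theta> \<bullet> y)) \<le> E" "E \<ge> 0"
  shows "norm (FL g (zvec \<theta> \<xi>)) \<le> E * B * measure lborel (cball (0::real^'n) R)"
proof -
  have "B \<ge> 0" using B norm_ge_zero order_trans by blast
  have i: "integrable lborel (\<lambda>y. E * B * indicator (cball (0::real^'n) R) y)"
    by (intro integrable_mult_right integrable_real_indicator) (use emeasure_lborel_cball_finite in auto)
  have "norm (FL g (zvec \<theta> \<xi>)) \<le> (LINT y|lborel. E * B * indicator (cball (0::real^'n) R) y)"
    unfolding FL_def
  proof (rule Bochner_Integration.integral_norm_bound_integral[OF test_integrable[OF K(1) exp_zdot_test[OF K(1) g]] i])
    fix y :: "real^'n"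
    show "norm (exp (zdot (- zvec \<theta> \<xi>) y) * g y) \<le> E * B * indicator (cball 0 R) y"
    proof (cases "y \<in> K")
      case True
      have "norm (exp (zdot (- zvec \<theta> \<xi>) y)) = exp (- (\<theta> \<bullet> y))"
        by (simp add: zdot_zvec)
      then show ?thesis using True K(2) E(1)[OF True] B[of y] \<open>B \<ge> 0\<close> \<open>E \<ge> 0\<close>
        by (auto simp: norm_mult indicator_def subset_iff intro!: mult_mono)
    next
      case False
      then show ?thesis using g \<open>B \<ge> 0\<close> \<open>E \<ge> 0\<close> by (simp add: test_fns_in_def indicator_def)
    qed
  qed
  then show ?thesis by simp
qed

text \<open>One coordinate at a time: the factor 1 + |z_i|^2 produces the transforms of
  \<open>g\<close> and of its second derivative in direction \<open>i\<close>. Each coordinate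
  therefore doubles the bound and consumes two derivatives.\<close>

lemma FL_decay:
  fixes g :: "real^'n::finite \<Rightarrow> complex"
  assumes K: "compact K" "K \<subseteq> cball 0 R" and E: "\<And>y. y \<in> K \<Longrightarrow> exp (- (\<theta> \<bullet> y)) \<le> E" "E \<ge> 0"
    and "finite I" and g: "g \<in> test_fns_in K"
    and B: "\<And>js y. length js \<le> 2 * card I \<Longrightarrow> norm (iter_deriv js g y) \<le> B"
  shows "(\<Prod>i\<in>I. 1 + (norm (zvec \<theta> \<xi> $ i))\<^sup>2) * norm (FL g (zvec \<theta> \<xi>))
    \<le> 2 ^ card I * (E * B * measure lborel (cball (0::real^'n) R))"
  using assms(5-7)
proof (induction I arbitrary: g rule: finite_induct)
  case empty
  then show ?case using FL_bound[OF K _ _ E, of g B] by (auto simp: empty(2)[of "[]", simplified])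
next
  case (insert i I)
  let ?z = "zvec \<theta> \<xi>"
  let ?p = "\<Prod>i\<in>I. 1 + (norm (?z $ i))\<^sup>2"
  let ?V = "2 ^ card I * (E * B * measure lborel (cball (0::real^'n) R))"
  have 1: "?p * norm (FL g ?z) \<le> ?V"
    by (rule insert.IH) (use insert in auto)
  have 2: "?p * norm (FL (iter_deriv [i,i] g) ?z) \<le> ?V"
  proof (rule insert.IH[OF test_fns_in_iter_deriv[OF compact_imp_closed[OF K(1)] insert.prems(1)]])
    show "norm (iter_deriv js (iter_deriv [i, i] g) y) \<le> B" if "length js \<le> 2 * card I" for js y
      using insert.prems(2)[of "js @ [i,i]" y] that insert.hyps by (simp add: iter_deriv_append)
  qed
  have "norm (FL (iter_deriv [i,i] g) ?z) = (norm (?z $ i))\<^sup>2 * norm (FL g ?z)"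
    unfolding FL_iter_deriv[OF K(1) insert.prems(1)] by (simp add: norm_mult power2_eq_square)
  then have "(\<Prod>i\<in>insert i I. 1 + (norm (?z $ i))\<^sup>2) * norm (FL g ?z)
     = ?p * norm (FL g ?z) + ?p * norm (FL (iter_deriv [i,i] g) ?z)"
    using insert.hyps by (simp add: algebra_simps)
  also have "\<dots> \<le> ?V + ?V" using 1 2 by (rule add_mono)
  finally show ?case using insert.hyps by (simp add: mult_ac)
qed

text \<open>Fubini for tensor products, transported from the product measure indexed by
  \<open>Basis\<close>, whose elements are the unit vectors \<open>axis i 1\<close>.\<close>

lemma lborel_integral_prod_vec:
  fixes f :: "'n::finite \<Rightarrow> real \<Rightarrow> 'b::{real_normed_field,banach,second_countable_topology}"
  assumes f: "\<And>i. integrable lborel (f i)"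
  shows "integrable lborel (\<lambda>x::real^'n. \<Prod>i\<in>UNIV. f i (x$i))"
    and "(LINT x|lborel. (\<Prod>i\<in>UNIV. f i ((x::real^'n)$i))) = (\<Prod>i\<in>UNIV. (LINT t|lborel. f i t))"
proof -
  interpret product_sigma_finite "\<lambda>_::real^'n. lborel :: real measure" by standard
  have inj: "inj (\<lambda>i::'n. axis i (1::real))" by (auto simp: inj_on_def axis_eq_axis)
  define F where "F b = f (inv (\<lambda>i::'n. axis i (1::real)) b)" for b
  have F: "F (axis i 1) = f i" for i unfolding F_def by (simp add: inv_f_f[OF inj])
  have B: "(Basis :: (real^'n) set) = range (\<lambda>i. axis i 1)" by (auto simp: Basis_vec_def)
  have P: "(\<Prod>i\<in>UNIV. h (axis i 1) (x$i)) = (\<Prod>b\<in>Basis. h b (x \<bullet> b))"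
    for h :: "real^'n \<Rightarrow> real \<Rightarrow> 'b" and x :: "real^'n"
    unfolding B by (subst prod.reindex[OF inj]) (simp add: inner_axis)
  have eq: "(\<lambda>x::real^'n. \<Prod>i\<in>UNIV. f i (x$i)) = (\<lambda>x. \<Prod>b\<in>Basis. F b (x \<bullet> b))"
    using P[of F] by (simp add: F)
  have int: "integrable lborel (F b)" for b unfolding F_def by (rule f)
  have [measurable]: "F b \<in> borel_measurable borel" for b
    using borel_measurable_integrable[OF int[of b]] by simp
  have m: "(\<lambda>x::real^'n. \<Prod>b\<in>Basis. F b (x \<bullet> b)) \<in> borel_measurable borel" by measurable
  have c: "(\<Prod>b\<in>Basis. F b ((\<Sum>b\<in>Basis. g b *\<^sub>R b) \<bullet> b)) = (\<Prod>b\<in>Basis. F b (g b))" for g :: "real^'n \<Rightarrow> real"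
    by (intro prod.cong) auto
  have mm: "(\<lambda>f. \<Sum>b\<in>Basis. f b *\<^sub>R b) \<in> measurable (\<Pi>\<^sub>M b\<in>(Basis::(real^'n) set). lborel) borel"
    by measurable
  show "integrable lborel (\<lambda>x::real^'n. \<Prod>i\<in>UNIV. f i (x$i))"
    unfolding eq by (subst lborel_eq) (simp add: integrable_distr_eq[OF mm m] c product_integrable_prod int)
  show "(LINT x|lborel. (\<Prod>i\<in>UNIV. f i ((x::real^'n)$i))) = (\<Prod>i\<in>UNIV. (LINT t|lborel. f i t))"
  proof -
    have "(LINT x|lborel. (\<Prod>b\<in>Basis. F b (x \<bullet> b))) = (LINT g|(\<Pi>\<^sub>M b\<in>Basis. lborel). (\<Prod>b\<in>Basis. F b (g b)))"
      by (subst lborel_eq, subst integral_distr[OF mm m]) (simp only: c)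
    also have "\<dots> = (\<Prod>b\<in>Basis. (LINT t|lborel. F b t))"
      by (rule product_integral_prod) (simp_all add: int)
    also have "\<dots> = (\<Prod>i\<in>UNIV. (LINT t|lborel. f i t))"
      unfolding B by (subst prod.reindex[OF inj]) (simp add: F)
    finally show ?thesis unfolding eq .
  qed
qed

section \<open>The Gaussian and Fourier inversion\<close>

definition gauss :: "real^'n::finite \<Rightarrow> real" where
  "gauss x = (\<Prod>i\<in>UNIV. exp (- (x$i)\<^sup>2 / 2))"

text \<open>Read off from the characteristic function of the standard normal distribution.\<close>

lemma gauss_1d:
  "integrable lborel (\<lambda>t::real. iexp (t * u) * complex_of_real (exp (- t\<^sup>2 / 2)))"
  "(LINT t|lborel. iexp (t * u) * complex_of_real (exp (- t\<^sup>2 / 2))) = of_real (sqrt (2*pi) * exp (- u\<^sup>2 / 2))"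
proof -
  have "integrable lborel (\<lambda>t::real. sqrt (2*pi) * std_normal_density t)"
    by (intro integrable_mult_right) auto
  then have i: "integrable lborel (\<lambda>t::real. exp (- t\<^sup>2 / 2))"
    by (simp add: std_normal_density_def)
  show "integrable lborel (\<lambda>t::real. iexp (t * u) * complex_of_real (exp (- t\<^sup>2 / 2)))"
    by (rule Bochner_Integration.integrable_bound[OF i]) (auto simp: norm_mult)
  have "complex_of_real (exp (- u\<^sup>2 / 2)) = char std_normal_distribution u"
    by (simp add: char_std_normal_distribution)
  also have "\<dots> = (LINT t|lborel. std_normal_density t *\<^sub>R iexp (u * t))"
    unfolding char_def by (rule integral_density) (auto simp: normal_density_nonneg)
  also have "\<dots> = (LINT t|lborel. of_real (1 / sqrt (2*pi)) * (iexp (t * u) * complex_of_real (exp (- t\<^sup>2 / 2))))"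
    by (simp add: std_normal_density_def scaleR_conv_of_real mult_ac)
  also have "\<dots> = of_real (1 / sqrt (2*pi)) * (LINT t|lborel. (iexp (t * u) * complex_of_real (exp (- t\<^sup>2 / 2))))"
    by (rule integral_mult_right_zero)
  finally show "(LINT t|lborel. iexp (t * u) * complex_of_real (exp (- t\<^sup>2 / 2))) = of_real (sqrt (2*pi) * exp (- u\<^sup>2 / 2))"
    by (simp add: field_simps)
qed

lemma gauss_transform:
  fixes y :: "real^'n::finite"
  shows "integrable lborel (\<lambda>\<xi>. iexp (\<xi> \<bullet> y) * of_real (gauss \<xi>))"
    and "(LINT \<xi>|lborel. iexp (\<xi> \<bullet> y) * of_real (gauss \<xi>)) = of_real (sqrt (2*pi) ^ CARD('n) * gauss y)"
proof -
  have e: "iexp (\<xi> \<bullet> y) * of_real (gauss \<xi>) = (\<Prod>i\<in>UNIV. iexp (\<xi>$i * y$i) * of_real (exp (- (\<xi>$i)\<^sup>2 / 2)))" for \<xi>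
    by (simp add: gauss_def prod.distrib inner_vec_def sum_distrib_left exp_sum)
  show "integrable lborel (\<lambda>\<xi>. iexp (\<xi> \<bullet> y) * of_real (gauss \<xi>))"
    unfolding e by (rule lborel_integral_prod_vec(1)) (rule gauss_1d)
  show "(LINT \<xi>|lborel. iexp (\<xi> \<bullet> y) * of_real (gauss \<xi>)) = of_real (sqrt (2*pi) ^ CARD('n) * gauss y)"
    unfolding e by (subst lborel_integral_prod_vec(2)) (simp_all only: gauss_1d, simp add: gauss_def prod.distrib)
qed

lemma gauss_props:
  "0 < gauss x" "gauss x \<le> 1" "gauss (- x) = gauss x" "gauss 0 = 1" "continuous_on UNIV gauss"
  "gauss \<in> borel_measurable borel"
proof -
  show "gauss x \<le> 1" unfolding gauss_def by (intro prod_le_1) auto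
  show c: "continuous_on UNIV gauss" unfolding gauss_def[abs_def] by (intro continuous_intros) auto
  show "gauss \<in> borel_measurable borel" by (rule borel_measurable_continuous_onI[OF c])
qed (auto simp: gauss_def intro!: prod_pos)

lemma gauss_integrable: "integrable lborel (gauss :: real^'n::finite \<Rightarrow> real)"
  and gauss_integral: "(LINT x|lborel. gauss (x::real^'n)) = sqrt (2*pi) ^ CARD('n)"
proof -
  have 1: "integrable lborel (\<lambda>\<xi>. complex_of_real (gauss (\<xi>::real^'n)))"
    "(LINT \<xi>|lborel. complex_of_real (gauss (\<xi>::real^'n))) = of_real (sqrt (2*pi) ^ CARD('n))"
    using gauss_transform[of "0::real^'n"] by (simp_all add: gauss_props)
  show "integrable lborel (gauss :: real^'n \<Rightarrow> real)" using 1(1) by (simp only: complex_of_real_integrable_eq)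
  show "(LINT x|lborel. gauss (x::real^'n)) = sqrt (2*pi) ^ CARD('n)"
    using 1(2) unfolding integral_complex_of_real of_real_eq_iff .
qed

text \<open>Damping by \<open>gauss (e *\<^sub>R \<xi>)\<close> makes the double integral absolutely
  convergent, so Fubini and the transform of the Gaussian apply; then e tends to 0 by dominated
  convergence on both sides. The constant \<open>S\<close> arises twice, from the transform and from
  the mass of the Gaussian, and its square is the power of 2 pi.\<close>

lemma Fourier_inversion_at_0:
  fixes \<phi> :: "real^'n::finite \<Rightarrow> complex"
  assumes K: "compact K" and \<phi>: "\<phi> \<in> test_fns_in K"
    and int: "integrable lborel (\<lambda>\<xi>. LINT y|lborel. iexp (- (\<xi> \<bullet> y)) * \<phi> y)"
  shows "(LINT \<xi>|lborel. LINT y|lborel. iexp (- (\<xi> \<bullet> y)) * \<phi> y) = (2*pi) ^ CARD('n) * \<phi> 0"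
proof -
  define \<Phi> where "\<Phi> \<xi> = (LINT y|lborel. iexp (- (\<xi> \<bullet> y)) * \<phi> y)" for \<xi>
  define S where "S = sqrt (2*pi) ^ CARD('n)"
  have [measurable]: "\<phi> \<in> borel_measurable borel" using test_measurable[OF \<phi>] .
  note [measurable] = gauss_props(6)
  have int\<phi>: "integrable lborel \<phi>" using test_integrable[OF K \<phi>] .
  obtain B where B: "\<And>x. norm (\<phi> x) \<le> B" using test_bounded[OF K \<phi>] by blast
  have scaled: "(LINT \<xi>|lborel. \<Phi> \<xi> * of_real (gauss (e *\<^sub>R \<xi>))) = of_real S * (LINT u|lborel. \<phi> (e *\<^sub>R u) * of_real (gauss u))"
    if e: "e > 0" for e
  proof -
    define f where "f \<xi> y = iexp (- (\<xi> \<bullet> y)) * \<phi> y * of_real (gauss (e *\<^sub>R \<xi>))" for \<xi> y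
    have gint: "integrable lborel (\<lambda>\<xi>::real^'n. gauss (e *\<^sub>R \<xi>))"
    proof (rule integrableI_bounded)
      have "(\<integral>\<^sup>+ \<xi>. ennreal (norm (gauss (\<xi>::real^'n))) \<partial>lborel)
        = (\<integral>\<^sup>+ \<xi>. ennreal (norm (gauss (\<xi>::real^'n))) \<partial>(density (distr lborel borel (\<lambda>x. 0 + e *\<^sub>R x)) (\<lambda>_. \<bar>e\<bar>^DIM(real^'n))))"
        using lborel_affine[of e "0::real^'n"] e by simp
      also have "\<dots> = ennreal (\<bar>e\<bar>^DIM(real^'n)) * (\<integral>\<^sup>+ \<xi>. ennreal (norm (gauss (e *\<^sub>R (\<xi>::real^'n)))) \<partial>lborel)"
        by (simp add: nn_integral_density nn_integral_distr nn_integral_cmult)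
      finally have *: "(\<integral>\<^sup>+ \<xi>. ennreal (norm (gauss (\<xi>::real^'n))) \<partial>lborel)
        = ennreal (\<bar>e\<bar>^DIM(real^'n)) * (\<integral>\<^sup>+ \<xi>. ennreal (norm (gauss (e *\<^sub>R (\<xi>::real^'n)))) \<partial>lborel)" .
      have "(\<integral>\<^sup>+ \<xi>. ennreal (norm (gauss (\<xi>::real^'n))) \<partial>lborel) < \<infinity>"
        using gauss_integrable by (simp add: integrable_iff_bounded)
      then show "(\<integral>\<^sup>+ \<xi>. ennreal (norm (gauss (e *\<^sub>R (\<xi>::real^'n)))) \<partial>lborel) < \<infinity>"
        unfolding * using e by (auto simp: ennreal_mult_less_top)
    qed measurable
    have "integrable (lborel \<Otimes>\<^sub>M lborel) (case_prod f)"
    proof (rule lborel_pair.Fubini_integrable)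
      show "case_prod f \<in> borel_measurable (lborel \<Otimes>\<^sub>M lborel)" unfolding f_def by measurable
      have "norm (case_prod f (\<xi>, y)) = norm (\<phi> y) * gauss (e *\<^sub>R \<xi>)" for \<xi> y
        using gauss_props(1)[of "e *\<^sub>R \<xi>"] by (simp add: f_def norm_mult)
      then show "integrable lborel (\<lambda>\<xi>. LINT y|lborel. norm (case_prod f (\<xi>, y)))"
        using gint by simp
      have "integrable lborel (\<lambda>y. f \<xi> y)" for \<xi>
        unfolding f_def
      proof (rule Bochner_Integration.integrable_bound[OF int\<phi>])
        show "AE y in lborel. norm (iexp (- (\<xi> \<bullet> y)) * \<phi> y * of_real (gauss (e *\<^sub>R \<xi>))) \<le> norm (\<phi> y)"
          using gauss_props(1,2)[of "e *\<^sub>R \<xi>"] by (auto simp: norm_mult intro!: mult_left_le)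
      qed measurable
      then show "AE \<xi> in lborel. integrable lborel (\<lambda>y. case_prod f (\<xi>, y))" by simp
    qed
    then have "(LINT y|lborel. LINT \<xi>|lborel. f \<xi> y) = (LINT \<xi>|lborel. LINT y|lborel. f \<xi> y)"
      by (rule lborel_pair.Fubini_integral)
    moreover have "(LINT y|lborel. f \<xi> y) = \<Phi> \<xi> * of_real (gauss (e *\<^sub>R \<xi>))" for \<xi>
      unfolding f_def \<Phi>_def by (rule integral_mult_left_zero)
    moreover have "(LINT \<xi>|lborel. f \<xi> y) = \<phi> y * of_real ((1/e) ^ CARD('n) * S * gauss ((1/e) *\<^sub>R y))" for y
    proof -
      have "(LINT \<xi>|lborel. f \<xi> y) = (LINT \<xi>|lborel. \<phi> y * (iexp (- (\<xi> \<bullet> y)) * of_real (gauss (e *\<^sub>R \<xi>))))"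
        by (simp add: f_def mult_ac)
      also have "\<dots> = \<phi> y * (LINT \<xi>|lborel. iexp (- (\<xi> \<bullet> y)) * of_real (gauss (e *\<^sub>R \<xi>)))"
        by (rule integral_mult_right_zero)
      also have "(LINT \<xi>|lborel. iexp (- (\<xi> \<bullet> y)) * of_real (gauss (e *\<^sub>R \<xi>)))
         = \<bar>1/e\<bar> ^ DIM(real^'n) *\<^sub>R (LINT \<xi>|lborel. iexp (- ((0 + (1/e) *\<^sub>R \<xi>) \<bullet> y)) * of_real (gauss (e *\<^sub>R (0 + (1/e) *\<^sub>R \<xi>))))"
        by (rule lborel_integral_affine) (measurable, use e in auto)
      also have "(\<lambda>\<xi>. iexp (- ((0 + (1/e) *\<^sub>R \<xi>) \<bullet> y)) * complex_of_real (gauss (e *\<^sub>R (0 + (1/e) *\<^sub>R \<xi>))))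
        = (\<lambda>\<xi>. iexp (\<xi> \<bullet> (- ((1/e) *\<^sub>R y))) * of_real (gauss \<xi>))"
        using e by auto
      also have "(LINT \<xi>|lborel. iexp (\<xi> \<bullet> (- ((1/e) *\<^sub>R y))) * of_real (gauss \<xi>)) = of_real (S * gauss ((1/e) *\<^sub>R y))"
        unfolding gauss_transform(2) S_def gauss_props(3) ..
      finally show ?thesis using e by (simp add: scaleR_conv_of_real mult_ac)
    qed
    ultimately have "(LINT \<xi>|lborel. \<Phi> \<xi> * of_real (gauss (e *\<^sub>R \<xi>)))
      = (LINT y|lborel. \<phi> y * of_real ((1/e) ^ CARD('n) * S * gauss ((1/e) *\<^sub>R y)))" by simp
    also have "\<dots> = \<bar>e\<bar> ^ DIM(real^'n) *\<^sub>R (LINT u|lborel. \<phi> (0 + e *\<^sub>R u) * of_real ((1/e) ^ CARD('n) * S * gauss ((1/e) *\<^sub>R (0 + e *\<^sub>R u))))"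
      by (rule lborel_integral_affine) (measurable, use e in auto)
    also have "\<dots> = e ^ CARD('n) *\<^sub>R (LINT u|lborel. of_real ((1/e) ^ CARD('n) * S) * (\<phi> (e *\<^sub>R u) * of_real (gauss u)))"
      using e by (simp add: mult_ac)
    also have "\<dots> = e ^ CARD('n) *\<^sub>R (of_real ((1/e) ^ CARD('n) * S) * (LINT u|lborel. \<phi> (e *\<^sub>R u) * of_real (gauss u)))"
      by (simp only: integral_mult_right_zero)
    also have "\<dots> = of_real S * (LINT u|lborel. \<phi> (e *\<^sub>R u) * of_real (gauss u))"
      using e by (simp add: scaleR_conv_of_real power_divide)
    finally show ?thesis .
  qed
  define e where "e n = 1 / real (Suc n)" for n
  have e: "e n > 0" "e \<longlonglongrightarrow> 0" for n
    unfolding e_def by (simp, rule LIMSEQ_Suc[OF lim_inverse_n'])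
  have e0: "(\<lambda>n. e n *\<^sub>R x) \<longlonglongrightarrow> 0" for x :: "real^'n"
    using tendsto_scaleR[OF e(2) tendsto_const[of x]] by simp
  have l1: "(\<lambda>n. LINT \<xi>|lborel. \<Phi> \<xi> * of_real (gauss (e n *\<^sub>R \<xi>))) \<longlonglongrightarrow> (LINT \<xi>|lborel. \<Phi> \<xi>)"
  proof (rule integral_dominated_convergence[where w="\<lambda>\<xi>. norm (\<Phi> \<xi>)"])
    have int': "integrable lborel \<Phi>" using int unfolding \<Phi>_def[abs_def] .
    then show "integrable lborel (\<lambda>\<xi>. norm (\<Phi> \<xi>))" "\<Phi> \<in> borel_measurable lborel" by auto
    from int' have [measurable]: "\<Phi> \<in> borel_measurable borel" by auto
    show "(\<lambda>\<xi>. \<Phi> \<xi> * of_real (gauss (e n *\<^sub>R \<xi>))) \<in> borel_measurable lborel" for n by measurable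
    show "AE \<xi> in lborel. (\<lambda>n. \<Phi> \<xi> * of_real (gauss (e n *\<^sub>R \<xi>))) \<longlonglongrightarrow> \<Phi> \<xi>"
    proof (rule AE_I2)
      fix \<xi> :: "real^'n"
      have "(\<lambda>n. gauss (e n *\<^sub>R \<xi>)) \<longlonglongrightarrow> gauss (0::real^'n)"
        using continuous_on_tendsto_compose[OF gauss_props(5) e0] by simp
      then show "(\<lambda>n. \<Phi> \<xi> * of_real (gauss (e n *\<^sub>R \<xi>))) \<longlonglongrightarrow> \<Phi> \<xi>"
        using tendsto_mult[OF tendsto_const[of "\<Phi> \<xi>"] tendsto_of_real] by (fastforce simp: gauss_props)
    qed
    show "AE \<xi> in lborel. norm (\<Phi> \<xi> * of_real (gauss (e n *\<^sub>R \<xi>))) \<le> norm (\<Phi> \<xi>)" for n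
      by (auto simp: norm_mult abs_of_pos[OF gauss_props(1)] gauss_props(2) intro!: mult_left_le AE_I2)
  qed
  have l2: "(\<lambda>n. LINT u|lborel. \<phi> (e n *\<^sub>R u) * of_real (gauss u)) \<longlonglongrightarrow> (LINT u|lborel. \<phi> 0 * of_real (gauss (u::real^'n)))"
  proof (rule integral_dominated_convergence[where w="\<lambda>u. B * gauss u"])
    show "integrable lborel (\<lambda>u::real^'n. B * gauss u)" by (intro integrable_mult_right gauss_integrable)
    show "(\<lambda>u. \<phi> 0 * of_real (gauss (u::real^'n))) \<in> borel_measurable lborel" by measurable
    show "(\<lambda>u. \<phi> (e n *\<^sub>R u) * of_real (gauss u)) \<in> borel_measurable lborel" for n by measurable
    show "AE u in lborel. (\<lambda>n. \<phi> (e n *\<^sub>R u) * of_real (gauss u)) \<longlonglongrightarrow> \<phi> 0 * of_real (gauss u)"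
      using continuous_on_tendsto_compose[OF test_continuous[OF \<phi>] e0] by (intro AE_I2 tendsto_mult) auto
    show "AE u in lborel. norm (\<phi> (e n *\<^sub>R u) * of_real (gauss u)) \<le> B * gauss u" for n
      using B by (auto simp: norm_mult abs_of_pos[OF gauss_props(1)] less_imp_le[OF gauss_props(1)] intro!: mult_right_mono)
  qed
  have l0: "(LINT u|lborel. \<phi> 0 * of_real (gauss (u::real^'n))) = \<phi> 0 * of_real S"
    by (simp add: gauss_integral S_def)
  have "(\<lambda>n. LINT \<xi>|lborel. \<Phi> \<xi> * of_real (gauss (e n *\<^sub>R \<xi>))) \<longlonglongrightarrow> of_real S * (\<phi> 0 * of_real S)"
    unfolding scaled[OF e(1)] using tendsto_mult[OF tendsto_const l2, of "of_real S"] unfolding l0 .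
  with l1 have "(LINT \<xi>|lborel. \<Phi> \<xi>) = of_real S * (\<phi> 0 * of_real S)"
    using LIMSEQ_unique by blast
  moreover have "S * S = (2*pi) ^ CARD('n)"
    unfolding S_def power_mult_distrib[symmetric] by simp
  then have "complex_of_real S * complex_of_real S = (2*pi) ^ CARD('n)"
    by (simp only: of_real_mult[symmetric])
  ultimately show ?thesis
    unfolding \<Phi>_def by (metis mult.assoc mult.commute)
qed

lemma FL_inversion:
  fixes g :: "real^'n::finite \<Rightarrow> complex"
  assumes K: "compact K" and g: "g \<in> test_fns_in K"
    and int: "integrable lborel (\<lambda>\<xi>. exp (zdot (zvec \<theta> \<xi>) x) * FL g (zvec \<theta> \<xi>))"
  shows "I_op \<theta> (\<lambda>\<xi>. FL g (zvec \<theta> \<xi>)) x = (2*pi) ^ CARD('n) * g x"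
proof -
  \<comment> \<open>Moving \<open>x\<close> to the origin and multiplying by the real exponential of
    - \<theta> \<bullet> y turns the contour integral into an ordinary Fourier integral.\<close>
  define \<phi> where "\<phi> y = exp (zdot (zvec (-\<theta>) 0) y) * g (x + 1 *\<^sub>R y)" for y
  have K': "compact ((+) (-x) ` K)" using compact_translation[OF K] .
  have "(\<lambda>y. g (x + 1 *\<^sub>R y)) \<in> test_fns_in ((+) (-x) ` K)"
    by (rule test_fns_in_affine[OF g]) (force intro: rev_image_eqI)
  then have \<phi>: "\<phi> \<in> test_fns_in ((+) (-x) ` K)"
    unfolding \<phi>_def by (rule exp_zdot_test[OF K'])
  have eq: "exp (zdot (zvec \<theta> \<xi>) x) * FL g (zvec \<theta> \<xi>) = (LINT y|lborel. iexp (- (\<xi> \<bullet> y)) * \<phi> y)" for \<xi>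
  proof -
    have [measurable]: "g \<in> borel_measurable borel" using test_measurable[OF g] .
    have [measurable]: "(\<lambda>y. exp (zdot (-zvec \<theta> \<xi>) y)) \<in> borel_measurable borel"
      using exp_zdot_smooth[of "-zvec \<theta> \<xi>"] smooth_continuous_on[of _ UNIV "[]"]
      by (intro borel_measurable_continuous_onI) auto
    have m: "(\<lambda>y. exp (zdot (-zvec \<theta> \<xi>) y) * g y) \<in> borel_measurable borel" by measurable
    have "FL g (zvec \<theta> \<xi>) = (LINT y|lborel. exp (zdot (-zvec \<theta> \<xi>) (x + 1 *\<^sub>R y)) * g (x + 1 *\<^sub>R y))"
      unfolding FL_def using lborel_integral_affine[OF m, of 1 x] by simp
    then have "exp (zdot (zvec \<theta> \<xi>) x) * FL g (zvec \<theta> \<xi>)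
      = (LINT y|lborel. exp (zdot (zvec \<theta> \<xi>) x) * (exp (zdot (-zvec \<theta> \<xi>) (x + 1 *\<^sub>R y)) * g (x + 1 *\<^sub>R y)))"
      by (simp only: integral_mult_right_zero)
    also have "\<dots> = (LINT y|lborel. iexp (- (\<xi> \<bullet> y)) * \<phi> y)"
    proof (rule Bochner_Integration.integral_cong)
      fix y
      have "exp (zdot (zvec \<theta> \<xi>) x) * exp (zdot (-zvec \<theta> \<xi>) (x + 1 *\<^sub>R y)) = iexp (- (\<xi> \<bullet> y)) * exp (zdot (zvec (-\<theta>) 0) y)"
        unfolding exp_add[symmetric] by (simp add: zdot_zvec zdot_add algebra_simps)
      then show "exp (zdot (zvec \<theta> \<xi>) x) * (exp (zdot (-zvec \<theta> \<xi>) (x + 1 *\<^sub>R y)) * g (x + 1 *\<^sub>R y)) = iexp (- (\<xi> \<bullet> y)) * \<phi> y"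
        unfolding \<phi>_def mult.assoc[symmetric] by simp
    qed simp
    finally show ?thesis .
  qed
  have "zdot (zvec (-\<theta>) 0) 0 = 0" by (simp add: zdot_def)
  then show ?thesis
    using Fourier_inversion_at_0[OF K' \<phi>] int unfolding I_op_def eq by (simp add: \<phi>_def)
qed

section \<open>Inverse transforms along a contour, with multipliers\<close>

lemma Re_zdot_zvec [simp]: "Re (zdot (zvec \<theta> \<xi>) x) = \<theta> \<bullet> x"
  by (simp add: zdot_zvec)

text \<open>Integrability against every monomial is what differentiating \<open>I_op\<close>
  arbitrarily often under the integral sign consumes, and it is stable under multiplication by
  monomials.\<close>

definition rapid :: "real^'n::finite \<Rightarrow> (real^'n \<Rightarrow> complex) \<Rightarrow> bool" where
  "rapid \<theta> M \<longleftrightarrow> (\<forall>is. integrable lborel (\<lambda>\<xi>. zmon is (zvec \<theta> \<xi>) * M \<xi>))"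

lemma rapid_zmon:
  assumes "rapid \<theta> M"
  shows "rapid \<theta> (\<lambda>\<xi>. zmon js (zvec \<theta> \<xi>) * M \<xi>)"
  unfolding rapid_def
proof
  fix "is"
  have "integrable lborel (\<lambda>\<xi>. zmon (is @ js) (zvec \<theta> \<xi>) * M \<xi>)" using assms unfolding rapid_def by blast
  then show "integrable lborel (\<lambda>\<xi>. zmon is (zvec \<theta> \<xi>) * (zmon js (zvec \<theta> \<xi>) * M \<xi>))"
    by (simp add: mult.assoc)
qed

lemma rapid_integrable:
  assumes "rapid \<theta> M"
  shows "integrable lborel M" "integrable lborel (\<lambda>\<xi>. exp (zdot (zvec \<theta> \<xi>) x) * M \<xi>)"
proof -
  show M: "integrable lborel M" using assms[unfolded rapid_def, rule_format, of "[]"] by simp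
  have [measurable]: "M \<in> borel_measurable borel" using borel_measurable_integrable[OF M] by simp
  show "integrable lborel (\<lambda>\<xi>. exp (zdot (zvec \<theta> \<xi>) x) * M \<xi>)"
  proof (rule Bochner_Integration.integrable_bound)
    show "integrable lborel (\<lambda>\<xi>. exp (\<theta> \<bullet> x) * norm (M \<xi>))" using M by simp
    show "(\<lambda>\<xi>. exp (zdot (zvec \<theta> \<xi>) x) * M \<xi>) \<in> borel_measurable lborel"
      unfolding zdot_zvec by measurable
  qed (simp add: norm_mult norm_exp_zdot)
qed

lemma norm_I_op_le:
  assumes "integrable lborel w" "\<And>\<xi>. norm (M \<xi>) \<le> w \<xi>"
  shows "norm (I_op \<theta> M x) \<le> exp (\<theta> \<bullet> x) * (LINT \<xi>|lborel. w \<xi>)"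
proof (cases "integrable lborel (\<lambda>\<xi>. exp (zdot (zvec \<theta> \<xi>) x) * M \<xi>)")
  case True
  have "norm (I_op \<theta> M x) \<le> (LINT \<xi>|lborel. exp (\<theta> \<bullet> x) * w \<xi>)"
    unfolding I_op_def
    by (rule Bochner_Integration.integral_norm_bound_integral[OF True])
      (use assms in \<open>auto simp: norm_mult norm_exp_zdot\<close>)
  then show ?thesis by simp
next
  \<comment> \<open>A non-integrable integrand has integral 0 by convention, which the nonnegative
    right-hand side dominates.\<close>
  case False
  have "0 \<le> w \<xi>" for \<xi> using assms(2)[of \<xi>] norm_ge_zero order_trans by blast
  then show ?thesis using False by (simp add: I_op_def not_integrable_integral_eq)
qed

lemma I_op_deriv:
  assumes M: "rapid \<theta> M"
  shows "I_op \<theta> M differentiable (at x)"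
    "partial_deriv i (I_op \<theta> M) x = I_op \<theta> (\<lambda>\<xi>. zmon [i] (zvec \<theta> \<xi>) * M \<xi>) x"
proof -
  let ?z = "zvec \<theta>"
  \<comment> \<open>From |e^a - 1 - a| \<le> e^|Re a| |a|^2 with a =
    \<open>zdot (zvec \<theta> \<xi>) h\<close>. For |h| \<le> 1 the real part is at most
    |\<theta>|, and the square of the sum of the coordinate moduli expands into the double
    sum.\<close>
  define w where "w \<xi> = exp (\<theta> \<bullet> x) * exp (norm \<theta>) * (\<Sum>i\<in>UNIV. \<Sum>j\<in>UNIV. norm (zmon [i,j] (?z \<xi>) * M \<xi>))" for \<xi>
  have "((\<lambda>x. LINT \<xi>|lborel. exp (zdot (?z \<xi>) x) * M \<xi>) has_derivative
    (\<lambda>h. \<Sum>i\<in>UNIV. of_real (h$i) * (LINT \<xi>|lborel. exp (zdot (?z \<xi>) x) * (zmon [i] (?z \<xi>) * M \<xi>)))) (at x)"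
  proof (rule has_derivative_integral_param[where w=w])
    show "integrable lborel (\<lambda>\<xi>. exp (zdot (?z \<xi>) x) * M \<xi>)" for x using rapid_integrable(2)[OF M] .
    show "integrable lborel (\<lambda>\<xi>. exp (zdot (?z \<xi>) x) * (zmon [i] (?z \<xi>) * M \<xi>))" for i
      using rapid_integrable(2)[OF rapid_zmon[OF M]] .
    show "integrable lborel w"
      unfolding w_def using M[unfolded rapid_def]
      by (intro integrable_mult_right Bochner_Integration.integrable_sum integrable_norm) blast
    fix h \<xi> :: "real^'a" assume h: "norm h \<le> 1"
    let ?w = "zdot (?z \<xi>) h"
    have "exp (zdot (?z \<xi>) (x + h)) * M \<xi> - exp (zdot (?z \<xi>) x) * M \<xi>
        - (\<Sum>i\<in>UNIV. of_real (h$i) * (exp (zdot (?z \<xi>) x) * (zmon [i] (?z \<xi>) * M \<xi>)))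
      = exp (zdot (?z \<xi>) x) * M \<xi> * (exp ?w - (\<Sum>k\<le>1. ?w ^ k / fact k))"
      by (simp add: zdot_add exp_add algebra_simps sum_distrib_left sum_distrib_right)
        (simp add: zdot_def sum_distrib_left sum_distrib_right mult_ac)
    also have "norm \<dots> = exp (\<theta> \<bullet> x) * norm (M \<xi>) * norm (exp ?w - (\<Sum>k\<le>1. ?w ^ k / fact k))"
      by (simp only: norm_mult norm_exp_zdot)
    also have "\<dots> \<le> exp (\<theta> \<bullet> x) * norm (M \<xi>) * (exp (norm \<theta>) * ((\<Sum>i\<in>UNIV. norm (?z \<xi> $ i)) * norm h)\<^sup>2)"
    proof (intro mult_left_mono)
      have "\<bar>Re ?w\<bar> \<le> norm \<theta> * norm h" by (simp add: zdot_zvec Cauchy_Schwarz_ineq2)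
      also have "\<dots> \<le> norm \<theta>" using h by (simp add: mult_left_le)
      finally have 1: "\<bar>Re ?w\<bar> \<le> norm \<theta>" .
      have 2: "norm ?w \<le> (\<Sum>i\<in>UNIV. norm (?z \<xi> $ i)) * norm h"
        unfolding zdot_def by (rule norm_linear_comb_le)
      have "norm (exp ?w - (\<Sum>k\<le>1. ?w ^ k / fact k)) \<le> exp \<bar>Re ?w\<bar> * (norm ?w)\<^sup>2"
        using Taylor_exp[of ?w 1] by (simp add: numeral_2_eq_2)
      also have "\<dots> \<le> exp (norm \<theta>) * ((\<Sum>i\<in>UNIV. norm (?z \<xi> $ i)) * norm h)\<^sup>2"
        using 1 2 by (intro mult_mono power_mono) auto
      finally show "norm (exp ?w - (\<Sum>k\<le>1. ?w ^ k / fact k))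
        \<le> exp (norm \<theta>) * ((\<Sum>i\<in>UNIV. norm (?z \<xi> $ i)) * norm h)\<^sup>2" .
    qed auto
    also have "\<dots> = (norm h)\<^sup>2 * w \<xi>"
      unfolding w_def power_mult_distrib
      by (simp add: norm_mult power2_eq_square sum_product sum_distrib_left sum_distrib_right mult_ac)
    finally show "norm (exp (zdot (?z \<xi>) (x + h)) * M \<xi> - exp (zdot (?z \<xi>) x) * M \<xi>
        - (\<Sum>i\<in>UNIV. of_real (h$i) * (exp (zdot (?z \<xi>) x) * (zmon [i] (?z \<xi>) * M \<xi>)))) \<le> (norm h)\<^sup>2 * w \<xi>" .
  qed
  then have *: "(I_op \<theta> M has_derivative
    (\<lambda>h. \<Sum>i\<in>UNIV. of_real (h$i) * I_op \<theta> (\<lambda>\<xi>. zmon [i] (?z \<xi>) * M \<xi>) x)) (at x)"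
    unfolding I_op_def[abs_def] .
  show "I_op \<theta> M differentiable (at x)" using * by (auto simp: differentiable_def)
  show "partial_deriv i (I_op \<theta> M) x = I_op \<theta> (\<lambda>\<xi>. zmon [i] (?z \<xi>) * M \<xi>) x"
    unfolding partial_deriv_eq[OF *]
    by (simp add: axis_def if_distrib[of of_real] if_distrib[of "\<lambda>x. x * _"] cong: if_cong)
qed

lemma I_op_smooth: "rapid \<theta> M \<Longrightarrow> I_op \<theta> M \<in> smooth_fns UNIV"
proof (rule smooth_coinduct[where S="I_op \<theta> ` {M. rapid \<theta> M}"])
  fix f i assume "f \<in> I_op \<theta> ` {M. rapid \<theta> M}"
  then obtain M where "f = I_op \<theta> M" "rapid \<theta> M" by blast
  then show "\<exists>g\<in>I_op \<theta> ` {M. rapid \<theta> M}. \<forall>x\<in>UNIV. partial_deriv i f x = g x"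
    using rapid_zmon by (intro bexI[of _ "I_op \<theta> (\<lambda>\<xi>. zmon [i] (zvec \<theta> \<xi>) * M \<xi>)"]) (auto simp: I_op_deriv(2) simp del: zmon_simps)
qed (auto intro: I_op_deriv(1))

lemma iter_deriv_I_op:
  assumes "rapid \<theta> M"
  shows "iter_deriv is (I_op \<theta> M) = I_op \<theta> (\<lambda>\<xi>. zmon is (zvec \<theta> \<xi>) * M \<xi>)"
proof (induction "is")
  case (Cons i "is")
  show ?case
  proof
    fix x
    show "iter_deriv (i # is) (I_op \<theta> M) x = I_op \<theta> (\<lambda>\<xi>. zmon (i # is) (zvec \<theta> \<xi>) * M \<xi>) x"
      using I_op_deriv(2)[OF rapid_zmon[OF assms, of "is"], of i x] Cons by (simp add: mult.assoc)
  qed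
qed simp

lemma I_op_sum:
  assumes "\<And>a. a \<in> A \<Longrightarrow> rapid \<theta> (M a)"
  shows "I_op \<theta> (\<lambda>\<xi>. \<Sum>a\<in>A. c a * M a \<xi>) x = (\<Sum>a\<in>A. c a * I_op \<theta> (M a) x)"
proof -
  have "I_op \<theta> (\<lambda>\<xi>. \<Sum>a\<in>A. c a * M a \<xi>) x = (LINT \<xi>|lborel. (\<Sum>a\<in>A. c a * (exp (zdot (zvec \<theta> \<xi>) x) * M a \<xi>)))"
    unfolding I_op_def by (simp add: sum_distrib_left mult_ac)
  also have "\<dots> = (\<Sum>a\<in>A. (LINT \<xi>|lborel. c a * (exp (zdot (zvec \<theta> \<xi>) x) * M a \<xi>)))"
    by (rule Bochner_Integration.integral_sum) (use rapid_integrable(2)[OF assms] in auto)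
  finally show ?thesis by (simp add: I_op_def)
qed

text \<open>A fixed integrable weight dominating all Fourier--Laplace transforms of test functions.\<close>

definition cweight :: "real^'n::finite \<Rightarrow> real" where
  "cweight \<xi> = (\<Prod>i\<in>UNIV. inverse (1 + (\<xi>$i)\<^sup>2))"

lemma cweight_integrable: "integrable lborel (cweight :: real^'n::finite \<Rightarrow> real)"
proof -
  have "integrable lborel (\<lambda>t::real. inverse (1 + t\<^sup>2))"
    using integrable_inverse_1_plus_square by (simp add: set_integrable_def einterval_def)
  then show ?thesis
    unfolding cweight_def[abs_def] by (rule lborel_integral_prod_vec(1))
qed

lemma cweight_pos: "cweight \<xi> > 0"
  unfolding cweight_def by (intro prod_pos) (auto simp: add_pos_nonneg)

lemma FL_le_cweight:
  fixes g :: "real^'n::finite \<Rightarrow> complex"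
  assumes K: "compact K" "K \<subseteq> cball 0 R" and E: "\<And>y. y \<in> K \<Longrightarrow> exp (- (\<theta> \<bullet> y)) \<le> E" "E \<ge> 0"
    and g: "g \<in> test_fns_in K"
    and B: "\<And>js y. length js \<le> 2 * CARD('n) \<Longrightarrow> norm (iter_deriv js g y) \<le> B"
  shows "norm (FL g (zvec \<theta> \<xi>)) \<le> 2 ^ CARD('n) * (E * B * measure lborel (cball (0::real^'n) R)) * cweight \<xi>"
proof -
  let ?C = "2 ^ CARD('n) * (E * B * measure lborel (cball (0::real^'n) R))"
  have "0 \<le> norm (iter_deriv [] g 0)" by simp
  also have "\<dots> \<le> B" by (rule B) simp
  finally have "B \<ge> 0" .
  have 1: "(\<Prod>i\<in>UNIV. 1 + (norm (zvec \<theta> \<xi> $ i))\<^sup>2) * norm (FL g (zvec \<theta> \<xi>)) \<le> ?C"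
    using FL_decay[OF K E finite_class.finite_UNIV g B] by simp
  have 2: "inverse (cweight \<xi>) \<le> (\<Prod>i\<in>UNIV. 1 + (norm (zvec \<theta> \<xi> $ i))\<^sup>2)"
    unfolding cweight_def prod_inversef[symmetric] inverse_inverse_eq o_def
    by (intro prod_mono) (auto simp: zvec_def cmod_power2)
  have "inverse (cweight \<xi>) * norm (FL g (zvec \<theta> \<xi>)) \<le> ?C"
    using mult_right_mono[OF 2 norm_ge_zero[of "FL g (zvec \<theta> \<xi>)"]] 1 by linarith
  then show ?thesis using cweight_pos[of \<xi>] by (simp add: field_simps)
qed

lemma zmon_measurable [measurable]: "(\<lambda>\<xi>. zmon is (zvec \<theta> \<xi>)) \<in> borel_measurable borel"
proof (induction "is")
  case (Cons i "is")
  have [measurable]: "(\<lambda>\<xi>. zvec \<theta> \<xi> $ i) \<in> borel_measurable borel"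
    unfolding zvec_def by (intro borel_measurable_continuous_onI) (auto intro!: continuous_intros)
  note [measurable] = Cons
  show ?case unfolding zmon_simps by measurable
qed simp

context
  fixes K :: "(real^'n::finite) set" and R :: real and m :: "real^'n \<Rightarrow> complex"
  assumes K: "compact K" "K \<subseteq> cball 0 R"
    and m: "m \<in> borel_measurable borel" "\<And>\<xi>. norm (m \<xi>) \<le> 1"
begin

lemma multiplier_zmon:
  assumes g: "g \<in> test_fns_in K"
  shows "zmon is (zvec \<theta> \<xi>) * (m \<xi> * FL g (zvec \<theta> \<xi>)) = m \<xi> * FL (iter_deriv is g) (zvec \<theta> \<xi>)"
  by (simp add: FL_iter_deriv[OF K(1) g])

lemma multiplier_rapid:
  assumes g: "g \<in> test_fns_in K"
  shows "rapid \<theta> (\<lambda>\<xi>. m \<xi> * FL g (zvec \<theta> \<xi>))"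
  unfolding rapid_def multiplier_zmon[OF g]
proof
  fix "is"
  let ?g = "iter_deriv is g"
  have g': "?g \<in> test_fns_in K" by (rule test_fns_in_iter_deriv[OF compact_imp_closed[OF K(1)] g])
  have "continuous_on K (\<lambda>y. exp (- (\<theta> \<bullet> y)))" by (intro continuous_intros)
  then have "bounded ((\<lambda>y. exp (- (\<theta> \<bullet> y))) ` K)"
    using K(1) compact_continuous_image compact_imp_bounded by blast
  then obtain E where E: "E > 0" "\<And>y. y \<in> K \<Longrightarrow> exp (- (\<theta> \<bullet> y)) \<le> E"
    unfolding bounded_pos by auto
  have "\<forall>js. \<exists>B\<ge>0. \<forall>x. norm (iter_deriv js ?g x) \<le> B" using test_bounded_deriv[OF K(1) g'] by blast
  then obtain B where B: "\<And>js. B js \<ge> 0" "\<And>js x. norm (iter_deriv js ?g x) \<le> B js" by metis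
  \<comment> \<open>There are finitely many derivative lists of bounded length, so one constant
    serves them all.\<close>
  define B' where "B' = sum B {js. set js \<subseteq> UNIV \<and> length js \<le> 2 * CARD('n)}"
  have "norm (iter_deriv js ?g y) \<le> B'" if "length js \<le> 2 * CARD('n)" for js y
    unfolding B'_def
    by (rule order_trans[OF B(2) member_le_sum[of js _ B]]) (use that B(1) finite_lists_length_le[of "UNIV :: 'n set"] in auto)
  from FL_le_cweight[OF K E(2) _ g' this] E(1)
  have le: "norm (FL ?g (zvec \<theta> \<xi>)) \<le> 2 ^ CARD('n) * (E * B' * measure lborel (cball (0::real^'n) R)) * cweight \<xi>" for \<xi>
    by simp
  show "integrable lborel (\<lambda>\<xi>. m \<xi> * FL ?g (zvec \<theta> \<xi>))"
  proof (rule Bochner_Integration.integrable_bound)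
    show "integrable lborel (\<lambda>\<xi>::real^'n. 2 ^ CARD('n) * (E * B' * measure lborel (cball (0::real^'n) R)) * cweight \<xi>)"
      by (intro integrable_mult_right cweight_integrable)
    show "(\<lambda>\<xi>. m \<xi> * FL ?g (zvec \<theta> \<xi>)) \<in> borel_measurable lborel"
      using m(1) FL_measurable[OF K(1) g'] by simp
    show "AE \<xi> in lborel. norm (m \<xi> * FL ?g (zvec \<theta> \<xi>))
      \<le> norm (2 ^ CARD('n) * (E * B' * measure lborel (cball (0::real^'n) R)) * cweight \<xi>)"
    proof (rule AE_I2)
      fix \<xi>
      have "norm (m \<xi> * FL ?g (zvec \<theta> \<xi>)) \<le> 1 * norm (FL ?g (zvec \<theta> \<xi>))"
        unfolding norm_mult by (intro mult_right_mono m(2)) auto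
      also note le[of \<xi>]
      finally show "norm (m \<xi> * FL ?g (zvec \<theta> \<xi>))
        \<le> norm (2 ^ CARD('n) * (E * B' * measure lborel (cball (0::real^'n) R)) * cweight \<xi>)" by simp
    qed
  qed
qed

text \<open>The kernel contributes exp (\<theta> \<bullet> x) and the transform contributes exp (-
  \<theta> \<bullet> y) over the support; together they form the weight in \<theta> \<bullet> (x -
  y). The remaining constant depends neither on \<theta> nor on the multiplier.\<close>

lemma multiplier_bound:
  assumes g: "g \<in> test_fns_in K" and E: "\<And>y. y \<in> K \<Longrightarrow> exp (\<theta> \<bullet> (x - y)) \<le> E" "E \<ge> 0"
    and B: "\<And>js y. length js \<le> length is + 2 * CARD('n) \<Longrightarrow> norm (iter_deriv js g y) \<le> B"
  shows "norm (iter_deriv is (I_op \<theta> (\<lambda>\<xi>. m \<xi> * FL g (zvec \<theta> \<xi>))) x)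
    \<le> 2 ^ CARD('n) * measure lborel (cball (0::real^'n) R) * (LINT \<xi>|lborel. cweight (\<xi>::real^'n)) * E * B"
proof -
  let ?g = "iter_deriv is g"
  have g': "?g \<in> test_fns_in K" by (rule test_fns_in_iter_deriv[OF compact_imp_closed[OF K(1)] g])
  let ?E = "E * exp (- (\<theta> \<bullet> x))"
  let ?w = "\<lambda>\<xi>::real^'n. 2 ^ CARD('n) * (?E * B * measure lborel (cball (0::real^'n) R)) * cweight \<xi>"
  have E': "exp (- (\<theta> \<bullet> y)) \<le> ?E" if "y \<in> K" for y
  proof -
    have "exp (- (\<theta> \<bullet> y)) = exp (\<theta> \<bullet> (x - y)) * exp (- (\<theta> \<bullet> x))"
      by (simp add: exp_add[symmetric] inner_diff_right)
    then show ?thesis using E(1)[OF that] by simp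
  qed
  have B': "norm (iter_deriv js ?g y) \<le> B" if "length js \<le> 2 * CARD('n)" for js y
    using B[of "js @ is" y] that by (simp add: iter_deriv_append)
  have le: "norm (m \<xi> * FL ?g (zvec \<theta> \<xi>)) \<le> ?w \<xi>" for \<xi>
  proof -
    have "norm (m \<xi> * FL ?g (zvec \<theta> \<xi>)) \<le> 1 * norm (FL ?g (zvec \<theta> \<xi>))"
      unfolding norm_mult by (intro mult_right_mono m(2)) auto
    also have "\<dots> \<le> ?w \<xi>" using FL_le_cweight[OF K E' _ g' B'] E(2) by simp
    finally show ?thesis .
  qed
  have "norm (I_op \<theta> (\<lambda>\<xi>. m \<xi> * FL ?g (zvec \<theta> \<xi>)) x) \<le> exp (\<theta> \<bullet> x) * (LINT \<xi>|lborel. ?w \<xi>)"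
    by (rule norm_I_op_le[OF _ le]) (intro integrable_mult_right cweight_integrable)
  also have "\<dots> = 2 ^ CARD('n) * measure lborel (cball (0::real^'n) R) * (LINT \<xi>|lborel. cweight (\<xi>::real^'n)) * E * B"
    by (simp add: exp_minus field_simps)
  finally show ?thesis
    unfolding iter_deriv_I_op[OF multiplier_rapid[OF g]] multiplier_zmon[OF g] .
qed

end

section \<open>The symbol of a differential operator\<close>

text \<open>\<open>lst \<alpha>\<close> is the very list chosen in \<open>mderiv\<close>, so that \<open>mderiv \<alpha>\<close> unfolds without reordering
  derivatives. The symbol \<open>psym P\<close> satisfies \<open>P(D) e\<^sup>z\<^sup>x = psym P z * e\<^sup>z\<^sup>x\<close>, and \<open>pbar P\<close> has the
  conjugate coefficients: on the contour \<open>Re z = \<theta>\<close> the conjugate of \<open>psym P z\<close> is the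
  polynomial \<open>pbar P (2 \<theta> - z)\<close>.\<close>

definition lst :: "('n::finite \<Rightarrow>\<^sub>0 nat) \<Rightarrow> 'n list" where
  "lst \<alpha> = (SOME is. count_list is = Poly_Mapping.lookup \<alpha>)"

definition co :: "'n::finite cpoly \<Rightarrow> ('n \<Rightarrow>\<^sub>0 nat) \<Rightarrow> complex" where
  "co P \<alpha> = Poly_Mapping.lookup P \<alpha> * (- \<i>) ^ mdeg \<alpha>"

definition psym :: "'n::finite cpoly \<Rightarrow> complex^'n \<Rightarrow> complex" where
  "psym P z = (\<Sum>\<alpha>\<in>Poly_Mapping.keys P. co P \<alpha> * zmon (lst \<alpha>) z)"

definition pbar :: "'n::finite cpoly \<Rightarrow> complex^'n \<Rightarrow> complex" where
  "pbar P z = (\<Sum>\<alpha>\<in>Poly_Mapping.keys P. cnj (co P \<alpha>) * zmon (lst \<alpha>) z)"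

lemma count_lst: "count_list (lst \<alpha>) = Poly_Mapping.lookup \<alpha>"
  unfolding lst_def using ex_count_list[of \<alpha>] by (rule someI_ex)

lemma length_lst: "length (lst \<alpha>) = mdeg \<alpha>"
  using sum_count_set[of "lst \<alpha>" UNIV] by (simp add: mdeg_def count_lst)

lemma mderiv_lst: "mderiv \<alpha> f = iter_deriv (lst \<alpha>) f"
  by (simp add: mderiv_def lst_def)

lemma diff_op_lst: "diff_op P f x = (\<Sum>\<alpha>\<in>Poly_Mapping.keys P. co P \<alpha> * iter_deriv (lst \<alpha>) f x)"
  by (simp add: diff_op_def co_def mderiv_lst)

lemma diff_op_I_op:
  assumes "rapid \<theta> M"
  shows "diff_op P (I_op \<theta> M) x = I_op \<theta> (\<lambda>\<xi>. psym P (zvec \<theta> \<xi>) * M \<xi>) x"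
proof -
  have "diff_op P (I_op \<theta> M) x = (\<Sum>\<alpha>\<in>Poly_Mapping.keys P. co P \<alpha> * I_op \<theta> (\<lambda>\<xi>. zmon (lst \<alpha>) (zvec \<theta> \<xi>) * M \<xi>) x)"
    by (simp add: diff_op_lst iter_deriv_I_op[OF assms])
  also have "\<dots> = I_op \<theta> (\<lambda>\<xi>. \<Sum>\<alpha>\<in>Poly_Mapping.keys P. co P \<alpha> * (zmon (lst \<alpha>) (zvec \<theta> \<xi>) * M \<xi>)) x"
    by (rule I_op_sum[symmetric]) (rule rapid_zmon[OF assms])
  finally show ?thesis by (simp add: psym_def sum_distrib_right mult.assoc)
qed

lemma diff_op_sum:
  assumes "\<And>a. a \<in> A \<Longrightarrow> f a \<in> smooth_fns X" "open X" "x \<in> X"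
  shows "diff_op P (\<lambda>x. \<Sum>a\<in>A. c a * f a x) x = (\<Sum>a\<in>A. c a * diff_op P (f a) x)"
proof -
  have "iter_deriv is (\<lambda>x. \<Sum>a\<in>A. c a * f a x) x = (\<Sum>a\<in>A. c a * iter_deriv is (f a) x)" for "is"
    using assms by (simp add: iter_deriv_sum[OF assms(2) smooth_cmult[OF assms(2) assms(1)] assms(3)] iter_deriv_cmult)
  then show ?thesis
    unfolding diff_op_lst sum_distrib_left
    by (subst sum.swap) (auto intro!: sum.cong simp: sum_distrib_left mult_ac)
qed

lemma cnj_psym:
  "cnj (psym P (zvec \<theta> \<xi>)) = pbar P (zvec (2 *\<^sub>R \<theta>) 0 - zvec \<theta> \<xi>)"
proof -
  have "cnj (zmon is (zvec \<theta> \<xi>)) = zmon is (zvec (2 *\<^sub>R \<theta>) 0 - zvec \<theta> \<xi>)" for "is"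
    by (induction "is") (auto simp: zvec_def)
  then show ?thesis by (simp add: psym_def pbar_def)
qed

text \<open>Multiplying a transform by w_i - z_i corresponds to applying the operator w_i minus the
  i-th partial derivative, which does not enlarge the support.\<close>

lemma FL_zmon_shift:
  assumes K: "compact K" and g: "g \<in> test_fns_in K"
  shows "\<exists>g'\<in>test_fns_in K. \<forall>z. FL g' z = zmon is (w - z) * FL g z"
proof (induction "is")
  case Nil
  then show ?case using g by auto
next
  case (Cons i "is")
  then obtain g' where g': "g' \<in> test_fns_in K" "\<And>z. FL g' z = zmon is (w - z) * FL g z" by blast
  have p: "partial_deriv i g' \<in> test_fns_in K"
    by (rule test_fns_in_partial_deriv[OF compact_imp_closed[OF K] g'(1)])
  have c: "(\<lambda>y. c * h y) \<in> test_fns_in K" if "h \<in> test_fns_in K" for c h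
    using that by (auto simp: test_fns_in_def intro: smooth_cmult)
  have "(\<lambda>y. w$i * g' y + (-1) * partial_deriv i g' y) \<in> test_fns_in K"
    using c[OF g'(1), of "w$i"] c[OF p, of "-1"]
      smooth_add[of UNIV "\<lambda>y. w$i * g' y" "\<lambda>y. (-1) * partial_deriv i g' y"] by (simp add: test_fns_in_def)
  moreover have "FL (\<lambda>y. w$i * g' y + (-1) * partial_deriv i g' y) z = zmon (i # is) (w - z) * FL g z" for z
    unfolding FL_add[OF K c[OF g'(1), of "w$i"] c[OF p, of "-1"]] FL_cmult FL_partial_deriv[OF K g'(1)] g'(2)
    by (simp add: algebra_simps)
  ultimately show ?case by blast
qed

lemma FL_pbar_shift:
  assumes K: "compact K" and g: "g \<in> test_fns_in K"
  shows "\<exists>g'\<in>test_fns_in K. \<forall>z. FL g' z = pbar P (w - z) * FL g z"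
proof -
  have "\<exists>g'\<in>test_fns_in K. \<forall>z. FL g' z = (\<Sum>\<alpha>\<in>A. cnj (co P \<alpha>) * zmon (lst \<alpha>) (w - z)) * FL g z"
    if "finite A" for A
    using that
  proof (induction A rule: finite_induct)
    case empty
    show ?case by (rule bexI[of _ "\<lambda>_. 0"]) (auto simp: FL_def test_fns_in_def)
  next
    case (insert \<alpha> A)
    then obtain g' where g': "g' \<in> test_fns_in K"
      "\<And>z. FL g' z = (\<Sum>\<alpha>\<in>A. cnj (co P \<alpha>) * zmon (lst \<alpha>) (w - z)) * FL g z" by blast
    obtain h where h: "h \<in> test_fns_in K" "\<And>z. FL h z = zmon (lst \<alpha>) (w - z) * FL g z"
      using FL_zmon_shift[OF K g] by blast
    let ?h = "\<lambda>y. cnj (co P \<alpha>) * h y"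
    have h': "?h \<in> test_fns_in K" using h(1) by (auto simp: test_fns_in_def intro: smooth_cmult)
    have "(\<lambda>y. ?h y + g' y) \<in> test_fns_in K"
      using h' g'(1) by (auto simp: test_fns_in_def intro: smooth_add)
    moreover have "FL (\<lambda>y. ?h y + g' y) z
      = (\<Sum>\<alpha>\<in>insert \<alpha> A. cnj (co P \<alpha>) * zmon (lst \<alpha>) (w - z)) * FL g z" for z
      using insert.hyps by (simp add: FL_add[OF K h' g'(1)] FL_cmult h(2) g'(2) distrib_right mult.assoc)
    ultimately show ?case by (intro bexI[of _ "\<lambda>y. ?h y + g' y"]) simp_all
  qed
  from this[of "Poly_Mapping.keys P"] show ?thesis by (simp add: pbar_def)
qed

section \<open>Extracting the principal part from values on a complex line\<close>

definition zpoly :: "'n::finite list \<Rightarrow> complex^'n \<Rightarrow> complex^'n \<Rightarrow> complex poly" where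
  "zpoly is w \<eta> = prod_list (map (\<lambda>i. [:w$i, \<eta>$i:]) is)"

lemma poly_zpoly: "poly (zpoly is w \<eta>) \<mu> = zmon is (w + \<mu> *s \<eta>)"
  by (induction "is") (auto simp: zpoly_def algebra_simps)

text \<open>Each linear factor raises the degree by at most one and contributes its slope
  \<open>\<eta>$i\<close> to the top coefficient, so the base point \<open>w\<close> drops out of
  it.\<close>

lemma zpoly_degree:
  "degree (zpoly is w \<eta>) \<le> length is" "coeff (zpoly is w \<eta>) (length is) = zmon is \<eta>"
proof (induction "is")
  case Nil
  case 1 show ?case by (simp add: zpoly_def)
next
  case Nil
  case 2 show ?case by (simp add: zpoly_def)
next
  case (Cons i "is")
  let ?q = "zpoly is w \<eta>"
  have c: "zpoly (i # is) w \<eta> = [:w$i, \<eta>$i:] * ?q" by (simp add: zpoly_def)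
  case 1
  have "degree (zpoly (i # is) w \<eta>) \<le> degree [:w$i, \<eta>$i:] + degree ?q"
    unfolding c by (rule degree_mult_le)
  also have "degree [:w$i, \<eta>$i:] \<le> 1" by simp
  finally show ?case using Cons by simp
next
  case (Cons i "is")
  let ?q = "zpoly is w \<eta>"
  have c: "zpoly (i # is) w \<eta> = [:w$i, \<eta>$i:] * ?q" by (simp add: zpoly_def)
  have "coeff ?q (Suc (length is)) = 0" using Cons by (intro coeff_eq_0) simp
  case 2
  then show ?case unfolding c using Cons \<open>coeff ?q (Suc (length is)) = 0\<close> by simp
qed

text \<open>Iterated divided differences express the leading coefficient through values at integer points.\<close>

lemma leading_coeff_functional:
  "\<exists>a::nat \<Rightarrow> complex. \<forall>q. degree q \<le> m \<longrightarrow> (\<Sum>j\<le>m. a j * poly q (of_nat j)) = coeff q m"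
proof (induction m)
  case 0
  show ?case by (rule exI[of _ "\<lambda>_. 1"]) (auto simp: degree_eq_zeroE elim!: degree_eq_zeroE)
next
  case (Suc m)
  then obtain a where a: "\<And>q::complex poly. degree q \<le> m \<Longrightarrow> (\<Sum>j\<le>m. a j * poly q (of_nat j)) = coeff q m" by blast
  define c :: complex where "c = of_nat (Suc m)"
  \<comment> \<open>The new functional is the old one applied to the divided difference (q(x) -
    q(c)) / (x - c) with the new node c = m + 1. That quotient has degree at most m and the same
    leading coefficient.\<close>
  define a' where "a' j = (if j \<le> m then a j / (of_nat j - c) else - (\<Sum>j\<le>m. a j / (of_nat j - c)))" for j
  have ne: "of_nat j - c \<noteq> 0" if "j \<le> m" for j
    using that unfolding c_def right_minus_eq of_nat_eq_iff by simp
  show ?case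
  proof (intro exI[of _ a'] allI impI)
    fix q :: "complex poly" assume q: "degree q \<le> Suc m"
    define r where "r = synthetic_div q c"
    have qr: "q + smult c r = pCons (poly q c) r" unfolding r_def by (rule synthetic_div_correct)
    have dr: "degree r \<le> m" unfolding r_def using q by (simp add: degree_synthetic_div)
    have "coeff (q + smult c r) (Suc m) = coeff (pCons (poly q c) r) (Suc m)" by (simp only: qr)
    moreover have "coeff r (Suc m) = 0" using dr by (simp add: coeff_eq_0)
    ultimately have lead: "coeff q (Suc m) = coeff r m" by simp
    have val: "poly r (of_nat j) = (poly q (of_nat j) - poly q c) / (of_nat j - c)" if "j \<le> m" for j
    proof -
      have "poly (q + smult c r) (of_nat j) = poly (pCons (poly q c) r) (of_nat j)" by (simp only: qr)
      then have "poly r (of_nat j) * (of_nat j - c) = poly q (of_nat j) - poly q c"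
        by (simp add: algebra_simps)
      then show ?thesis using ne[OF that] by (simp add: field_simps)
    qed
    have "(\<Sum>j\<le>Suc m. a' j * poly q (of_nat j)) = (\<Sum>j\<le>m. a' j * poly q (of_nat j)) + a' (Suc m) * poly q c"
      by (simp add: c_def)
    also have "\<dots> = (\<Sum>j\<le>m. a j / (of_nat j - c) * poly q (of_nat j)) - (\<Sum>j\<le>m. a j / (of_nat j - c) * poly q c)"
      by (simp add: a'_def sum_distrib_right)
    also have "\<dots> = (\<Sum>j\<le>m. a j * poly r (of_nat j))"
      unfolding sum_subtractf[symmetric]
      by (rule sum.cong) (auto simp: val diff_divide_distrib algebra_simps)
    finally show "(\<Sum>j\<le>Suc m. a' j * poly q (of_nat j)) = coeff q (Suc m)"
      using a[OF dr] lead by simp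
  qed
qed

text \<open>The lower digits contribute less than \<open>B ^ n\<close>, so division by
  \<open>B ^ n\<close> recovers the top digit; the others follow by induction.\<close>

lemma digits_unique:
  fixes a b :: "nat \<Rightarrow> nat"
  assumes "\<And>k. k < n \<Longrightarrow> a k < B" "\<And>k. k < n \<Longrightarrow> b k < B"
    "(\<Sum>k<n. a k * B ^ k) = (\<Sum>k<n. b k * B ^ k)" "k < n"
  shows "a k = b k"
  using assms
proof (induction n arbitrary: k)
  case (Suc n)
  have lt: "(\<Sum>k<n. c k * B ^ k) < B ^ n" if "\<And>k. k < n \<Longrightarrow> c k < B" for c :: "nat \<Rightarrow> nat" and n
    using that
  proof (induction n)
    case (Suc n)
    have "(\<Sum>k<Suc n. c k * B ^ k) < B ^ n + c n * B ^ n" using Suc by simp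
    also have "\<dots> = Suc (c n) * B ^ n" by simp
    also have "\<dots> \<le> B * B ^ n" using Suc.prems[of n] by (intro mult_right_mono) auto
    finally show ?case by simp
  qed simp
  let ?s = "\<lambda>c. \<Sum>k<n. c k * B ^ k"
  have la: "?s a < B ^ n" "?s b < B ^ n" using lt Suc.prems by auto
  have quot: "(s + q * N) div N = q" if "s < N" for s q N :: nat
    using that by (subst div_mult_self1) auto
  have e: "?s a + a n * B ^ n = ?s b + b n * B ^ n" using Suc.prems(3) by simp
  have "(?s a + a n * B ^ n) div B ^ n = a n" "(?s b + b n * B ^ n) div B ^ n = b n"
    using quot[OF la(1)] quot[OF la(2)] by blast+
  then have "a n = b n" using e by simp
  then have "?s a = ?s b" using e by simp
  then show ?case using Suc.IH[of k] Suc.prems \<open>a n = b n\<close> by (cases "k = n") auto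
qed simp

text \<open>Kronecker substitution: on the curve \<open>\<eta>\<^sub>i = T ^ (B ^ e i)\<close> distinct monomials of degree
  less than \<open>B\<close> become distinct powers of \<open>T\<close>.\<close>

lemma monomials_independent:
  fixes c :: "('n::finite \<Rightarrow>\<^sub>0 nat) \<Rightarrow> complex"
  assumes A: "finite A" "\<alpha>0 \<in> A" "c \<alpha>0 \<noteq> 0"
  shows "\<exists>\<eta>::real^'n. (\<Sum>\<alpha>\<in>A. c \<alpha> * zmon (lst \<alpha>) (zvec \<eta> 0)) \<noteq> 0"
proof -
  obtain e :: "'n \<Rightarrow> nat" where e: "bij_betw e UNIV {..<CARD('n)}"
    using ex_bij_betw_finite_nat[of "UNIV :: 'n set"] by (auto simp: atLeast0LessThan)
  \<comment> \<open>Exceeds every exponent occurring in \<open>A\<close>, so that exponents can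
    serve as digits in base \<open>B\<close>.\<close>
  define B where "B = Suc (\<Sum>\<alpha>\<in>A. mdeg \<alpha>)"
  define w where "w \<alpha> = (\<Sum>i\<in>UNIV. Poly_Mapping.lookup \<alpha> i * B ^ e i)" for \<alpha> :: "'n \<Rightarrow>\<^sub>0 nat"
  have lk: "Poly_Mapping.lookup \<alpha> i < B" if "\<alpha> \<in> A" for \<alpha> i
  proof -
    have "Poly_Mapping.lookup \<alpha> i \<le> mdeg \<alpha>" unfolding mdeg_def by (rule member_le_sum) auto
    also have "\<dots> \<le> (\<Sum>\<alpha>\<in>A. mdeg \<alpha>)" using that A(1) by (intro member_le_sum) auto
    finally show ?thesis by (simp add: B_def)
  qed
  have winv: "w \<alpha> = (\<Sum>k<CARD('n). Poly_Mapping.lookup \<alpha> (inv e k) * B ^ k)" for \<alpha>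
    unfolding w_def sum.reindex_bij_betw[OF e, symmetric]
    using bij_betw_imp_inj_on[OF e] by (simp add: inv_f_f)
  have inj: "\<alpha> = \<beta>" if "\<alpha> \<in> A" "\<beta> \<in> A" "w \<alpha> = w \<beta>" for \<alpha> \<beta>
  proof -
    have "Poly_Mapping.lookup \<alpha> (inv e k) = Poly_Mapping.lookup \<beta> (inv e k)" if "k < CARD('n)" for k
      using digits_unique[of "CARD('n)" "\<lambda>k. Poly_Mapping.lookup \<alpha> (inv e k)" B "\<lambda>k. Poly_Mapping.lookup \<beta> (inv e k)" k]
        lk \<open>\<alpha> \<in> A\<close> \<open>\<beta> \<in> A\<close> \<open>w \<alpha> = w \<beta>\<close> that winv by auto
    moreover have "e i < CARD('n)" "inv e (e i) = i" for i
      using e bij_betw_imp_inj_on[OF e] by (auto simp: bij_betw_def inv_f_f)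
    ultimately have "Poly_Mapping.lookup \<alpha> i = Poly_Mapping.lookup \<beta> i" for i by metis
    then show ?thesis by (intro poly_mapping_eqI)
  qed
  define q where "q = (\<Sum>\<alpha>\<in>A. monom (c \<alpha>) (w \<alpha>))"
  have "coeff q (w \<alpha>0) = (\<Sum>\<alpha>\<in>A. if \<alpha> = \<alpha>0 then c \<alpha> else 0)"
    unfolding q_def coeff_sum using inj A(2) by (intro sum.cong) auto
  also have "\<dots> = c \<alpha>0" using A by simp
  finally have "q \<noteq> 0" using A(3) by auto
  then have "finite {x. poly q x = 0}" by (rule poly_roots_finite)
  moreover have "infinite (range complex_of_real)"
    using infinite_UNIV_char_0 finite_imageD[of complex_of_real UNIV] by (auto simp: inj_on_def)
  ultimately obtain T where T: "poly q (complex_of_real T) \<noteq> 0"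
    by (metis (mono_tags, lifting) finite_subset image_subsetI mem_Collect_eq)
  define \<eta> :: "real^'n" where "\<eta> = (\<chi> i. T ^ (B ^ e i))"
  have "zmon (lst \<alpha>) (zvec \<eta> 0) = of_real T ^ w \<alpha>" for \<alpha>
  proof -
    have "zmon is (zvec \<eta> 0) = of_real T ^ sum_list (map (\<lambda>i. B ^ e i) is)" for "is"
      by (induction "is") (auto simp: zvec_def \<eta>_def power_add)
    also have "sum_list (map (\<lambda>i. B ^ e i) (lst \<alpha>)) = w \<alpha>"
      unfolding w_def by (subst sum_list_map_eq_sum_count2[of _ UNIV]) (auto simp: count_lst)
    finally show ?thesis .
  qed
  then have "(\<Sum>\<alpha>\<in>A. c \<alpha> * zmon (lst \<alpha>) (zvec \<eta> 0)) = poly q (of_real T)"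
    by (simp add: q_def poly_sum poly_monom)
  with T show ?thesis by metis
qed

text \<open>Along the line \<open>w + \<mu> \<eta>\<close> the polynomial \<open>pbar P\<close> has
  degree at most m in \<mu>, and its coefficient at m is the principal part at \<eta>, which does
  not see \<open>w\<close>. The direction \<eta> is chosen off the zeros of the principal part.
  Since the weight vector \<tau> will enter only through \<open>w\<close>, this is the source of all
  uniformity.\<close>

lemma pbar_combination:
  fixes P :: "'n::finite cpoly"
  assumes "P \<noteq> 0"
  shows "\<exists>m (a::nat \<Rightarrow> complex) (\<eta>::real^'n) c. c \<noteq> 0 \<and>
    (\<forall>w. (\<Sum>j\<le>m. a j * pbar P (w + of_nat j *s zvec \<eta> 0)) = c)"
proof -
  let ?k = "Poly_Mapping.keys P"
  define m where "m = Max (mdeg ` ?k)"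
  have "?k \<noteq> {}" using assms by simp
  then have "m \<in> mdeg ` ?k" unfolding m_def by (intro Max_in) auto
  then obtain \<alpha>0 where \<alpha>0: "\<alpha>0 \<in> ?k" "mdeg \<alpha>0 = m" by blast
  have le: "mdeg \<alpha> \<le> m" if "\<alpha> \<in> ?k" for \<alpha> unfolding m_def using that by (intro Max_ge) auto
  define b where "b \<alpha> = cnj (co P \<alpha>)" for \<alpha>
  have "b \<alpha>0 \<noteq> 0" using \<alpha>0 by (simp add: b_def co_def in_keys_iff)
  then obtain \<eta> :: "real^'n" where \<eta>: "(\<Sum>\<alpha>\<in>{\<alpha>\<in>?k. mdeg \<alpha> = m}. b \<alpha> * zmon (lst \<alpha>) (zvec \<eta> 0)) \<noteq> 0"
    using monomials_independent[of "{\<alpha>\<in>?k. mdeg \<alpha> = m}" \<alpha>0 b] \<alpha>0 by auto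
  obtain a :: "nat \<Rightarrow> complex" where a: "\<And>q. degree q \<le> m \<Longrightarrow> (\<Sum>j\<le>m. a j * poly q (of_nat j)) = coeff q m"
    using leading_coeff_functional[of m] by blast
  have "(\<Sum>j\<le>m. a j * pbar P (w + of_nat j *s zvec \<eta> 0))
    = (\<Sum>\<alpha>\<in>{\<alpha>\<in>?k. mdeg \<alpha> = m}. b \<alpha> * zmon (lst \<alpha>) (zvec \<eta> 0))" for w
  proof -
    define Q where "Q = (\<Sum>\<alpha>\<in>?k. smult (b \<alpha>) (zpoly (lst \<alpha>) w (zvec \<eta> 0)))"
    have "degree (smult (b \<alpha>) (zpoly (lst \<alpha>) w (zvec \<eta> 0))) \<le> m" if "\<alpha> \<in> ?k" for \<alpha>
      using zpoly_degree(1)[of "lst \<alpha>" w "zvec \<eta> 0"] le[OF that] length_lst[of \<alpha>]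
        degree_smult_le[of "b \<alpha>" "zpoly (lst \<alpha>) w (zvec \<eta> 0)"] by linarith
    then have "degree Q \<le> m" unfolding Q_def by (intro degree_sum_le) auto
    have "pbar P (w + \<mu> *s zvec \<eta> 0) = poly Q \<mu>" for \<mu>
      by (simp add: pbar_def Q_def poly_sum poly_zpoly b_def)
    then have "(\<Sum>j\<le>m. a j * pbar P (w + of_nat j *s zvec \<eta> 0)) = coeff Q m"
      using a[OF \<open>degree Q \<le> m\<close>] by simp
    also have "\<dots> = (\<Sum>\<alpha>\<in>?k. b \<alpha> * coeff (zpoly (lst \<alpha>) w (zvec \<eta> 0)) m)"
      by (simp add: Q_def coeff_sum)
    also have "\<dots> = (\<Sum>\<alpha>\<in>?k. if mdeg \<alpha> = m then b \<alpha> * zmon (lst \<alpha>) (zvec \<eta> 0) else 0)"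
    proof (rule sum.cong)
      fix \<alpha> assume "\<alpha> \<in> ?k"
      show "b \<alpha> * coeff (zpoly (lst \<alpha>) w (zvec \<eta> 0)) m = (if mdeg \<alpha> = m then b \<alpha> * zmon (lst \<alpha>) (zvec \<eta> 0) else 0)"
      proof (cases "mdeg \<alpha> = m")
        case True
        then show ?thesis using zpoly_degree(2)[of "lst \<alpha>" w "zvec \<eta> 0"] by (simp add: length_lst)
      next
        case False
        then have "degree (zpoly (lst \<alpha>) w (zvec \<eta> 0)) < m"
          using zpoly_degree(1)[of "lst \<alpha>" w "zvec \<eta> 0"] le[OF \<open>\<alpha> \<in> ?k\<close>] by (simp add: length_lst)
        then show ?thesis using False by (simp add: coeff_eq_0)
      qed
    qed simp
    also have "\<dots> = (\<Sum>\<alpha>\<in>{\<alpha>\<in>?k. mdeg \<alpha> = m}. b \<alpha> * zmon (lst \<alpha>) (zvec \<eta> 0))"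
      by (simp add: sum.inter_filter)
    finally show ?thesis .
  qed
  with \<eta> show ?thesis by blast
qed

section \<open>Solutions with exponential weights\<close>

text \<open>The bound is stated for every majorant \<open>E\<close> of the weight at every point, so
  that a single \<open>v\<close> yields both a small bound on the convex set and a large one
  elsewhere. The extra \<open>2 * CARD('n)\<close> derivatives of \<open>g\<close> pay for the
  integrable weight in frequency.\<close>

definition weighted_sol ::
  "'n::finite cpoly \<Rightarrow> (real^'n) set \<Rightarrow> real \<Rightarrow> real^'n \<Rightarrow> (real^'n \<Rightarrow> complex) \<Rightarrow> real \<Rightarrow> (real^'n \<Rightarrow> complex) \<Rightarrow> bool" where
  "weighted_sol P K R \<tau> g A v \<longleftrightarrow> v \<in> smooth_fns UNIV \<and> (\<forall>x. diff_op P v x = g x) \<and>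
    (\<forall>is x E B. norm x \<le> R \<longrightarrow> E \<ge> 0 \<longrightarrow> (\<forall>y\<in>K. exp (\<tau> \<bullet> (x - y)) \<le> E) \<longrightarrow>
      (\<forall>js y. length js \<le> length is + 2 * CARD('n) \<longrightarrow> norm (iter_deriv js g y) \<le> B) \<longrightarrow>
      norm (iter_deriv is v x) \<le> A * E * B)"

text \<open>The point of the following theorem is that \<open>A\<close> does not depend on \<open>\<tau>\<close>. Zeros of the symbol are
  harmless: with \<open>x / 0 = 0\<close> the multiplier \<open>cnj p / p\<close> still satisfies \<open>p * (cnj p / p) = cnj p\<close>.\<close>

theorem diff_op_solve:
  fixes P :: "'n::finite cpoly"
  assumes "P \<noteq> 0"
  shows "\<exists>A\<ge>0. \<forall>K (\<tau>::real^'n) g. compact K \<longrightarrow> K \<subseteq> cball 0 R \<longrightarrow> g \<in> test_fns_in K \<longrightarrow>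
    (\<exists>v. weighted_sol P K R \<tau> g A v)"
proof -
  obtain m and a :: "nat \<Rightarrow> complex" and \<eta> :: "real^'n" and c where c: "c \<noteq> 0"
    and comb: "\<And>w. (\<Sum>j\<le>m. a j * pbar P (w + of_nat j *s zvec \<eta> 0)) = c"
    using pbar_combination[OF assms] by blast
  define pp :: complex where "pp = (2*pi) ^ CARD('n)"
  have "pp \<noteq> 0" by (simp add: pp_def)
  define W where "W = 2 ^ CARD('n) * measure lborel (cball (0::real^'n) R) * (LINT \<xi>|lborel. cweight (\<xi>::real^'n))"
  have "0 \<le> (LINT \<xi>|lborel. cweight (\<xi>::real^'n))"
    by (rule integral_nonneg_AE) (simp add: less_imp_le[OF cweight_pos])
  then have "W \<ge> 0" unfolding W_def by (intro mult_nonneg_nonneg) auto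
  \<comment> \<open>The last factor bounds the exponential of (j/2) \<eta> \<bullet> (x - y) for j
    \<le> m, where |x - y| \<le> 2 R.\<close>
  define A where "A = (\<Sum>j\<le>m. norm (a j / (c * pp))) * W * exp (real m * norm \<eta> * R)"
  show ?thesis
  proof (intro exI[of _ A] conjI allI impI)
    show "A \<ge> 0" unfolding A_def using \<open>W \<ge> 0\<close> by (intro mult_nonneg_nonneg sum_nonneg) auto
    fix K :: "(real^'n) set" and \<tau> :: "real^'n" and g :: "real^'n \<Rightarrow> complex"
    assume K: "compact K" "K \<subseteq> cball 0 R" and g: "g \<in> test_fns_in K"
    \<comment> \<open>With this half step 2 \<theta>_j - z = (2 \<tau> - z) + j \<eta>, the
      arithmetic progression that \<open>comb\<close> requires.\<close>
    define \<theta> where "\<theta> j = \<tau> + (real j / 2) *\<^sub>R \<eta>" for j :: nat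
    define mu where "mu j \<xi> = cnj (psym P (zvec (\<theta> j) \<xi>)) / psym P (zvec (\<theta> j) \<xi>)" for j \<xi>
    have [measurable]: "(\<lambda>\<xi>. psym P (zvec \<theta> \<xi>)) \<in> borel_measurable borel" for \<theta>
      unfolding psym_def by measurable
    have mu: "mu j \<in> borel_measurable borel" "norm (mu j \<xi>) \<le> 1" for j \<xi>
    proof -
      have "cnj \<in> borel_measurable borel" by (intro borel_measurable_continuous_onI continuous_intros)
      from measurable_compose[OF _ this] have [measurable]: "(\<lambda>\<xi>. cnj (psym P (zvec (\<theta> j) \<xi>))) \<in> borel_measurable borel"
        by measurable
      show "mu j \<in> borel_measurable borel" unfolding mu_def[abs_def] by measurable
      show "norm (mu j \<xi>) \<le> 1" by (simp add: mu_def norm_divide)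
    qed
    \<comment> \<open>The constant multiplier 1, through which the multiplier lemmas also cover
      plain Fourier inversion.\<close>
    have one: "(\<lambda>_. 1) \<in> borel_measurable borel" "norm (1::complex) \<le> 1" by auto
    define I where "I j = I_op (\<theta> j) (\<lambda>\<xi>. mu j \<xi> * FL g (zvec (\<theta> j) \<xi>))" for j
    note rap = multiplier_rapid[OF K mu g]
    have I: "I j \<in> smooth_fns UNIV" for j unfolding I_def by (rule I_op_smooth[OF rap])
    define v where "v x = (\<Sum>j\<le>m. a j / (c * pp) * I j x)" for x
    have inv: "I_op \<theta> (\<lambda>\<xi>. FL h (zvec \<theta> \<xi>)) x = pp * h x" if "h \<in> test_fns_in K" for \<theta> h x
      unfolding pp_def
      using FL_inversion[OF K(1) that] rapid_integrable(2)[OF multiplier_rapid[OF K one that]] by simp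
    have "\<forall>j. \<exists>g'\<in>test_fns_in K. \<forall>z. FL g' z = pbar P (zvec (2 *\<^sub>R \<theta> j) 0 - z) * FL g z"
      using FL_pbar_shift[OF K(1) g] by blast
    then obtain G where G: "\<And>j. G j \<in> test_fns_in K"
      "\<And>j z. FL (G j) z = pbar P (zvec (2 *\<^sub>R \<theta> j) 0 - z) * FL g z" by metis
    have DI: "diff_op P (I j) x = pp * G j x" for j x
    proof -
      have cancel: "psym P z * (cnj (psym P z) / psym P z * y) = cnj (psym P z) * y" for z y by simp
      have "diff_op P (I j) x = I_op (\<theta> j) (\<lambda>\<xi>. psym P (zvec (\<theta> j) \<xi>) * (mu j \<xi> * FL g (zvec (\<theta> j) \<xi>))) x"
        unfolding I_def by (rule diff_op_I_op[OF rap])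
      also have "\<dots> = I_op (\<theta> j) (\<lambda>\<xi>. cnj (psym P (zvec (\<theta> j) \<xi>)) * FL g (zvec (\<theta> j) \<xi>)) x"
        by (simp only: mu_def cancel)
      also have "\<dots> = I_op (\<theta> j) (\<lambda>\<xi>. FL (G j) (zvec (\<theta> j) \<xi>)) x"
        unfolding cnj_psym G(2) ..
      finally show ?thesis using inv[OF G(1)] by simp
    qed
    \<comment> \<open>The formula for \<open>FL (G j)\<close> holds at every complex point, so the
      \<open>G j\<close>, which belong to different contours, can be compared along the single
      contour through 0. There their combination is c times the transform of
      \<open>g\<close>.\<close>
    have sumG: "(\<Sum>j\<le>m. a j * G j x) = c * g x" for x
    proof -
      have sh: "zvec (2 *\<^sub>R \<theta> j) 0 - z = (zvec (2 *\<^sub>R \<tau>) 0 - z) + of_nat j *s zvec \<eta> 0" for j z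
        by (simp add: vec_eq_iff zvec_def \<theta>_def algebra_simps)
      have "pp * (\<Sum>j\<le>m. a j * G j x) = (\<Sum>j\<le>m. a j * I_op 0 (\<lambda>\<xi>. FL (G j) (zvec 0 \<xi>)) x)"
        by (simp add: inv[OF G(1)] sum_distrib_left mult_ac)
      also have "\<dots> = I_op 0 (\<lambda>\<xi>. \<Sum>j\<le>m. a j * FL (G j) (zvec 0 \<xi>)) x"
        by (rule I_op_sum[symmetric]) (use multiplier_rapid[OF K one G(1), of 0] in simp)
      also have "(\<lambda>\<xi>. \<Sum>j\<le>m. a j * FL (G j) (zvec 0 \<xi>)) = (\<lambda>\<xi>. \<Sum>j\<in>{0::nat}. c * FL g (zvec 0 \<xi>))"
      proof
        fix \<xi> :: "real^'n"
        have "(\<Sum>j\<le>m. a j * FL (G j) (zvec 0 \<xi>))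
          = (\<Sum>j\<le>m. a j * pbar P ((zvec (2 *\<^sub>R \<tau>) 0 - zvec 0 \<xi>) + of_nat j *s zvec \<eta> 0)) * FL g (zvec 0 \<xi>)"
          by (simp only: G(2) sh sum_distrib_right mult.assoc)
        then show "(\<Sum>j\<le>m. a j * FL (G j) (zvec 0 \<xi>)) = (\<Sum>j\<in>{0::nat}. c * FL g (zvec 0 \<xi>))"
          unfolding comb by simp
      qed
      also have "I_op 0 (\<lambda>\<xi>. \<Sum>j\<in>{0::nat}. c * FL g (zvec 0 \<xi>)) x = (\<Sum>j\<in>{0::nat}. c * I_op 0 (\<lambda>\<xi>. FL g (zvec 0 \<xi>)) x)"
        by (rule I_op_sum) (use multiplier_rapid[OF K one g, of 0] in simp)
      finally have "pp * (\<Sum>j\<le>m. a j * G j x) = pp * (c * g x)" by (simp add: inv[OF g])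
      then show ?thesis using \<open>pp \<noteq> 0\<close> by simp
    qed
    show "\<exists>v. weighted_sol P K R \<tau> g A v"
      unfolding weighted_sol_def
    proof (intro exI[of _ v] conjI allI impI)
      show "v \<in> smooth_fns UNIV" unfolding v_def[abs_def] by (intro smooth_sum smooth_cmult I) auto
      show "diff_op P v x = g x" for x
      proof -
        have "diff_op P v x = (\<Sum>j\<le>m. a j / (c * pp) * (pp * G j x))"
          unfolding v_def[abs_def] using I by (subst diff_op_sum[of _ _ UNIV]) (auto simp: DI)
        also have "\<dots> = (\<Sum>j\<le>m. a j * G j x) / c"
          using \<open>pp \<noteq> 0\<close> c by (simp add: sum_divide_distrib)
        finally show ?thesis using c by (simp add: sumG)
      qed
      fix "is" :: "'n list" and x :: "real^'n" and E B
      assume x: "norm x \<le> R" and E: "E \<ge> 0" "\<forall>y\<in>K. exp (\<tau> \<bullet> (x - y)) \<le> E"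
        and B: "\<forall>js y. length js \<le> length is + 2 * CARD('n) \<longrightarrow> norm (iter_deriv js g y) \<le> B"
      have "0 \<le> norm (iter_deriv [] g 0)" by simp
      also have "\<dots> \<le> B" using B[rule_format, of "[]" 0] by simp
      finally have "B \<ge> 0" .
      let ?E = "E * exp (real m * norm \<eta> * R)"
      have bI: "norm (iter_deriv is (I j) x) \<le> W * ?E * B" if "j \<le> m" for j
        unfolding I_def W_def
      proof (rule multiplier_bound[OF K mu g])
        fix y assume y: "y \<in> K"
        have "norm (x - y) \<le> 2 * R" using x y K(2) norm_triangle_ineq4[of x y] by force
        have "\<theta> j \<bullet> (x - y) = \<tau> \<bullet> (x - y) + (real j / 2) * (\<eta> \<bullet> (x - y))"
          by (simp add: \<theta>_def inner_add_left)
        also have "(real j / 2) * (\<eta> \<bullet> (x - y)) \<le> (real j / 2) * (norm \<eta> * (2 * R))"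
        proof (rule mult_left_mono)
          have "\<eta> \<bullet> (x - y) \<le> norm \<eta> * norm (x - y)" by (rule norm_cauchy_schwarz)
          also have "\<dots> \<le> norm \<eta> * (2 * R)" using \<open>norm (x - y) \<le> 2 * R\<close> by (intro mult_left_mono) auto
          finally show "\<eta> \<bullet> (x - y) \<le> norm \<eta> * (2 * R)" .
        qed simp
        also have "(real j / 2) * (norm \<eta> * (2 * R)) \<le> (real m / 2) * (norm \<eta> * (2 * R))"
          using that order_trans[OF norm_ge_zero x] by (intro mult_right_mono) auto
        finally have "exp (\<theta> j \<bullet> (x - y)) \<le> exp (\<tau> \<bullet> (x - y)) * exp (real m * norm \<eta> * R)"
          by (simp add: exp_add[symmetric] mult_ac)
        also have "\<dots> \<le> ?E" using E(2) y by (intro mult_right_mono) auto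
        finally show "exp (\<theta> j \<bullet> (x - y)) \<le> ?E" .
      qed (use E B in auto)
      have "iter_deriv is v x = (\<Sum>j\<le>m. a j / (c * pp) * iter_deriv is (I j) x)"
        unfolding v_def[abs_def] using I smooth_cmult[OF _ I]
        by (subst iter_deriv_sum[of UNIV]) (auto simp: iter_deriv_cmult[of UNIV] simp del: times_divide_eq_left)
      then have "norm (iter_deriv is v x) \<le> (\<Sum>j\<le>m. norm (a j / (c * pp)) * norm (iter_deriv is (I j) x))"
        by (simp only: norm_mult[symmetric] norm_sum)
      also have "\<dots> \<le> (\<Sum>j\<le>m. norm (a j / (c * pp)) * (W * ?E * B))"
        by (intro sum_mono mult_left_mono bI) auto
      also have "\<dots> = A * E * B" by (simp add: A_def sum_distrib_right sum_distrib_left mult_ac)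
      finally show "norm (iter_deriv is v x) \<le> A * E * B" .
    qed
  qed
qed

section \<open>Mollification\<close>

definition mollifier :: "(real^'n::finite \<Rightarrow> real) \<Rightarrow> bool" where
  "mollifier \<rho> \<longleftrightarrow> (\<lambda>x. complex_of_real (\<rho> x)) \<in> test_fns_in (cball 0 1) \<and> (\<forall>x. \<rho> x \<ge> 0) \<and>
     (LINT x|lborel. \<rho> x) = 1"

text \<open>The summand 0 in the argument keeps the affine shape of \<open>smooth_affine\<close> and
  \<open>test_fns_in_affine\<close>.\<close>

definition moll :: "(real^'n::finite \<Rightarrow> real) \<Rightarrow> real \<Rightarrow> real^'n \<Rightarrow> complex" where
  "moll \<rho> \<delta> x = of_real ((1/\<delta>) ^ CARD('n)) * of_real (\<rho> (0 + (1/\<delta>) *\<^sub>R x))"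

lemma ex_mollifier: "\<exists>\<rho>::real^'n::finite \<Rightarrow> real. mollifier \<rho>"
proof -
  obtain b :: "real^'n \<Rightarrow> real" where b: "(\<lambda>x. complex_of_real (b x)) \<in> test_fns_in (cbox (\<chi> i. -1) (\<chi> i. 1))"
    "\<And>x. b x \<ge> 0" "\<And>x. x \<in> box (\<chi> i. -1) (\<chi> i. 1) \<Longrightarrow> b x > 0"
    using ex_bump by blast
  \<comment> \<open>Shrinking the cube by this factor puts it inside the Euclidean unit ball, by the
    l1 bound for the norm.\<close>
  let ?n = "real CARD('n)"
  define b1 where "b1 x = b (0 + ?n *\<^sub>R x)" for x
  have t1: "(\<lambda>x. complex_of_real (b1 x)) \<in> test_fns_in (cball 0 1)"
    unfolding b1_def
  proof (rule test_fns_in_affine[OF b(1)])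
    fix y :: "real^'n" assume "0 + ?n *\<^sub>R y \<in> cbox (\<chi> i. -1) (\<chi> i. 1)"
    then have "\<bar>y$i\<bar> \<le> 1 / ?n" for i
      by (simp add: mem_box_cart abs_le_iff field_simps)
    then have "(\<Sum>i\<in>UNIV. \<bar>y$i\<bar>) \<le> (\<Sum>i\<in>(UNIV::'n set). 1 / ?n)" by (intro sum_mono) auto
    then show "y \<in> cball 0 1" using norm_le_l1_cart[of y] by simp
  qed
  define J where "J = (LINT x|lborel. b1 x)"
  have int: "integrable lborel b1"
    using test_integrable[OF _ t1] by (simp add: complex_of_real_integrable_eq)
  have pos: "b1 x > 0" if "x \<in> box (\<chi> i. -1/?n) (\<chi> i. 1/?n)" for x
    unfolding b1_def using that by (intro b(3)) (auto simp: mem_box_cart field_simps)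
  have "J \<noteq> 0"
  proof
    assume "J = 0"
    moreover have "AE x in lborel. 0 \<le> b1 x" by (simp add: b1_def b(2))
    ultimately have "AE x in lborel. b1 x = 0"
      using integral_nonneg_eq_0_iff_AE[OF int] unfolding J_def by blast
    then have "AE x in lborel. x \<notin> box (\<chi> i. -1/?n) ((\<chi> i. 1/?n) :: real^'n)"
      by eventually_elim (use pos in force)
    then have "emeasure lborel (box (\<chi> i. -1/?n) ((\<chi> i. 1/?n) :: real^'n)) = 0"
      by (subst (asm) AE_iff_measurable[OF _ refl]) (auto simp: box_def)
    moreover have i: "(\<chi> i. 1/?n) \<bullet> b = 1/?n" "(\<chi> i. -1/?n) \<bullet> b = -1/?n" if "b \<in> Basis" for b :: "real^'n"
      using that by (auto simp: Basis_vec_def inner_axis)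
    have "emeasure lborel (box (\<chi> i. -1/?n) ((\<chi> i. 1/?n) :: real^'n)) = ennreal (\<Prod>b\<in>(Basis :: (real^'n) set). 2/?n)"
    proof (subst emeasure_lborel_box)
      show "(\<chi> i. -1/?n) \<bullet> b \<le> (\<chi> i. 1/?n) \<bullet> b" if "b \<in> Basis" for b :: "real^'n"
        unfolding i[OF that] by simp
      show "ennreal (\<Prod>b\<in>(Basis :: (real^'n) set). ((\<chi> i. 1/?n) - (\<chi> i. -1/?n)) \<bullet> b)
        = ennreal (\<Prod>b\<in>(Basis :: (real^'n) set). 2/?n)"
      proof (rule arg_cong[of _ _ ennreal], rule prod.cong, rule refl)
        fix b :: "real^'n" assume "b \<in> Basis"
        then show "((\<chi> i. 1/?n) - (\<chi> i. -1/?n)) \<bullet> b = 2/?n"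
          unfolding inner_diff_left i[OF \<open>b \<in> Basis\<close>] by (simp add: diff_divide_distrib[symmetric])
      qed
    qed
    then have "emeasure lborel (box (\<chi> i. -1/?n) ((\<chi> i. 1/?n) :: real^'n)) \<noteq> 0" by simp
    ultimately show False by contradiction
  qed
  moreover have "J \<ge> 0" unfolding J_def by (rule integral_nonneg_AE) (simp add: b(2) b1_def)
  ultimately have J: "J > 0" by simp
  have "mollifier (\<lambda>x. b1 x / J)"
    unfolding mollifier_def
  proof (intro conjI allI)
    have "(\<lambda>x. (1/J) * complex_of_real (b1 x)) \<in> test_fns_in (cball 0 1)"
      using t1 smooth_cmult[OF open_UNIV, of "\<lambda>x. complex_of_real (b1 x)" "1/J"] by (auto simp: test_fns_in_def)
    then show "(\<lambda>x. complex_of_real (b1 x / J)) \<in> test_fns_in (cball 0 1)" by simp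
  qed (use J b(2) in \<open>auto simp: b1_def[symmetric] J_def[symmetric], simp add: b1_def\<close>)
  then show ?thesis by blast
qed

context
  fixes \<rho> :: "real^'n::finite \<Rightarrow> real"
  assumes \<rho>: "mollifier \<rho>"
begin

lemma moll_test:
  assumes "\<delta> > 0"
  shows "moll \<rho> \<delta> \<in> test_fns_in (cball 0 \<delta>)"
proof -
  have "(\<lambda>x. complex_of_real (\<rho> (0 + (1/\<delta>) *\<^sub>R x))) \<in> test_fns_in (cball 0 \<delta>)"
    by (rule test_fns_in_affine[of "\<lambda>x. complex_of_real (\<rho> x)" "cball 0 1"]) (use \<rho> assms in \<open>auto simp: mollifier_def\<close>)
  then show ?thesis unfolding moll_def[abs_def]
    by (auto simp: test_fns_in_def intro: smooth_cmult)
qed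

text \<open>Every derivative costs one factor 1/\<delta> on top of the normalisation; as \<delta>
  \<le> 1, one power covers all orders up to \<open>N\<close>.\<close>

lemma moll_deriv_bound:
  "\<exists>C\<ge>0. \<forall>is \<delta> x. length is \<le> N \<longrightarrow> 0 < \<delta> \<longrightarrow> \<delta> \<le> 1 \<longrightarrow> norm (iter_deriv is (moll \<rho> \<delta>) x) \<le> C * (1/\<delta>) ^ (CARD('n) + N)"
proof -
  let ?r = "\<lambda>x. complex_of_real (\<rho> x)"
  have r: "?r \<in> test_fns_in (cball 0 1)" using \<rho> by (simp add: mollifier_def)
  have "\<forall>is. \<exists>B\<ge>0. \<forall>x. norm (iter_deriv is ?r x) \<le> B" using test_bounded_deriv[OF _ r] by simp
  then obtain B where B: "\<And>is. B is \<ge> 0" "\<And>is x. norm (iter_deriv is ?r x) \<le> B is" by metis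
  define C where "C = sum B {is. set is \<subseteq> UNIV \<and> length is \<le> N}"
  have BC: "B is \<le> C" if "length is \<le> N" for "is"
    unfolding C_def by (rule member_le_sum) (use that B(1) finite_lists_length_le[of "UNIV :: 'n set"] in auto)
  have "C \<ge> 0" unfolding C_def using B(1) by (intro sum_nonneg) auto
  moreover have "norm (iter_deriv is (moll \<rho> \<delta>) x) \<le> C * (1/\<delta>) ^ (CARD('n) + N)"
    if len: "length is \<le> N" and \<delta>: "0 < \<delta>" "\<delta> \<le> 1" for "is" \<delta> x
  proof -
    have s: "?r \<in> smooth_fns UNIV" using r by (simp add: test_fns_in_def)
    have "iter_deriv is (moll \<rho> \<delta>) x = of_real ((1/\<delta>) ^ CARD('n)) * (of_real (1/\<delta>) ^ length is * iter_deriv is ?r (0 + (1/\<delta>) *\<^sub>R x))"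
      unfolding moll_def[abs_def]
      by (simp only: iter_deriv_cmult[OF open_UNIV smooth_affine(1)[OF s] UNIV_I] smooth_affine(2)[OF s])
    also have "norm \<dots> = (1/\<delta>) ^ (CARD('n) + length is) * norm (iter_deriv is ?r (0 + (1/\<delta>) *\<^sub>R x))"
      using \<delta> by (simp add: norm_mult norm_power power_add norm_divide)
    also have "\<dots> \<le> (1/\<delta>) ^ (CARD('n) + N) * C"
      using \<delta> len B(2)[of "is" "0 + (1/\<delta>) *\<^sub>R x"] BC[OF len]
      by (intro mult_mono power_increasing) auto
    finally show ?thesis by (simp add: mult.commute)
  qed
  ultimately show ?thesis by blast
qed

lemma moll_integral:
  assumes "\<delta> > 0"
  shows "integrable lborel (\<lambda>y. moll \<rho> \<delta> (x - y))" "(LINT y|lborel. moll \<rho> \<delta> (x - y)) = 1"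
    "(LINT y|lborel. norm (moll \<rho> \<delta> (x - y))) = 1"
proof -
  have r: "(\<lambda>x. complex_of_real (\<rho> x)) \<in> test_fns_in (cball 0 1)" and pos: "\<And>x. \<rho> x \<ge> 0"
    and one: "(LINT x|lborel. \<rho> x) = 1" using \<rho> by (auto simp: mollifier_def)
  have m: "moll \<rho> \<delta> \<in> borel_measurable borel" using test_measurable[OF moll_test[OF assms]] .
  have "(\<lambda>y. moll \<rho> \<delta> (x + (-1) *\<^sub>R y)) \<in> test_fns_in (cball x \<delta>)"
    by (rule test_fns_in_affine[OF moll_test[OF assms]]) (auto simp: dist_norm norm_minus_commute)
  then show i: "integrable lborel (\<lambda>y. moll \<rho> \<delta> (x - y))"
    using test_integrable[of "cball x \<delta>"] by simp
  have "(LINT y|lborel. moll \<rho> \<delta> y) = \<bar>-1\<bar> ^ DIM(real^'n) *\<^sub>R (LINT y|lborel. moll \<rho> \<delta> (x + (-1) *\<^sub>R y))"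
    by (rule lborel_integral_affine[OF m]) simp
  then have "(LINT y|lborel. moll \<rho> \<delta> (x - y)) = (LINT y|lborel. moll \<rho> \<delta> y)" by simp
  also have "\<dots> = \<bar>\<delta>\<bar> ^ DIM(real^'n) *\<^sub>R (LINT y|lborel. moll \<rho> \<delta> (0 + \<delta> *\<^sub>R y))"
    by (rule lborel_integral_affine[OF m]) (use assms in simp)
  also have "(\<lambda>y. moll \<rho> \<delta> (0 + \<delta> *\<^sub>R y)) = (\<lambda>y. of_real ((1/\<delta>) ^ CARD('n)) * complex_of_real (\<rho> y))"
    unfolding moll_def using assms by simp
  also have "(LINT y|lborel. of_real ((1/\<delta>) ^ CARD('n)) * complex_of_real (\<rho> y)) = of_real ((1/\<delta>) ^ CARD('n))"
    unfolding integral_mult_right_zero integral_complex_of_real one by simp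
  finally show l: "(LINT y|lborel. moll \<rho> \<delta> (x - y)) = 1"
    using assms by (simp add: scaleR_conv_of_real power_divide)
  have "moll \<rho> \<delta> y = complex_of_real (norm (moll \<rho> \<delta> y))" for y
    using pos[of "0 + (1/\<delta>) *\<^sub>R y"] assms by (simp add: moll_def norm_mult norm_divide norm_power)
  then have "(LINT y|lborel. moll \<rho> \<delta> (x - y)) = (LINT y|lborel. complex_of_real (norm (moll \<rho> \<delta> (x - y))))"
    by presburger
  then show "(LINT y|lborel. norm (moll \<rho> \<delta> (x - y))) = 1"
    using l unfolding integral_complex_of_real by (metis of_real_1 of_real_eq_iff)
qed

lemma conv_moll_integrable:
  assumes "\<delta> > 0" "continuous_on (cball x \<delta>) f"
  shows "integrable lborel (\<lambda>y. f y * moll \<rho> \<delta> (x - y))"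
proof (rule integrable_compact_support[of "cball x \<delta>"])
  note t = moll_test[OF assms(1)]
  show "continuous_on (cball x \<delta>) (\<lambda>y. f y * moll \<rho> \<delta> (x - y))"
    by (intro continuous_on_mult assms(2) continuous_on_compose2[OF test_continuous[OF t]] continuous_intros) auto
  show "f y * moll \<rho> \<delta> (x - y) = 0" if "y \<notin> cball x \<delta>" for y
    using t that by (simp add: test_fns_in_def dist_norm)
qed simp

lemma moll_weighted_bound:
  assumes \<delta>: "\<delta> > 0" and f: "continuous_on (cball x \<delta>) f" and M: "\<And>y. y \<in> cball x \<delta> \<Longrightarrow> norm (f y) \<le> M"
  shows "norm (conv f (moll \<rho> \<delta>) x) \<le> M"
proof -
  note t = moll_test[OF \<delta>]
  have "norm (conv f (moll \<rho> \<delta>) x) \<le> (LINT y|lborel. M * norm (moll \<rho> \<delta> (x - y)))"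
    unfolding conv_def
  proof (rule Bochner_Integration.integral_norm_bound_integral[OF conv_moll_integrable[OF \<delta> f]])
    show "integrable lborel (\<lambda>y. M * norm (moll \<rho> \<delta> (x - y)))"
      by (intro integrable_mult_right integrable_norm moll_integral(1)[OF \<delta>])
    fix y
    show "norm (f y * moll \<rho> \<delta> (x - y)) \<le> M * norm (moll \<rho> \<delta> (x - y))"
    proof (cases "y \<in> cball x \<delta>")
      case True
      then show ?thesis unfolding norm_mult by (intro mult_right_mono M) auto
    next
      case False
      then show ?thesis using t by (simp add: test_fns_in_def dist_norm)
    qed
  qed
  then show ?thesis using moll_integral(3)[OF \<delta>] by simp
qed

lemma moll_approx:
  assumes \<delta>: "\<delta> > 0" and f: "continuous_on (cball x \<delta>) f"
    and M: "\<And>y. y \<in> cball x \<delta> \<Longrightarrow> norm (f x - f y) \<le> M"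
  shows "norm (f x - conv f (moll \<rho> \<delta>) x) \<le> M"
proof -
  have "conv (\<lambda>y. f x - f y) (moll \<rho> \<delta>) x = f x - conv f (moll \<rho> \<delta>) x"
    unfolding conv_def left_diff_distrib
    using conv_moll_integrable[OF \<delta> f] moll_integral[OF \<delta>, of x] by simp
  moreover have "norm (conv (\<lambda>y. f x - f y) (moll \<rho> \<delta>) x) \<le> M"
    by (rule moll_weighted_bound[OF \<delta> continuous_on_diff[OF continuous_on_const f] M])
  ultimately show ?thesis by simp
qed

section \<open>Solutions that are small on a convex set\<close>

context
  fixes P :: "'n cpoly" and K :: "(real^'n) set" and R :: real and r :: nat
begin

text \<open>Decay and growth rates are kept apart because \<open>t\<close> will be of size log
  (1/\<epsilon>): on \<open>K\<close> the decay has to beat the power of 1/\<delta>, while elsewhere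
  the growth only has to remain a power of 1/\<epsilon>.\<close>

definition good_sol where
  "good_sol C N \<kappa> Q \<delta> t G B v \<longleftrightarrow> v \<in> smooth_fns UNIV \<and> (\<forall>x. diff_op P v x = conv G (moll \<rho> \<delta>) x) \<and>
     (\<forall>is x. length is \<le> r \<and> x \<in> K \<longrightarrow> norm (iter_deriv is v x) \<le> C * (1/\<delta>) ^ N * exp (- \<kappa> * t) * B) \<and>
     (\<forall>is x. length is \<le> r \<and> norm x \<le> R \<longrightarrow> norm (iter_deriv is v x) \<le> C * (1/\<delta>) ^ N * exp (Q * t) * B)"

text \<open>Sources supported in \<open>A\<close> admit solutions that are exponentially small in the parameter \<open>t\<close> on \<open>K\<close>.
  Mollified bounded functions, rather than smooth sources, allow a source to be split by indicator
  functions instead of a partition of unity.\<close>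

definition solvable_off :: "(real^'n) set \<Rightarrow> bool" where
  "solvable_off A \<longleftrightarrow> (\<exists>C N \<kappa> Q \<delta>1. C \<ge> 0 \<and> \<kappa> > 0 \<and> Q \<ge> 0 \<and> \<delta>1 > 0 \<and> \<delta>1 \<le> 1 \<and>
    (\<forall>\<delta> t G B. 0 < \<delta> \<and> \<delta> < \<delta>1 \<and> t \<ge> 0 \<and> bounded_supp B A G \<longrightarrow> (\<exists>v. good_sol C N \<kappa> Q \<delta> t G B v)))"

lemma solvable_offI:
  assumes "C \<ge> 0" "\<kappa> > 0" "Q \<ge> 0" "\<delta>1 > 0" "\<delta>1 \<le> 1"
    "\<And>\<delta> t G B. 0 < \<delta> \<Longrightarrow> \<delta> < \<delta>1 \<Longrightarrow> t \<ge> 0 \<Longrightarrow> bounded_supp B A G \<Longrightarrow> \<exists>v. good_sol C N \<kappa> Q \<delta> t G B v"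
  shows "solvable_off A"
  unfolding solvable_off_def using assms by blast

lemma solvable_off_subset:
  assumes "solvable_off A" "A' \<subseteq> A" "bounded A"
  shows "solvable_off A'"
proof -
  have *: "bounded_supp B A G" if "bounded_supp B A' G" for B and G :: "real^'n \<Rightarrow> complex"
    using that assms(2,3) by (auto simp: bounded_supp_def)
  from assms(1) obtain C N \<kappa> Q \<delta>1 where 1: "C \<ge> 0" "\<kappa> > 0" "Q \<ge> 0" "\<delta>1 > 0" "\<delta>1 \<le> 1"
    and 2: "\<forall>\<delta> t G B. 0 < \<delta> \<and> \<delta> < \<delta>1 \<and> t \<ge> 0 \<and> bounded_supp B A G \<longrightarrow> (\<exists>v. good_sol C N \<kappa> Q \<delta> t G B v)"
    unfolding solvable_off_def by blast
  show ?thesis by (rule solvable_offI[OF 1]) (use 2 * in blast)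
qed

lemma solvable_off_empty: "solvable_off {}"
proof (rule solvable_offI[of 0 1 0 1 _ 0])
  fix \<delta> t :: real and G :: "real^'n \<Rightarrow> complex" and B
  assume "bounded_supp B {} G"
  then have G: "G x = 0" for x by (simp add: bounded_supp_def)
  show "\<exists>v. good_sol 0 0 1 0 \<delta> t G B v" unfolding good_sol_def
    by (rule exI[of _ "\<lambda>x. 0"]) (auto simp: conv_def G diff_op_lst iter_deriv_const)
qed auto

text \<open>The source is cut along the Borel set \<open>A1\<close>; \<open>conv\<close> is linear
  in it, so the two solutions add up. Since 1/\<delta> \<ge> 1 and t \<ge> 0, the worse exponent and
  the worse rates serve for both.\<close>

lemma solvable_off_Un:
  assumes A1: "solvable_off A1" "A1 \<in> sets borel" "bounded A1" and A2: "solvable_off A2" "bounded A2"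
  shows "solvable_off (A1 \<union> A2)"
proof -
  from A1(1) obtain C1 N1 \<kappa>1 Q1 d1 where 1: "C1 \<ge> 0" "\<kappa>1 > 0" "Q1 \<ge> 0" "d1 > 0" "d1 \<le> 1"
    "\<forall>\<delta> t G B. 0 < \<delta> \<and> \<delta> < d1 \<and> t \<ge> 0 \<and> bounded_supp B A1 G \<longrightarrow> (\<exists>v. good_sol C1 N1 \<kappa>1 Q1 \<delta> t G B v)"
    unfolding solvable_off_def by blast
  from A2(1) obtain C2 N2 \<kappa>2 Q2 d2 where 2: "C2 \<ge> 0" "\<kappa>2 > 0" "Q2 \<ge> 0" "d2 > 0" "d2 \<le> 1"
    "\<forall>\<delta> t G B. 0 < \<delta> \<and> \<delta> < d2 \<and> t \<ge> 0 \<and> bounded_supp B A2 G \<longrightarrow> (\<exists>v. good_sol C2 N2 \<kappa>2 Q2 \<delta> t G B v)"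
    unfolding solvable_off_def by blast
  define N where "N = max N1 N2"
  define \<kappa> where "\<kappa> = min \<kappa>1 \<kappa>2"
  define Q where "Q = max Q1 Q2"
  define d where "d = min d1 d2"
  show ?thesis
  proof (rule solvable_offI[of "C1 + C2" \<kappa> Q d _ N])
    fix \<delta> t :: real and G :: "real^'n \<Rightarrow> complex" and B
    assume \<delta>: "0 < \<delta>" "\<delta> < d" and t: "t \<ge> 0" and G: "bounded_supp B (A1 \<union> A2) G"
    have "0 \<le> norm (G 0)" by simp
    also have "\<dots> \<le> B" using G by (simp add: bounded_supp_def)
    finally have B: "B \<ge> 0" .
    define G1 where "G1 x = indicator A1 x *\<^sub>R G x" for x
    define G2 where "G2 x = indicator (- A1) x *\<^sub>R G x" for x
    have Gm [measurable]: "G \<in> borel_measurable borel" using G by (simp add: bounded_supp_def)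
    note [measurable] = A1(2)
    have G1: "bounded_supp B A1 G1" unfolding bounded_supp_def G1_def[abs_def]
      using G A1(3) B by (auto simp: bounded_supp_def indicator_def)
    have G2: "bounded_supp B A2 G2" unfolding bounded_supp_def G2_def[abs_def]
      using G A2(2) B by (auto simp: bounded_supp_def indicator_def)
    from \<delta>(2) have "\<delta> < d1" by (simp add: d_def)
    obtain v1 where v1: "v1 \<in> smooth_fns UNIV" "\<And>x. diff_op P v1 x = conv G1 (moll \<rho> \<delta>) x"
      "\<And>is x. length is \<le> r \<Longrightarrow> x \<in> K \<Longrightarrow> norm (iter_deriv is v1 x) \<le> C1 * (1/\<delta>) ^ N1 * exp (- \<kappa>1 * t) * B"
      "\<And>is x. length is \<le> r \<Longrightarrow> norm x \<le> R \<Longrightarrow> norm (iter_deriv is v1 x) \<le> C1 * (1/\<delta>) ^ N1 * exp (Q1 * t) * B"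
      using 1(6)[rule_format, OF conjI[OF \<delta>(1) conjI[OF \<open>\<delta> < d1\<close> conjI[OF t G1]]]]
      unfolding good_sol_def by blast
    from \<delta>(2) have "\<delta> < d2" by (simp add: d_def)
    obtain v2 where v2: "v2 \<in> smooth_fns UNIV" "\<And>x. diff_op P v2 x = conv G2 (moll \<rho> \<delta>) x"
      "\<And>is x. length is \<le> r \<Longrightarrow> x \<in> K \<Longrightarrow> norm (iter_deriv is v2 x) \<le> C2 * (1/\<delta>) ^ N2 * exp (- \<kappa>2 * t) * B"
      "\<And>is x. length is \<le> r \<Longrightarrow> norm x \<le> R \<Longrightarrow> norm (iter_deriv is v2 x) \<le> C2 * (1/\<delta>) ^ N2 * exp (Q2 * t) * B"
      using 2(6)[rule_format, OF conjI[OF \<delta>(1) conjI[OF \<open>\<delta> < d2\<close> conjI[OF t G2]]]]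
      unfolding good_sol_def by blast
    define v where "v x = v1 x + v2 x" for x
    have it: "iter_deriv is v x = iter_deriv is v1 x + iter_deriv is v2 x" for "is" x
      unfolding v_def[abs_def] by (rule iter_deriv_add[OF _ v1(1) v2(1)]) auto
    have inv: "1/\<delta> \<ge> 1" using \<delta> 1(5) by (simp add: d_def)
    have mono: "Ci * (1/\<delta>) ^ Ni * X * B \<le> Ci * (1/\<delta>) ^ N * Y * B" if "Ci \<ge> 0" "Ni \<le> N" "0 \<le> X" "X \<le> Y" for Ci Ni X Y
      using that B inv \<delta>(1) by (intro mult_right_mono mult_mono mult_left_mono power_increasing) auto
    have intg: "integrable lborel (\<lambda>y. H y * moll \<rho> \<delta> (x - y))" if H: "bounded_supp B A H" for H A x
    proof -
      obtain R' where R': "bounded_supp B (cball 0 R') H" using bounded_supp_ball[OF H] by blast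
      obtain D where "\<And>y. norm (moll \<rho> \<delta> y) \<le> D" using test_bounded[OF _ moll_test[OF \<delta>(1)]] by auto
      then show ?thesis
        using test_measurable[OF moll_test[OF \<delta>(1)]]
        by (intro bounded_supp_integrable_bound(1)[OF R']) auto
    qed
    show "\<exists>v. good_sol (C1 + C2) N \<kappa> Q \<delta> t G B v" unfolding good_sol_def
    proof (intro exI[of _ v] conjI allI impI; (elim conjE)?)
      show "v \<in> smooth_fns UNIV" unfolding v_def[abs_def] by (rule smooth_add[OF _ v1(1) v2(1)]) simp
      fix x
      have "diff_op P v x = diff_op P v1 x + diff_op P v2 x"
        by (simp add: diff_op_lst it distrib_left sum.distrib)
      also have "\<dots> = conv (\<lambda>y. G1 y + G2 y) (moll \<rho> \<delta>) x"
        unfolding v1(2) v2(2) conv_def distrib_right using intg[OF G1] intg[OF G2] by simp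
      also have "(\<lambda>y. G1 y + G2 y) = G" by (auto simp: G1_def G2_def indicator_def)
      finally show "diff_op P v x = conv G (moll \<rho> \<delta>) x" .
    next
      fix "is" :: "'n list" and x assume len: "length is \<le> r" and x: "x \<in> K"
      have "norm (iter_deriv is v x) \<le> norm (iter_deriv is v1 x) + norm (iter_deriv is v2 x)"
        unfolding it by (rule norm_triangle_ineq)
      also have "\<dots> \<le> C1 * (1/\<delta>) ^ N * exp (- \<kappa> * t) * B + C2 * (1/\<delta>) ^ N * exp (- \<kappa> * t) * B"
        using 1(1) 2(1) t
        by (intro add_mono order_trans[OF v1(3)[OF len x]] order_trans[OF v2(3)[OF len x]] mono)
          (auto simp: N_def \<kappa>_def intro!: mult_right_mono)
      finally show "norm (iter_deriv is v x) \<le> (C1 + C2) * (1/\<delta>) ^ N * exp (- \<kappa> * t) * B"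
        by (simp add: algebra_simps)
    next
      fix "is" :: "'n list" and x :: "real^'n" assume len: "length is \<le> r" and x: "norm x \<le> R"
      have "norm (iter_deriv is v x) \<le> norm (iter_deriv is v1 x) + norm (iter_deriv is v2 x)"
        unfolding it by (rule norm_triangle_ineq)
      also have "\<dots> \<le> C1 * (1/\<delta>) ^ N * exp (Q * t) * B + C2 * (1/\<delta>) ^ N * exp (Q * t) * B"
        using 1(1) 2(1) t
        by (intro add_mono order_trans[OF v1(4)[OF len x]] order_trans[OF v2(4)[OF len x]] mono)
          (auto simp: N_def Q_def intro!: mult_right_mono)
      finally show "norm (iter_deriv is v x) \<le> (C1 + C2) * (1/\<delta>) ^ N * exp (Q * t) * B"
        by (simp add: algebra_simps)
    qed
  qed (use 1(1-5) 2(1-5) in \<open>auto simp: \<kappa>_def Q_def d_def\<close>)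
qed

text \<open>\<open>K\<close> and \<open>A\<close> lie on opposite sides of a slab given by a gap of
  2 \<kappa> in u \<bullet> x. Mollifying uses up at most half of it, so with \<tau> = t u the
  weight is still at most exp (- \<kappa> t) between the mollified source and
  \<open>K\<close>.\<close>

lemma solvable_off_halfspace:
  fixes u :: "real^'n"
  assumes P: "P \<noteq> 0" and K: "K \<subseteq> cball 0 R" "\<And>x. x \<in> K \<Longrightarrow> u \<bullet> x \<le> b" and "\<kappa> > 0" and "R \<ge> 0"
    and A: "A \<subseteq> cball 0 R" "\<And>y. y \<in> A \<Longrightarrow> u \<bullet> y \<ge> b + 2 * \<kappa>"
  shows "solvable_off A"
proof -
  let ?n = "CARD('n)"
  \<comment> \<open>Room for the mollified source: half of the gap is given away, and the radius
    grows by 1 \<ge> \<delta>.\<close>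
  define S where "S = {y. u \<bullet> y \<ge> b + \<kappa>} \<inter> cball 0 (R + 1)"
  have S: "compact S"
    unfolding S_def by (rule closed_Int_compact[OF closed_halfspace_ge compact_cball])
  have S': "S \<subseteq> cball 0 (R + 1)"
    unfolding S_def by (rule Int_lower2)
  obtain A0 where A0: "A0 \<ge> 0" "\<And>(\<tau>::real^'n) g. g \<in> test_fns_in S \<Longrightarrow> \<exists>v. weighted_sol P S (R + 1) \<tau> g A0 v"
    using diff_op_solve[OF P, of "R + 1"] S S' by meson
  define N where "N = r + 2 * ?n"
  obtain D where D: "D \<ge> 0" "\<And>is \<delta> x. length is \<le> N \<Longrightarrow> 0 < \<delta> \<Longrightarrow> \<delta> \<le> 1 \<Longrightarrow>
      norm (iter_deriv is (moll \<rho> \<delta>) x) \<le> D * (1/\<delta>) ^ (?n + N)"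
    using moll_deriv_bound[of N] by blast
  define vol where "vol = measure lborel (cball (0::real^'n) R)"
  define C where "C = A0 * D * vol"
  \<comment> \<open>Bounds u \<bullet> (x - y) for |x| \<le> R and |y| \<le> R + 1.\<close>
  define Q where "Q = norm u * (2 * R + 1)"
  \<comment> \<open>Makes |u| \<delta> \<le> \<kappa>, also when \<open>u\<close> is 0.\<close>
  define d where "d = min 1 (\<kappa> / (norm u + 1))"
  show ?thesis
  proof (rule solvable_offI[of C \<kappa> Q d _ "?n + N"])
    show "C \<ge> 0" using A0(1) D(1) by (simp add: C_def vol_def)
    show "Q \<ge> 0" "d > 0" "d \<le> 1" using \<open>R \<ge> 0\<close> \<open>\<kappa> > 0\<close> by (auto simp: Q_def d_def add_nonneg_pos)
    fix \<delta> t :: real and G :: "real^'n \<Rightarrow> complex" and B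
    assume \<delta>: "0 < \<delta>" "\<delta> < d" and t: "t \<ge> 0" and G: "bounded_supp B A G"
    note mt = moll_test[OF \<delta>(1)]
    have \<delta>1: "\<delta> \<le> 1" using \<delta> by (simp add: d_def)
    have "\<delta> * (norm u + 1) < \<kappa>" using \<delta> by (simp add: d_def pos_less_divide_eq add_nonneg_pos)
    then have u\<delta>: "norm u * \<delta> \<le> \<kappa>" using \<delta>(1) by (simp add: algebra_simps)
    have GR: "bounded_supp B (cball 0 R) G" using G A(1) by (auto simp: bounded_supp_def)
    define g where "g = conv G (moll \<rho> \<delta>)"
    have g: "g \<in> test_fns_in S"
      unfolding test_fns_in_def
    proof (intro CollectI conjI allI impI)
      show "g \<in> smooth_fns UNIV" unfolding g_def by (rule conv_smooth[OF G _ mt]) simp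
      fix x assume x: "x \<notin> S"
      show "g x = 0" unfolding g_def
      proof (rule conv_eq_0[of A _ \<delta>])
        show "G y = 0" if "y \<notin> A" for y using G that by (simp add: bounded_supp_def)
        show "moll \<rho> \<delta> y = 0" if "y \<notin> cball 0 \<delta>" for y using mt that by (simp add: test_fns_in_def)
        fix a assume a: "a \<in> A"
        show "norm (x - a) > \<delta>"
        proof (rule ccontr)
          assume "\<not> norm (x - a) > \<delta>"
          then have n: "norm (x - a) \<le> \<delta>" by simp
          have "norm x \<le> norm a + norm (x - a)" by (rule norm_triangle_sub)
          then have "norm x \<le> R + 1" using n a A(1) \<delta>1 by force
          moreover have "\<bar>u \<bullet> (x - a)\<bar> \<le> norm u * norm (x - a)" by (rule Cauchy_Schwarz_ineq2)
          then have "\<bar>u \<bullet> (x - a)\<bar> \<le> norm u * \<delta>" using n by (meson mult_left_mono norm_ge_zero order_trans)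
          then have "u \<bullet> x \<ge> b + \<kappa>" using u\<delta> A(2)[OF a] by (simp add: inner_diff_right)
          ultimately show False using x by (simp add: S_def)
        qed
      qed
    qed
    obtain v where v: "v \<in> smooth_fns UNIV" "\<And>x. diff_op P v x = g x"
      "\<And>is x E B. norm x \<le> R + 1 \<Longrightarrow> E \<ge> 0 \<Longrightarrow> (\<forall>y\<in>S. exp ((t *\<^sub>R u) \<bullet> (x - y)) \<le> E) \<Longrightarrow>
        (\<forall>js y. length js \<le> length is + 2 * ?n \<longrightarrow> norm (iter_deriv js g y) \<le> B) \<Longrightarrow>
        norm (iter_deriv is v x) \<le> A0 * E * B"
      using A0(2)[OF g, of "t *\<^sub>R u"] unfolding weighted_sol_def by blast
    have gb: "norm (iter_deriv js g y) \<le> B * (D * (1/\<delta>) ^ (?n + N)) * vol" if "length js \<le> N" for js y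
      unfolding g_def iter_deriv_conv[OF G compact_cball mt] vol_def
      by (rule norm_conv_le[OF GR])
        (use D(2)[OF that \<delta>(1) \<delta>1] test_measurable[OF test_fns_in_iter_deriv[OF closed_cball mt]] in auto)
    have bnd: "norm (iter_deriv is v x) \<le> C * (1/\<delta>) ^ (?n + N) * E * B"
      if "length is \<le> r" "norm x \<le> R + 1" "E \<ge> 0" "\<forall>y\<in>S. exp ((t *\<^sub>R u) \<bullet> (x - y)) \<le> E" for "is" x E
    proof -
      have "norm (iter_deriv is v x) \<le> A0 * E * (B * (D * (1/\<delta>) ^ (?n + N)) * vol)"
        by (rule v(3)[OF that(2-4)]) (use gb that(1) in \<open>auto simp: N_def\<close>)
      then show ?thesis by (simp add: C_def mult_ac)
    qed
    show "\<exists>v. good_sol C (?n + N) \<kappa> Q \<delta> t G B v" unfolding good_sol_def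
    proof (intro exI[of _ v] conjI allI impI; (elim conjE)?)
      show "v \<in> smooth_fns UNIV" by (rule v(1))
      show "diff_op P v x = conv G (moll \<rho> \<delta>) x" for x by (simp add: v(2) g_def)
      show "norm (iter_deriv is v x) \<le> C * (1/\<delta>) ^ (?n + N) * exp (- \<kappa> * t) * B"
        if "length is \<le> r" "x \<in> K" for "is" x
      proof (rule bnd[OF that(1)])
        show "norm x \<le> R + 1" using K(1) that(2) by force
        show "\<forall>y\<in>S. exp ((t *\<^sub>R u) \<bullet> (x - y)) \<le> exp (- \<kappa> * t)"
        proof
          fix y assume "y \<in> S"
          then have "u \<bullet> (x - y) \<le> - \<kappa>" using K(2)[OF that(2)] by (simp add: S_def inner_diff_right)
          from mult_left_mono[OF this t] show "exp ((t *\<^sub>R u) \<bullet> (x - y)) \<le> exp (- \<kappa> * t)"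
            by (simp add: mult.commute)
        qed
      qed simp
      show "norm (iter_deriv is v x) \<le> C * (1/\<delta>) ^ (?n + N) * exp (Q * t) * B"
        if "length is \<le> r" "norm x \<le> R" for "is" x
      proof (rule bnd[OF that(1)])
        show "norm x \<le> R + 1" using that(2) by simp
        show "\<forall>y\<in>S. exp ((t *\<^sub>R u) \<bullet> (x - y)) \<le> exp (Q * t)"
        proof
          fix y assume "y \<in> S"
          then have "norm y \<le> R + 1" by (simp add: S_def)
          then have "norm (x - y) \<le> 2 * R + 1" using that(2) norm_triangle_ineq4[of x y] by linarith
          have "u \<bullet> (x - y) \<le> norm u * norm (x - y)" by (rule norm_cauchy_schwarz)
          also have "\<dots> \<le> Q" unfolding Q_def by (rule mult_left_mono) (fact, simp)
          finally have "u \<bullet> (x - y) \<le> Q" .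
          from mult_left_mono[OF this t] show "exp ((t *\<^sub>R u) \<bullet> (x - y)) \<le> exp (Q * t)"
            by (simp add: mult.commute)
        qed
      qed simp
    qed
  qed fact
qed

lemma solvable_off_compact:
  assumes P: "P \<noteq> 0" and K: "compact K" "convex K" "K \<subseteq> cball 0 R" and "R \<ge> 0"
    and A: "compact A" "A \<subseteq> cball 0 R" "A \<inter> K = {}"
  shows "solvable_off A"
proof -
  have "\<exists>U. open U \<and> y \<in> U \<and> solvable_off (cball 0 R \<inter> U)" if y: "y \<in> A" for y
  proof -
    obtain a c where ac: "a \<bullet> y < c" "\<And>x. x \<in> K \<Longrightarrow> a \<bullet> x > c"
      using separating_hyperplane_closed_point[OF K(2) compact_imp_closed[OF K(1)], of y] A(3) y by blast
    \<comment> \<open>With \<open>u = - a\<close> and \<open>b = - c\<close> the half-space lemma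
      asks for a gap of 2 \<kappa>. This is half of the available c - a \<bullet> y, so
      \<open>y\<close> satisfies it strictly and has an open neighbourhood that does.\<close>
    define \<kappa> where "\<kappa> = (c - a \<bullet> y) / 4"
    have "\<kappa> > 0" using ac(1) by (simp add: \<kappa>_def)
    let ?U = "{z. (- a) \<bullet> z > - c + 2 * \<kappa>}"
    have "open ?U" by (rule open_halfspace_gt)
    moreover have "y \<in> ?U" using ac(1) by (simp add: \<kappa>_def field_simps)
    moreover have "solvable_off (cball 0 R \<inter> ?U)"
      by (rule solvable_off_halfspace[OF P K(3) _ \<open>\<kappa> > 0\<close> \<open>R \<ge> 0\<close>, of "-a" "-c"])
        (use ac(2) in \<open>auto simp: less_imp_le\<close>)
    ultimately show ?thesis by blast
  qed
  then obtain U where U: "\<And>y. y \<in> A \<Longrightarrow> open (U y)" "\<And>y. y \<in> A \<Longrightarrow> y \<in> U y"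
    "\<And>y. y \<in> A \<Longrightarrow> solvable_off (cball 0 R \<inter> U y)" by metis
  obtain F where F: "F \<subseteq> A" "finite F" "A \<subseteq> (\<Union>y\<in>F. U y)"
    using compactE_image[OF A(1), of A U] U(1,2) by blast
  have "solvable_off (cball 0 R \<inter> (\<Union>y\<in>F. U y))"
    using F(2,1)
  proof (induction F rule: finite_induct)
    case empty
    then show ?case using solvable_off_empty by simp
  next
    case (insert y F)
    have "solvable_off ((cball 0 R \<inter> U y) \<union> (cball 0 R \<inter> (\<Union>y\<in>F. U y)))"
      using insert U(1,3) by (intro solvable_off_Un) (auto intro: bounded_subset)
    then show ?case by (simp add: Int_Un_distrib)
  qed
  then show ?thesis by (rule solvable_off_subset) (use F(3) A(2) in \<open>auto intro: bounded_subset\<close>)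
qed

end

end

section \<open>Seminorms\<close>

lemma ex_multi_index: "\<exists>\<alpha>. count_list is = Poly_Mapping.lookup \<alpha>" for "is" :: "'n::finite list"
  by (rule exI[of _ "Abs_poly_mapping (count_list is)"]) (simp add: lookup_Abs_poly_mapping)

lemma Cr_norm_le:
  assumes "\<And>is x. length is \<le> r \<Longrightarrow> x \<in> K \<Longrightarrow> norm (iter_deriv is f x) \<le> B" "B \<ge> 0"
  shows "Cr_norm K r f \<le> B"
  unfolding Cr_norm_def
  by (rule cSup_least) (use assms in \<open>auto simp: mderiv_lst length_lst\<close>)

context
  fixes f :: "real^'n::finite \<Rightarrow> complex" and Y L :: "(real^'n) set"
  assumes f: "f \<in> smooth_fns Y" and Y: "open Y" and L: "compact L" "L \<subseteq> Y"
begin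

text \<open>A real \<open>Sup\<close> is informative only for bounded sets. Continuity on compact
  \<open>L\<close> bounds each derivative, and only finitely many lists have length at most
  \<open>r\<close>.\<close>

lemma Cr_norm_bdd: "bdd_above (insert 0 {norm (mderiv \<alpha> f x) | \<alpha> x. x \<in> L \<and> mdeg \<alpha> \<le> r})"
proof -
  have "bdd_above ((\<lambda>x. norm (iter_deriv is f x)) ` L)" for "is"
  proof -
    have "continuous_on L (\<lambda>x. norm (iter_deriv is f x))"
      by (intro continuous_on_norm continuous_on_subset[OF smooth_continuous_on[OF f] L(2)])
    from compact_continuous_image[OF this L(1)] show ?thesis
      by (intro bounded_imp_bdd_above compact_imp_bounded)
  qed
  then have bdd: "bdd_above (\<Union>is\<in>{is. set is \<subseteq> UNIV \<and> length is \<le> r}. (\<lambda>x. norm (iter_deriv is f x)) ` L)"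
    using finite_lists_length_le[of "UNIV :: 'n set" r] by (subst bdd_above_UN) auto
  have "{norm (mderiv \<alpha> f x) | \<alpha> x. x \<in> L \<and> mdeg \<alpha> \<le> r}
      \<subseteq> (\<Union>is\<in>{is. set is \<subseteq> UNIV \<and> length is \<le> r}. (\<lambda>x. norm (iter_deriv is f x)) ` L)"
    by (force simp: mderiv_lst length_lst)
  from bdd_above_mono[OF bdd this] show ?thesis by (simp only: bdd_above_insert)
qed

text \<open>The seminorm sees one chosen order of differentiation per multi-index; by
  \<open>mderiv_eq\<close> on the open set \<open>Y\<close> every other order gives the same
  value.\<close>

lemma Cr_norm_ge:
  assumes "length is \<le> r" "x \<in> L"
  shows "norm (iter_deriv is f x) \<le> Cr_norm L r f"
proof -
  obtain \<alpha> where \<alpha>: "count_list is = Poly_Mapping.lookup \<alpha>" using ex_multi_index by blast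
  have "mdeg \<alpha> = length is"
    using sum_count_set[of "is" UNIV] by (simp add: mdeg_def \<alpha>)
  moreover have "mderiv \<alpha> f x = iter_deriv is f x"
    using mderiv_eq[OF f Y _ \<alpha>] assms(2) L(2) by blast
  ultimately have "norm (iter_deriv is f x) \<in> {norm (mderiv \<alpha> f x) | \<alpha> x. x \<in> L \<and> mdeg \<alpha> \<le> r}"
    using assms by (intro CollectI exI[of _ \<alpha>] exI[of _ x]) simp
  then show ?thesis
    unfolding Cr_norm_def by (intro cSup_upper Cr_norm_bdd) blast
qed

lemma Cr_norm_nonneg: "0 \<le> Cr_norm L r f"
  unfolding Cr_norm_def by (rule cSup_upper[OF _ Cr_norm_bdd]) simp

lemma Cr_norm_mono: "r \<le> r' \<Longrightarrow> Cr_norm L r f \<le> Cr_norm L r' f"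
  by (rule Cr_norm_le) (auto intro: Cr_norm_ge Cr_norm_nonneg)

end

section \<open>Approximation of zero solutions\<close>

lemma diff_op_diff:
  assumes "open X" "f \<in> smooth_fns X" "g \<in> smooth_fns X" "x \<in> X"
  shows "diff_op P (\<lambda>x. f x - g x) x = diff_op P f x - diff_op P g x"
  unfolding diff_op_lst iter_deriv_diff[OF assms] by (simp add: right_diff_distrib sum_subtractf)

context
  fixes \<rho> :: "real^'n::finite \<Rightarrow> real"
  assumes \<rho>: "mollifier \<rho>"
begin

lemma conv_diff_op:
  fixes P :: "'n cpoly"
  assumes X: "open X" "f \<in> smooth_fns X" and x: "cball x \<delta> \<subseteq> X" and \<delta>: "\<delta> > 0"
  shows "(\<Sum>\<alpha>\<in>Poly_Mapping.keys P. co P \<alpha> * conv (iter_deriv (lst \<alpha>) f) (moll \<rho> \<delta>) x) = conv (diff_op P f) (moll \<rho> \<delta>) x"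
proof -
  have int: "integrable lborel (\<lambda>y. iter_deriv is f y * moll \<rho> \<delta> (x - y))" for "is"
    by (rule conv_moll_integrable[OF \<rho> \<delta> continuous_on_subset[OF smooth_continuous_on[OF X(2)] x]])
  have "conv (diff_op P f) (moll \<rho> \<delta>) x
    = (LINT y|lborel. (\<Sum>\<alpha>\<in>Poly_Mapping.keys P. co P \<alpha> * (iter_deriv (lst \<alpha>) f y * moll \<rho> \<delta> (x - y))))"
    by (simp add: conv_def diff_op_lst sum_distrib_right mult.assoc)
  also have "\<dots> = (\<Sum>\<alpha>\<in>Poly_Mapping.keys P. (LINT y|lborel. co P \<alpha> * (iter_deriv (lst \<alpha>) f y * moll \<rho> \<delta> (x - y))))"
    by (rule Bochner_Integration.integral_sum) (intro integrable_mult_right int)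
  finally show ?thesis by (simp add: conv_def)
qed

text \<open>\<open>F\<close> stands for a cut-off of \<open>f\<close> that may jump. Derivatives go
  to the mollifier, \<open>F\<close> is replaced by \<open>f\<close> on the only ball that counts,
  and then they return to \<open>f\<close>.\<close>

lemma conv_moll_iter_deriv:
  assumes X: "open X" "f \<in> smooth_fns X" and x: "cball x \<delta> \<subseteq> X" and \<delta>: "\<delta> > 0"
    and F: "bounded_supp B A F" "\<And>y. y \<in> cball x \<delta> \<Longrightarrow> F y = f y"
  shows "iter_deriv is (conv F (moll \<rho> \<delta>)) x = conv (iter_deriv is f) (moll \<rho> \<delta>) x"
proof -
  note t = moll_test[OF \<rho> \<delta>]
  have "iter_deriv is (conv F (moll \<rho> \<delta>)) x = conv F (iter_deriv is (moll \<rho> \<delta>)) x"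
    by (rule iter_deriv_conv[OF F(1) _ t]) simp
  also have "\<dots> = conv f (iter_deriv is (moll \<rho> \<delta>)) x"
    by (rule conv_cong[OF _ F(2)]) (use test_fns_in_iter_deriv[OF closed_cball t] in \<open>auto simp: test_fns_in_def\<close>)
  also have "\<dots> = conv (iter_deriv is f) (moll \<rho> \<delta>) x"
    by (rule conv_iter_deriv[OF X x t])
  finally show ?thesis .
qed

text \<open>The mean value inequality on the ball of radius \<delta>. This is where the one
  derivative is lost.\<close>

lemma moll_iter_deriv_approx:
  assumes X: "open X" "f \<in> smooth_fns X" and x: "cball x \<delta> \<subseteq> X" and \<delta>: "\<delta> > 0"
    and B: "\<And>i y. y \<in> cball x \<delta> \<Longrightarrow> norm (iter_deriv (i # is) f y) \<le> B"
  shows "norm (iter_deriv is f x - conv (iter_deriv is f) (moll \<rho> \<delta>) x) \<le> real CARD('n) * B * \<delta>"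
proof (rule moll_approx[OF \<rho> \<delta> continuous_on_subset[OF smooth_continuous_on[OF X(2)] x]])
  fix y assume y: "y \<in> cball x \<delta>"
  have "0 \<le> norm (iter_deriv (undefined # is) f y)" by simp
  also have "\<dots> \<le> B" using B[OF y] .
  finally have "B \<ge> 0" .
  have "norm (iter_deriv is f x - iter_deriv is f y) \<le> real CARD('n) * B * norm (x - y)"
    by (rule differentiable_Lipschitz[of "cball x \<delta>"])
      (use B smooth_differentiable_at[OF X(2,1)] x y \<delta> in auto)
  also have "\<dots> \<le> real CARD('n) * B * \<delta>"
    using y \<open>B \<ge> 0\<close> by (intro mult_left_mono) (auto simp: dist_norm)
  finally show "norm (iter_deriv is f x - iter_deriv is f y) \<le> real CARD('n) * B * \<delta>" .
qed

text \<open>Here \<delta> and \<open>t\<close> are still independent. The error on \<open>K\<close>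
  consists of one term of order \<delta> for each of the two mollifications and the exponentially
  small correction \<open>v\<close>; all other costs are powers of 1/\<delta> times the sup norm of
  \<open>f\<close>.\<close>

lemma runge_parametric:
  fixes P :: "'n cpoly"
  assumes P: "P \<noteq> 0" and K: "compact K" "convex K" and Y: "open Y"
    and L: "compact L" "L \<subseteq> Y" "K \<subseteq> interior L" and M: "compact M"
  shows "\<exists>C2 E \<kappa> Q d N k. C2 \<ge> 0 \<and> E \<ge> 0 \<and> \<kappa> > 0 \<and> Q \<ge> 0 \<and> d > 0 \<and> d \<le> 1 \<and>
    (\<forall>f\<in>zero_sols P Y. \<forall>\<delta> t. 0 < \<delta> \<and> \<delta> < d \<and> t \<ge> 0 \<longrightarrow> (\<exists>h\<in>zero_sols P UNIV.
      Cr_norm K r1 (\<lambda>x. f x - h x) \<le> 2 * real CARD('n) * \<delta> * Cr_norm L (r1 + 1) f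
        + C2 * (1/\<delta>) ^ N * exp (- \<kappa> * t) * Cr_norm L 0 f \<and>
      Cr_norm M r2 h \<le> (E * (1/\<delta>) ^ k + C2 * (1/\<delta>) ^ N * exp (Q * t)) * Cr_norm L 0 f))"
proof -
  let ?n = "CARD('n)"
  obtain e where e: "e > 0" "(\<Union>x\<in>K. ball x e) \<subseteq> interior L"
    using compact_subset_open_imp_ball_epsilon_subset[OF K(1) open_interior L(3)] by blast
  \<comment> \<open>Room for both mollifications: balls of radius at most \<open>e0\<close> about
    \<open>K\<close> stay in \<open>W (3 * e0)\<close>, and balls of radius at most
    \<open>e0\<close> about points of the latter stay in the interior of \<open>L\<close>.\<close>
  define e0 where "e0 = e / 4"
  have "e0 > 0" using e by (simp add: e0_def)
  define W where "W s = (\<Union>x\<in>K. ball x s)" for s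
  have Wopen: "open (W s)" for s unfolding W_def by auto
  have KW: "K \<subseteq> W (3 * e0)" unfolding W_def using \<open>e0 > 0\<close> by force
  have W1: "cball x \<delta> \<subseteq> W (3 * e0)" if "x \<in> K" "\<delta> \<le> e0" for x \<delta>
    using that \<open>e0 > 0\<close> unfolding W_def by force
  have W2: "cball y \<delta> \<subseteq> interior L" if yW: "y \<in> W (3 * e0)" and \<delta>: "\<delta> \<le> e0" for y \<delta>
  proof -
    from yW obtain x where x: "x \<in> K" "dist x y < 3 * e0" by (auto simp: W_def)
    have "cball y \<delta> \<subseteq> ball x e"
    proof
      fix z assume "z \<in> cball y \<delta>"
      then have "dist x z < 4 * e0" using x(2) \<delta> dist_triangle[of x z y] by simp
      then show "z \<in> ball x e" by (simp add: e0_def)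
    qed
    then show ?thesis using e(2) x(1) by blast
  qed
  obtain R0 where R0: "R0 > 0" "\<And>x. x \<in> K \<union> L \<union> M \<Longrightarrow> norm x \<le> R0"
    using K(1) L(1) M compact_imp_bounded bounded_Un bounded_pos by metis
  \<comment> \<open>Mollifying at scale \<delta> \<le> 1 keeps the cut-off of \<open>f\<close>
    supported in this ball.\<close>
  define R where "R = R0 + 1"
  have "R \<ge> 0" using R0(1) by (simp add: R_def)
  have KR: "K \<subseteq> cball 0 R" and LR: "L \<subseteq> cball 0 R0" and MR: "\<And>x. x \<in> M \<Longrightarrow> norm x \<le> R"
    using R0(2) by (force simp: R_def)+
  define r where "r = max r1 r2"
  \<comment> \<open>All that can carry \<open>P(D)u1\<close>: near \<open>K\<close> it vanishes
    because \<open>f\<close> is a solution, outside the ball because \<open>u1\<close> is 0.\<close>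
  define A where "A = cball 0 R - W (3 * e0)"
  have A: "compact A" "A \<subseteq> cball 0 R" "A \<inter> K = {}"
    using compact_diff[OF compact_cball Wopen] KW by (auto simp: A_def)
  obtain C1 N1 \<kappa> Q d1 where 1: "C1 \<ge> 0" "\<kappa> > 0" "Q \<ge> 0" "d1 > 0" "d1 \<le> 1"
    and sol: "\<forall>\<delta> t G B. 0 < \<delta> \<and> \<delta> < d1 \<and> t \<ge> 0 \<and> bounded_supp B A G \<longrightarrow>
      (\<exists>v. good_sol \<rho> P K R r C1 N1 \<kappa> Q \<delta> t G B v)"
    using solvable_off_compact[OF \<rho> P K KR \<open>R \<ge> 0\<close> A, of r] unfolding solvable_off_def[OF \<rho>] by blast
  define m where "m = Max (insert 0 (mdeg ` Poly_Mapping.keys P))"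
  have m: "length (lst \<alpha>) \<le> m" if "\<alpha> \<in> Poly_Mapping.keys P" for \<alpha>
    unfolding m_def length_lst using that by (intro Max_ge) auto
  define S0 where "S0 = (\<Sum>\<alpha>\<in>Poly_Mapping.keys P. norm (co P \<alpha>))"
  have "S0 \<ge> 0" unfolding S0_def by (intro sum_nonneg) auto
  \<comment> \<open>Orders of mollifier derivatives needed: m for \<open>P(D)u1\<close>, r for the
    derivatives of \<open>u2\<close>.\<close>
  define N2 where "N2 = max m r"
  obtain D where D: "D \<ge> 0" "\<forall>is \<delta> x. length is \<le> N2 \<longrightarrow> 0 < \<delta> \<longrightarrow> \<delta> \<le> 1 \<longrightarrow>
      norm (iter_deriv is (moll \<rho> \<delta>) x) \<le> D * (1/\<delta>) ^ (?n + N2)"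
    using moll_deriv_bound[OF \<rho>, of N2] by blast
  define vol where "vol = measure lborel (cball (0::real^'n) R)"
  have "vol \<ge> 0" by (simp add: vol_def)
  define C2 where "C2 = C1 * S0 * D * vol"
  define E where "E = (D * vol)\<^sup>2"
  define d where "d = min d1 e0"
  define N where "N = N1 + (?n + N2)"
  define k where "k = (?n + N2) + (?n + N2)"
  have main: "\<exists>h\<in>zero_sols P UNIV.
      Cr_norm K r1 (\<lambda>x. f x - h x) \<le> 2 * real ?n * \<delta> * Cr_norm L (r1 + 1) f
        + C2 * (1/\<delta>) ^ N * exp (- \<kappa> * t) * Cr_norm L 0 f \<and>
      Cr_norm M r2 h \<le> (E * (1/\<delta>) ^ k + C2 * (1/\<delta>) ^ N * exp (Q * t)) * Cr_norm L 0 f"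
    if f0: "f \<in> zero_sols P Y" and \<delta>: "0 < \<delta>" "\<delta> < d" and t: "t \<ge> 0" for f \<delta> t
  proof -
    have f: "f \<in> smooth_fns Y" and Pf: "\<And>x. x \<in> Y \<Longrightarrow> diff_op P f x = 0"
      using f0 by (auto simp: zero_sols_def)
    have \<delta>': "\<delta> \<le> 1" "\<delta> \<le> e0" "\<delta> < d1" using \<delta> 1(5) by (auto simp: d_def)
    have intL: "interior L \<subseteq> L" by (rule interior_subset)
    have fi: "f \<in> smooth_fns (interior L)" by (rule smooth_subset[OF f]) (use L(2) intL in blast)
    note nge = Cr_norm_ge[OF f Y L(1,2)]
    define nf where "nf = Cr_norm L 0 f"
    define nf1 where "nf1 = Cr_norm L (r1 + 1) f"
    have "nf \<ge> 0" "nf1 \<ge> 0" unfolding nf_def nf1_def by (rule Cr_norm_nonneg[OF f Y L(1,2)])+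
    define w where "w = D * (1/\<delta>) ^ (?n + N2)"
    have "w \<ge> 0" using D(1) \<delta>(1) by (simp add: w_def)
    note mt = moll_test[OF \<rho> \<delta>(1)]
    have wb: "norm (iter_deriv is (moll \<rho> \<delta>) x) \<le> w" if "length is \<le> N2" for "is" x
      unfolding w_def using D(2) that \<delta>(1) \<delta>'(1) by blast
    have mtm: "iter_deriv is (moll \<rho> \<delta>) \<in> borel_measurable borel" for "is"
      using test_measurable[OF test_fns_in_iter_deriv[OF closed_cball mt]] .
    define F where "F y = indicator L y *\<^sub>R f y" for y
    have F: "bounded_supp nf (cball 0 R) F"
      unfolding bounded_supp_def
    proof (intro conjI allI impI)
      have "continuous_on L f" using continuous_on_subset[OF smooth_continuous_on[OF f, of "[]"] L(2)] by simp
      then show "F \<in> borel_measurable borel" unfolding F_def[abs_def]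
        by (intro borel_measurable_continuous_on_indicator) (use L(1) in \<open>auto intro: compact_imp_closed borel_closed\<close>)
      show "norm (F x) \<le> nf" for x
        using nge[of "[]" 0 x] \<open>nf \<ge> 0\<close> by (auto simp: F_def nf_def indicator_def)
      show "F x = 0" if "x \<notin> cball 0 R" for x using that LR by (auto simp: F_def R_def indicator_def)
    qed simp
    have Feq: "F y = f y" if "y \<in> interior L" for y using that intL by (auto simp: F_def)
    define u1 where "u1 = conv F (moll \<rho> \<delta>)"
    have u1s: "u1 \<in> smooth_fns UNIV" unfolding u1_def by (rule conv_smooth[OF F _ mt]) simp
    have u1t: "u1 \<in> test_fns_in (cball 0 R)"
      unfolding test_fns_in_def
    proof (intro CollectI conjI allI impI u1s)
      fix x :: "real^'n" assume x: "x \<notin> cball 0 R"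
      show "u1 x = 0" unfolding u1_def
      proof (rule conv_eq_0[of L _ \<delta>])
        show "F y = 0" if "y \<notin> L" for y using that by (simp add: F_def)
        show "moll \<rho> \<delta> y = 0" if "y \<notin> cball 0 \<delta>" for y using mt that by (simp add: test_fns_in_def)
        show "norm (x - a) > \<delta>" if "a \<in> L" for a
        proof -
          have "norm a \<le> R0" using LR that by auto
          then show ?thesis using x norm_triangle_sub[of x a] \<delta>'(1) by (simp add: R_def)
        qed
      qed
    qed
    have u1b: "norm (iter_deriv is u1 x) \<le> nf * w * vol" if "length is \<le> N2" for "is" x
      unfolding u1_def iter_deriv_conv[OF F compact_cball mt] vol_def
      by (rule norm_conv_le[OF F mtm]) (rule wb[OF that])
    have u1W: "iter_deriv is u1 y = conv (iter_deriv is f) (moll \<rho> \<delta>) y" if "y \<in> W (3 * e0)" for "is" y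
      unfolding u1_def
      by (rule conv_moll_iter_deriv[OF open_interior fi W2[OF that \<delta>'(2)] \<delta>(1) F])
        (use Feq W2[OF that \<delta>'(2)] in blast)
    \<comment> \<open>On \<open>W (3 * e0)\<close> the function \<open>u1\<close> is a genuine
      mollification of \<open>f\<close>, with which \<open>P(D)\<close> commutes, so
      \<open>G\<close> vanishes there.\<close>
    define G where "G = diff_op P u1"
    define BG where "BG = S0 * (nf * w * vol)"
    have Gc: "continuous_on UNIV G"
      unfolding G_def diff_op_lst by (intro continuous_intros smooth_continuous_on[OF u1s])
    have G: "bounded_supp BG A G"
      unfolding bounded_supp_def
    proof (intro conjI allI impI)
      show "G \<in> borel_measurable borel" by (rule borel_measurable_continuous_onI[OF Gc])
      show "bounded A" using A(1) by (rule compact_imp_bounded)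
      fix x
      have "norm (G x) \<le> (\<Sum>\<alpha>\<in>Poly_Mapping.keys P. norm (co P \<alpha>) * norm (iter_deriv (lst \<alpha>) u1 x))"
        unfolding G_def diff_op_lst norm_mult[symmetric] by (rule norm_sum)
      also have "\<dots> \<le> (\<Sum>\<alpha>\<in>Poly_Mapping.keys P. norm (co P \<alpha>) * (nf * w * vol))"
        by (intro sum_mono mult_left_mono u1b) (auto simp: N2_def dest: m)
      finally show "norm (G x) \<le> BG" by (simp add: BG_def S0_def sum_distrib_right)
      assume x: "x \<notin> A"
      show "G x = 0"
      proof (cases "x \<in> W (3 * e0)")
        case True
        note sub = W2[OF True \<delta>'(2)]
        have "G x = conv (diff_op P f) (moll \<rho> \<delta>) x"
          unfolding G_def diff_op_lst[of P u1] u1W[OF True] by (rule conv_diff_op[OF open_interior fi sub \<delta>(1)])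
        also have "\<dots> = conv (\<lambda>_. 0) (moll \<rho> \<delta>) x"
        proof (rule conv_cong[of \<delta>])
          show "moll \<rho> \<delta> y = 0" if "y \<notin> cball 0 \<delta>" for y using mt that by (simp add: test_fns_in_def)
          show "diff_op P f y = 0" if "y \<in> cball x \<delta>" for y
            by (rule Pf) (use that sub intL L(2) in blast)
        qed
        finally show ?thesis by (simp add: conv_def)
      next
        case False
        then have "x \<notin> cball 0 R" using x by (simp add: A_def)
        then have "iter_deriv is u1 x = 0" for "is"
          using test_fns_in_iter_deriv[OF closed_cball u1t, of "is"] by (simp add: test_fns_in_def)
        then show ?thesis by (simp add: G_def diff_op_lst)
      qed
    qed
    obtain v where "good_sol \<rho> P K R r C1 N1 \<kappa> Q \<delta> t G BG v"
      using sol \<delta>(1) \<delta>'(3) t G by blast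
    then have v: "v \<in> smooth_fns UNIV" "\<And>x. diff_op P v x = conv G (moll \<rho> \<delta>) x"
      "\<And>is x. length is \<le> r \<Longrightarrow> x \<in> K \<Longrightarrow> norm (iter_deriv is v x) \<le> C1 * (1/\<delta>) ^ N1 * exp (- \<kappa> * t) * BG"
      "\<And>is x. length is \<le> r \<Longrightarrow> norm x \<le> R \<Longrightarrow> norm (iter_deriv is v x) \<le> C1 * (1/\<delta>) ^ N1 * exp (Q * t) * BG"
      unfolding good_sol_def[OF \<rho>] by blast+
    have BGeq: "C1 * (1/\<delta>) ^ N1 * X * BG = C2 * (1/\<delta>) ^ N * X * nf" for X
      by (simp add: BG_def w_def C2_def N_def power_add mult_ac)
    have u1bs: "bounded_supp (nf * w * vol) (cball 0 R) u1"
      unfolding bounded_supp_def using u1b[of "[]"] test_measurable[OF u1t] u1t by (auto simp: test_fns_in_def)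
    \<comment> \<open>The second mollification makes \<open>P(D)u2\<close> equal to
      \<open>conv G (moll \<rho> \<delta>)\<close>, the shape of source that \<open>good_sol\<close>
      solves.\<close>
    define u2 where "u2 = conv u1 (moll \<rho> \<delta>)"
    have u2s: "u2 \<in> smooth_fns UNIV" unfolding u2_def by (rule conv_smooth[OF u1bs _ mt]) simp
    have u2d: "iter_deriv is u2 x = conv (iter_deriv is u1) (moll \<rho> \<delta>) x" for "is" x
      unfolding u2_def by (rule conv_moll_iter_deriv[OF open_UNIV u1s _ \<delta>(1) u1bs]) auto
    have Pu2: "diff_op P u2 x = conv G (moll \<rho> \<delta>) x" for x
      unfolding G_def diff_op_lst[of P u2] u2d by (rule conv_diff_op[OF open_UNIV u1s _ \<delta>(1)]) simp
    define h where "h x = u2 x - v x" for x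
    have hs: "h \<in> smooth_fns UNIV" unfolding h_def[abs_def] by (rule smooth_diff[OF _ u2s v(1)]) simp
    have hd: "iter_deriv is h x = iter_deriv is u2 x - iter_deriv is v x" for "is" x
      unfolding h_def[abs_def] by (rule iter_deriv_diff[OF _ u2s v(1)]) auto
    have "diff_op P h x = 0" for x
      unfolding h_def[abs_def] using diff_op_diff[OF open_UNIV u2s v(1) UNIV_I] by (simp add: Pu2 v(2))
    then have h: "h \<in> zero_sols P UNIV" using hs by (simp add: zero_sols_def)
    have hK: "Cr_norm K r1 (\<lambda>x. f x - h x) \<le> 2 * real ?n * \<delta> * nf1 + C2 * (1/\<delta>) ^ N * exp (- \<kappa> * t) * nf"
    proof (rule Cr_norm_le)
      show "0 \<le> 2 * real ?n * \<delta> * nf1 + C2 * (1/\<delta>) ^ N * exp (- \<kappa> * t) * nf"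
        using \<open>nf \<ge> 0\<close> \<open>nf1 \<ge> 0\<close> \<delta>(1) 1(1) \<open>S0 \<ge> 0\<close> \<open>vol \<ge> 0\<close> D(1)
        by (intro add_nonneg_nonneg mult_nonneg_nonneg) (auto simp: C2_def)
      fix "is" :: "'n list" and x assume len: "length is \<le> r1" and x: "x \<in> K"
      have xW: "x \<in> W (3 * e0)" using x KW by blast
      note subL = W2[OF xW \<delta>'(2)]
      have xY: "x \<in> Y" using x L(2,3) intL by blast
      have a1: "norm (iter_deriv is f x - iter_deriv is u1 x) \<le> real ?n * nf1 * \<delta>"
        unfolding u1W[OF xW]
      proof (rule moll_iter_deriv_approx[OF open_interior fi subL \<delta>(1)])
        show "norm (iter_deriv (i # is) f y) \<le> nf1" if "y \<in> cball x \<delta>" for i y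
          unfolding nf1_def by (rule nge) (use that subL intL len in auto)
      qed
      \<comment> \<open>The derivatives of \<open>u1\<close> near \<open>x\<close> are averages of
        those of \<open>f\<close> over balls inside \<open>L\<close>, so the same bound
        \<open>nf1\<close> applies to them.\<close>
      have a2: "norm (iter_deriv is u1 x - iter_deriv is u2 x) \<le> real ?n * nf1 * \<delta>"
        unfolding u2d
      proof (rule moll_iter_deriv_approx[OF open_UNIV u1s _ \<delta>(1)])
        show "norm (iter_deriv (i # is) u1 y) \<le> nf1" if y: "y \<in> cball x \<delta>" for i y
        proof -
          have yW: "y \<in> W (3 * e0)" using W1[OF x \<delta>'(2)] y by blast
          note sub = W2[OF yW \<delta>'(2)]
          have "norm (conv (iter_deriv (i # is) f) (moll \<rho> \<delta>) y) \<le> nf1"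
          proof (rule moll_weighted_bound[OF \<rho> \<delta>(1)])
            show "continuous_on (cball y \<delta>) (iter_deriv (i # is) f)"
              by (rule continuous_on_subset[OF smooth_continuous_on[OF fi] sub])
            show "norm (iter_deriv (i # is) f z) \<le> nf1" if "z \<in> cball y \<delta>" for z
              unfolding nf1_def by (rule nge) (use that sub intL len in auto)
          qed
          then show ?thesis by (simp only: u1W[OF yW])
        qed
      qed simp
      have a3: "norm (iter_deriv is v x) \<le> C2 * (1/\<delta>) ^ N * exp (- \<kappa> * t) * nf"
        using v(3)[OF _ x, of "is"] len unfolding BGeq by (simp add: r_def)
      have "iter_deriv is (\<lambda>x. f x - h x) x = iter_deriv is f x - iter_deriv is h x"
        by (rule iter_deriv_diff[OF Y f smooth_subset[OF hs] xY]) simp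
      also have "\<dots> = (iter_deriv is f x - iter_deriv is u1 x) + (iter_deriv is u1 x - iter_deriv is u2 x) + iter_deriv is v x"
        by (simp add: hd)
      also have "norm \<dots> \<le> real ?n * nf1 * \<delta> + real ?n * nf1 * \<delta> + C2 * (1/\<delta>) ^ N * exp (- \<kappa> * t) * nf"
        by (intro norm_triangle_le add_mono a1 a2 a3)
      finally show "norm (iter_deriv is (\<lambda>x. f x - h x) x)
        \<le> 2 * real ?n * \<delta> * nf1 + C2 * (1/\<delta>) ^ N * exp (- \<kappa> * t) * nf" by (simp add: algebra_simps)
    qed
    have hM: "Cr_norm M r2 h \<le> (E * (1/\<delta>) ^ k + C2 * (1/\<delta>) ^ N * exp (Q * t)) * nf"
    proof (rule Cr_norm_le)
      show "0 \<le> (E * (1/\<delta>) ^ k + C2 * (1/\<delta>) ^ N * exp (Q * t)) * nf"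
        using \<open>nf \<ge> 0\<close> \<delta>(1) 1(1) \<open>S0 \<ge> 0\<close> \<open>vol \<ge> 0\<close> D(1)
        by (intro add_nonneg_nonneg mult_nonneg_nonneg) (auto simp: C2_def E_def)
      fix "is" :: "'n list" and x assume len: "length is \<le> r2" and x: "x \<in> M"
      have "norm (iter_deriv is u2 x) \<le> (nf * w * vol) * w * vol"
        unfolding u2_def iter_deriv_conv[OF u1bs compact_cball mt] vol_def[symmetric]
        unfolding vol_def[symmetric] using norm_conv_le[OF u1bs mtm wb, of "is" x] len
        by (simp add: N2_def r_def vol_def)
      also have "\<dots> = E * (1/\<delta>) ^ k * nf" by (simp add: E_def w_def k_def power_add power2_eq_square mult_ac)
      finally have "norm (iter_deriv is u2 x) \<le> E * (1/\<delta>) ^ k * nf" .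
      moreover have "norm (iter_deriv is v x) \<le> C2 * (1/\<delta>) ^ N * exp (Q * t) * nf"
        using v(4)[OF _ MR[OF x], of "is"] len unfolding BGeq by (simp add: r_def)
      ultimately show "norm (iter_deriv is h x) \<le> (E * (1/\<delta>) ^ k + C2 * (1/\<delta>) ^ N * exp (Q * t)) * nf"
        unfolding hd distrib_right by (rule norm_triangle_le_diff[OF add_mono])
    qed
    show ?thesis using h hK hM unfolding nf_def nf1_def by blast
  qed
  have "C2 \<ge> 0" "E \<ge> 0" "d > 0" "d \<le> 1"
    using 1 \<open>S0 \<ge> 0\<close> \<open>vol \<ge> 0\<close> D(1) \<open>e0 > 0\<close> by (auto simp: C2_def E_def d_def)
  with 1(2,3) main show ?thesis by blast
qed

end

text \<open>The parameter \<open>t\<close> is taken logarithmic in \<open>\<epsilon>\<close>, so that exponentials in \<open>t\<close> become powers of \<open>\<epsilon>\<close>.\<close>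

lemma exponential_parameter:
  fixes C2 E \<kappa> Q c :: real
  assumes "C2 \<ge> 0" "E \<ge> 0" "\<kappa> > 0" "Q \<ge> 0" "0 < c" "c \<le> 1"
  shows "\<exists>s C. s > 0 \<and> C > 0 \<and> (\<forall>\<epsilon>. 0 < \<epsilon> \<and> \<epsilon> < 1 \<longrightarrow> (\<exists>t\<ge>0.
    C2 * (1/(c * \<epsilon>)) ^ N * exp (- \<kappa> * t) \<le> \<epsilon> / 2 \<and>
    E * (1/(c * \<epsilon>)) ^ k + C2 * (1/(c * \<epsilon>)) ^ N * exp (Q * t) \<le> C / \<epsilon> powr s))"
proof -
  define p where "p = Q / \<kappa>"
  \<comment> \<open>With exp (- \<kappa> t) = b \<epsilon>^(N+1) the first quantity becomes C2 / (C2
    + 1) times \<epsilon> / 2. The summand 1 allows C2 = 0.\<close>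
  define b where "b = c ^ N / (2 * (C2 + 1))"
  have "p \<ge> 0" using assms by (simp add: p_def)
  have b: "0 < b" "b \<le> 1"
    using assms power_le_one[of c N] by (auto simp: b_def field_simps)
  \<comment> \<open>\<open>exp (Q * t)\<close> is the power -p of b \<epsilon>^(N+1), which accounts
    for (N + 1) p; k and N come from the powers of 1/(c \<epsilon>), and the final 1 makes s
    positive.\<close>
  define s where "s = real k + real N + (real N + 1) * p + 1"
  define C where "C = E * (1/c) ^ k + C2 * (1/c) ^ N * (1/b) powr p + 1"
  have "s > 0" using \<open>p \<ge> 0\<close> by (simp add: s_def add_nonneg_pos)
  have "C > 0" using assms b by (auto simp: C_def intro!: add_nonneg_pos add_nonneg_nonneg mult_nonneg_nonneg)
  show ?thesis
  proof (rule exI[of _ s], rule exI[of _ C], intro conjI allI impI; (elim conjE)?)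
    fix \<epsilon> :: real assume \<epsilon>: "0 < \<epsilon>" "\<epsilon> < 1"
    define x where "x = b * \<epsilon> ^ (N + 1)"
    have x: "0 < x" "x \<le> 1"
      using b \<epsilon> power_le_one[of \<epsilon> "N + 1"] by (auto simp: x_def intro!: mult_le_one)
    define t where "t = - ln x / \<kappa>"
    have "t \<ge> 0" using x assms by (simp add: t_def divide_nonpos_pos)
    have e1: "exp (- \<kappa> * t) = x" using x assms by (simp add: t_def)
    have e2: "exp (Q * t) = (1/x) powr p"
      using x by (simp add: t_def p_def powr_def ln_div)
    have 1: "C2 * (1/(c * \<epsilon>)) ^ N * exp (- \<kappa> * t) \<le> \<epsilon> / 2"
    proof -
      have "C2 * (1/(c * \<epsilon>)) ^ N * exp (- \<kappa> * t) = C2 / (C2 + 1) * (\<epsilon> / 2)"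
        unfolding e1 x_def b_def using assms \<epsilon> by (simp add: power_divide power_mult_distrib field_simps)
      also have "\<dots> \<le> 1 * (\<epsilon> / 2)" using assms \<epsilon> by (intro mult_right_mono) (auto simp: field_simps)
      finally show ?thesis by simp
    qed
    have inv: "(1/(c * \<epsilon>)) ^ j = (1/c) ^ j * \<epsilon> powr (- real j)" for j
      using \<epsilon> assms by (simp add: power_divide power_mult_distrib powr_minus powr_realpow field_simps)
    have pw: "(1/x) powr p = (1/b) powr p * \<epsilon> powr (- ((real N + 1) * p))"
    proof -
      have "\<epsilon> powr (- (real N + 1)) = inverse (\<epsilon> ^ (N + 1))"
        using \<epsilon> powr_realpow[of \<epsilon> "N + 1"] by (simp only: powr_minus of_nat_add of_nat_1)
      then have "1/x = (1/b) * \<epsilon> powr (- (real N + 1))"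
        using \<epsilon> b by (simp add: x_def field_simps)
      then show ?thesis using \<epsilon> b by (simp add: powr_divide powr_powr algebra_simps)
    qed
    have mono: "\<epsilon> powr (- y) \<le> \<epsilon> powr (- s)" if "y \<le> s" for y
      using that \<epsilon> by (intro powr_mono') auto
    have "E * (1/(c * \<epsilon>)) ^ k + C2 * (1/(c * \<epsilon>)) ^ N * exp (Q * t)
      = E * (1/c) ^ k * \<epsilon> powr (- real k) + C2 * (1/c) ^ N * (1/b) powr p * (\<epsilon> powr (- real N) * \<epsilon> powr (- ((real N + 1) * p)))"
      unfolding e2 pw inv by (simp add: mult_ac)
    also have "\<epsilon> powr (- real N) * \<epsilon> powr (- ((real N + 1) * p)) = \<epsilon> powr (- (real N + (real N + 1) * p))"
      by (simp add: powr_add[symmetric])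
    also have "E * (1/c) ^ k * \<epsilon> powr (- real k) + C2 * (1/c) ^ N * (1/b) powr p * \<epsilon> powr (- (real N + (real N + 1) * p))
      \<le> E * (1/c) ^ k * \<epsilon> powr (- s) + C2 * (1/c) ^ N * (1/b) powr p * \<epsilon> powr (- s)"
      using assms b \<open>p \<ge> 0\<close> by (intro add_mono mult_left_mono mono) (auto simp: s_def)
    also have "\<dots> \<le> C * \<epsilon> powr (- s)" by (simp add: C_def distrib_right)
    finally have "E * (1/(c * \<epsilon>)) ^ k + C2 * (1/(c * \<epsilon>)) ^ N * exp (Q * t) \<le> C / \<epsilon> powr s"
      by (simp add: powr_minus divide_inverse)
    with 1 \<open>t \<ge> 0\<close> show "\<exists>t\<ge>0. C2 * (1/(c * \<epsilon>)) ^ N * exp (- \<kappa> * t) \<le> \<epsilon> / 2 \<and>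
      E * (1/(c * \<epsilon>)) ^ k + C2 * (1/(c * \<epsilon>)) ^ N * exp (Q * t) \<le> C / \<epsilon> powr s" by blast
  qed fact+
qed

text \<open>The order \<open>r1'\<close> of the norm on \<open>L\<close> is a separate parameter,
  since it is \<open>r1 + 1\<close> in general and 0 in the hypoelliptic case.\<close>

definition runge_approximable :: "'n::finite cpoly \<Rightarrow> (real^'n) set \<Rightarrow> (real^'n) set \<Rightarrow> (real^'n) set \<Rightarrow> (real^'n) set
    \<Rightarrow> nat \<Rightarrow> nat \<Rightarrow> nat \<Rightarrow> bool" where
  "runge_approximable P K Y L M r1 r1' r2 \<longleftrightarrow> (\<exists>s C. s > 0 \<and> C > 0 \<and>
     (\<forall>f\<in>zero_sols P Y. \<forall>\<epsilon>::real. 0 < \<epsilon> \<and> \<epsilon> < 1 \<longrightarrow>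
       (\<exists>h\<in>zero_sols P UNIV. Cr_norm K r1 (\<lambda>x. f x - h x) \<le> \<epsilon> * Cr_norm L r1' f \<and>
          Cr_norm M r2 h \<le> C / \<epsilon> powr s * Cr_norm L 0 f)))"

lemma runge_general:
  fixes P :: "'n::finite cpoly"
  assumes P: "P \<noteq> 0" and K: "compact K" "convex K" and Y: "open Y"
    and L: "compact L" "L \<subseteq> Y" "K \<subseteq> interior L" and M: "compact M"
  shows "runge_approximable P K Y L M r1 (r1 + 1) r2"
proof -
  obtain \<rho> :: "real^'n \<Rightarrow> real" where \<rho>: "mollifier \<rho>" using ex_mollifier by blast
  let ?n = "real CARD('n)"
  obtain C2 E \<kappa> Q d N k where c: "C2 \<ge> 0" "E \<ge> 0" "\<kappa> > 0" "Q \<ge> 0" "d > 0" "d \<le> 1"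
    and app: "\<forall>f\<in>zero_sols P Y. \<forall>\<delta> t. 0 < \<delta> \<and> \<delta> < d \<and> t \<ge> 0 \<longrightarrow> (\<exists>h\<in>zero_sols P UNIV.
      Cr_norm K r1 (\<lambda>x. f x - h x) \<le> 2 * ?n * \<delta> * Cr_norm L (r1 + 1) f
        + C2 * (1/\<delta>) ^ N * exp (- \<kappa> * t) * Cr_norm L 0 f \<and>
      Cr_norm M r2 h \<le> (E * (1/\<delta>) ^ k + C2 * (1/\<delta>) ^ N * exp (Q * t)) * Cr_norm L 0 f)"
    using runge_parametric[OF \<rho> P K Y L M, of r1 r2] by blast
  \<comment> \<open>With \<delta> = c0 \<epsilon> both mollifications together cost at most
    \<epsilon> / 2, because d \<le> 1; the correction term gets the other half. Moreover \<delta>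
    stays below d.\<close>
  define c0 where "c0 = d / (4 * ?n)"
  have n1: "?n \<ge> 1" by (simp add: Suc_le_eq)
  have "d / (4 * ?n) \<le> d / 1" by (rule divide_left_mono) (use c n1 in linarith)+
  then have "c0 \<le> d" by (simp add: c0_def)
  moreover have "0 < c0" "2 * ?n * c0 \<le> 1/2" using c by (auto simp: c0_def)
  ultimately have c0: "0 < c0" "c0 \<le> 1" "c0 \<le> d" "2 * ?n * c0 \<le> 1/2" using c by auto
  obtain s C where sC: "s > 0" "C > 0"
    and par: "\<forall>\<epsilon>. 0 < \<epsilon> \<and> \<epsilon> < 1 \<longrightarrow> (\<exists>t\<ge>0. C2 * (1/(c0 * \<epsilon>)) ^ N * exp (- \<kappa> * t) \<le> \<epsilon> / 2 \<and>
      E * (1/(c0 * \<epsilon>)) ^ k + C2 * (1/(c0 * \<epsilon>)) ^ N * exp (Q * t) \<le> C / \<epsilon> powr s)"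
    using exponential_parameter[OF c(1-4) c0(1,2), of N k] by blast
  show ?thesis
    unfolding runge_approximable_def
  proof (rule exI[of _ s], rule exI[of _ C], intro conjI ballI allI impI; (elim conjE)?)
    fix f and \<epsilon> :: real assume f0: "f \<in> zero_sols P Y" and \<epsilon>: "0 < \<epsilon>" "\<epsilon> < 1"
    have f: "f \<in> smooth_fns Y" using f0 by (simp add: zero_sols_def)
    obtain t where t: "t \<ge> 0" "C2 * (1/(c0 * \<epsilon>)) ^ N * exp (- \<kappa> * t) \<le> \<epsilon> / 2"
      "E * (1/(c0 * \<epsilon>)) ^ k + C2 * (1/(c0 * \<epsilon>)) ^ N * exp (Q * t) \<le> C / \<epsilon> powr s"
      using par \<epsilon> by blast
    have lt: "c0 * \<epsilon> < c0 * 1" using c0 \<epsilon> by (intro mult_strict_left_mono) auto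
    have \<delta>: "0 < c0 * \<epsilon>" using c0 \<epsilon> by simp
    have \<delta>': "c0 * \<epsilon> < d" using lt c0(3) by linarith
    obtain h where h: "h \<in> zero_sols P UNIV"
      "Cr_norm K r1 (\<lambda>x. f x - h x) \<le> 2 * ?n * (c0 * \<epsilon>) * Cr_norm L (r1 + 1) f
        + C2 * (1/(c0 * \<epsilon>)) ^ N * exp (- \<kappa> * t) * Cr_norm L 0 f"
      "Cr_norm M r2 h \<le> (E * (1/(c0 * \<epsilon>)) ^ k + C2 * (1/(c0 * \<epsilon>)) ^ N * exp (Q * t)) * Cr_norm L 0 f"
      using app f0 \<delta> \<delta>' t(1) by blast
    note nn = Cr_norm_nonneg[OF f Y L(1,2)]
    have "2 * ?n * (c0 * \<epsilon>) = (2 * ?n * c0) * \<epsilon>" by simp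
    also have "\<dots> \<le> (1/2) * \<epsilon>" by (rule mult_right_mono[OF c0(4)]) (use \<epsilon> in simp)
    finally have "2 * ?n * (c0 * \<epsilon>) * Cr_norm L (r1 + 1) f \<le> (1/2) * \<epsilon> * Cr_norm L (r1 + 1) f"
      by (rule mult_right_mono[OF _ nn])
    moreover have "C2 * (1/(c0 * \<epsilon>)) ^ N * exp (- \<kappa> * t) * Cr_norm L 0 f \<le> \<epsilon> / 2 * Cr_norm L (r1 + 1) f"
      by (rule mult_mono[OF t(2) Cr_norm_mono[OF f Y L(1,2)]]) (use \<epsilon> nn in auto)
    ultimately have "Cr_norm K r1 (\<lambda>x. f x - h x) \<le> \<epsilon> * Cr_norm L (r1 + 1) f"
      using h(2) by simp
    moreover have "Cr_norm M r2 h \<le> C / \<epsilon> powr s * Cr_norm L 0 f"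
      by (rule order_trans[OF h(3) mult_right_mono[OF t(3) nn]])
    ultimately show "\<exists>h\<in>zero_sols P UNIV. Cr_norm K r1 (\<lambda>x. f x - h x) \<le> \<epsilon> * Cr_norm L (r1 + 1) f \<and>
          Cr_norm M r2 h \<le> C / \<epsilon> powr s * Cr_norm L 0 f"
      using h(1) by blast
  qed fact+
qed

section \<open>A priori estimate for hypoelliptic operators\<close>

text \<open>The gliding hump argument behind the uniform boundedness principle, in the form of Sokal:
  since \<open>\<bar>a + b\<bar>\<close> or \<open>\<bar>a - b\<bar>\<close> is at least \<open>\<bar>b\<bar>\<close>, the humps can be added without cancellation.\<close>

lemma gliding_hump:
  fixes V :: "('a::real_normed_vector \<Rightarrow> complex) set"
  assumes V0: "(\<lambda>_. 0) \<in> V" and V: "\<And>f g c. f \<in> V \<Longrightarrow> g \<in> V \<Longrightarrow> (\<lambda>z. f z + c * g z) \<in> V"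
    and T: "\<And>x y. (x, y) \<in> T \<Longrightarrow> x \<in> L \<and> y \<in> L \<and> x \<noteq> y"
    and unbdd: "\<And>C. \<exists>f\<in>V. \<exists>(x, y)\<in>T. (\<forall>z\<in>L. norm (f z) \<le> 1) \<and> norm (f x - f y) > C * norm (x - y)"
  shows "\<exists>F G. (\<forall>n. F n \<in> V) \<and> (\<forall>n. \<forall>z\<in>L. norm (G z - F n z) \<le> (1/3) ^ n) \<and>
    (\<forall>C. \<exists>(x, y)\<in>T. norm (G x - G y) > C * norm (x - y))"
proof -
  define U where "U = {f\<in>V. \<forall>z\<in>L. norm (f z) \<le> 1}"
  \<comment> \<open>At a pair with a large difference quotient, \<open>f\<close> is replaced by an
    almost maximiser over the unit ball \<open>U\<close>. The factor 4/3 will later control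
    everything added after it.\<close>
  have "\<exists>f x y. f \<in> U \<and> (x, y) \<in> T \<and> norm (f x - f y) > C * norm (x - y) \<and>
      (\<forall>g\<in>U. norm (g x - g y) \<le> 4/3 * norm (f x - f y))" for C
  proof -
    obtain f0 x y where 0: "f0 \<in> U" "(x, y) \<in> T" "norm (f0 x - f0 y) > \<bar>2 * C\<bar> * norm (x - y)"
      using unbdd[of "\<bar>2 * C\<bar>"] unfolding U_def by blast
    let ?S = "(\<lambda>f. norm (f x - f y)) ` U"
    have "norm (f x - f y) \<le> 2" if "f \<in> U" for f
    proof -
      have "norm (f x) \<le> 1" "norm (f y) \<le> 1" using \<open>f \<in> U\<close> T[OF 0(2)] by (auto simp: U_def)
      then show ?thesis using norm_triangle_ineq4[of "f x" "f y"] by linarith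
    qed
    then have bdd: "bdd_above ?S" by (intro bdd_aboveI[of _ 2]) auto
    have le: "norm (g x - g y) \<le> Sup ?S" if "g \<in> U" for g
      using that by (intro cSup_upper bdd) auto
    have "0 \<le> \<bar>2 * C\<bar> * norm (x - y)" by simp
    then have pos: "0 < Sup ?S" "\<bar>2 * C\<bar> * norm (x - y) < Sup ?S" using 0(3) le[OF 0(1)] by linarith+
    have "3/4 * Sup ?S < Sup ?S" using pos by simp
    then obtain f where f: "f \<in> U" "3/4 * Sup ?S < norm (f x - f y)"
      using less_cSup_iff[of ?S "3/4 * Sup ?S"] bdd 0(1) by auto
    have "C * norm (x - y) \<le> \<bar>C\<bar> * norm (x - y)" by (intro mult_right_mono) auto
    also have "\<dots> \<le> 1/2 * Sup ?S" using pos(2) by (simp add: abs_mult)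
    also have "\<dots> < norm (f x - f y)" using f(2) pos(1) by linarith
    finally have "C * norm (x - y) < norm (f x - f y)" .
    moreover have "norm (g x - g y) \<le> 4/3 * norm (f x - f y)" if "g \<in> U" for g
      using le[OF that] f(2) by linarith
    ultimately show ?thesis using f(1) 0(2) by blast
  qed
  then obtain f x y where f: "\<And>C. f C \<in> U" and xy: "\<And>C::real. (x C, y C) \<in> T"
    and big: "\<And>C. norm (f C (x C) - f C (y C)) > C * norm (x C - y C)"
    and max: "\<And>C g. g \<in> U \<Longrightarrow> norm (g (x C) - g (y C)) \<le> 4/3 * norm (f C (x C) - f C (y C))"
    by metis
  \<comment> \<open>Compensates the weight 3^(-n) of the n-th hump and the third of it that survives
    the tail, leaving a quotient above n.\<close>
  define C where "C n = 3 * 3 ^ n * real n" for n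
  define D where "D n = norm (f (C n) (x (C n)) - f (C n) (y (C n)))" for n
  define step where "step n h s z = h z + complex_of_real (s * (1/3) ^ n) * f (C n) z" for n h s z
  define good where "good n h \<longleftrightarrow> norm (h (x (C n)) - h (y (C n))) \<ge> (1/3) ^ n * D n" for n and h :: "'a \<Rightarrow> complex"
  define F where "F = rec_nat (\<lambda>_. 0) (\<lambda>n h. if good (Suc n) (step (Suc n) h 1) then step (Suc n) h 1 else step (Suc n) h (-1))"
  have F_simps: "F 0 = (\<lambda>_. 0)"
    "F (Suc n) = (if good (Suc n) (step (Suc n) (F n) 1) then step (Suc n) (F n) 1 else step (Suc n) (F n) (-1))" for n
    by (simp_all add: F_def)
  have fV: "f C \<in> V" and fL: "\<And>z. z \<in> L \<Longrightarrow> norm (f C z) \<le> 1" for C using f[of C] by (auto simp: U_def)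
  have FV: "F n \<in> V" for n
  proof (induction n)
    case (Suc n)
    then have "step (Suc n) (F n) s \<in> V" for s unfolding step_def[abs_def] by (intro V fV)
    then show ?case by (simp add: F_simps)
  qed (simp add: F_simps V0)
  have Fgood: "good (Suc n) (F (Suc n))" for n
  proof -
    let ?x = "x (C (Suc n))" and ?y = "y (C (Suc n))"
    let ?a = "F n ?x - F n ?y" and ?b = "complex_of_real ((1/3) ^ Suc n) * (f (C (Suc n)) ?x - f (C (Suc n)) ?y)"
    have p: "step (Suc n) (F n) 1 ?x - step (Suc n) (F n) 1 ?y = ?a + ?b"
      and m: "step (Suc n) (F n) (-1) ?x - step (Suc n) (F n) (-1) ?y = ?a - ?b"
      by (simp_all add: step_def algebra_simps)
    have b: "norm ?b = (1/3) ^ Suc n * D (Suc n)" by (simp only: norm_mult norm_of_real D_def) simp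
    have "2 * norm ?b = norm ((?a + ?b) - (?a - ?b))"
    proof -
      have "(?a + ?b) - (?a - ?b) = 2 * ?b" by simp
      then show ?thesis by (metis norm_mult norm_numeral)
    qed
    also have "\<dots> \<le> norm (?a + ?b) + norm (?a - ?b)" by (rule norm_triangle_ineq4)
    finally have "norm ?b \<le> norm (?a + ?b) \<or> norm ?b \<le> norm (?a - ?b)" by linarith
    moreover have "good (Suc n) (step (Suc n) (F n) 1) \<longleftrightarrow> norm ?b \<le> norm (?a + ?b)"
      unfolding good_def p b ..
    moreover have "good (Suc n) (step (Suc n) (F n) (-1)) \<longleftrightarrow> norm ?b \<le> norm (?a - ?b)"
      unfolding good_def m b ..
    ultimately have "good (Suc n) (step (Suc n) (F n) 1) \<or> good (Suc n) (step (Suc n) (F n) (-1))"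
      by blast
    then show ?thesis by (auto simp only: F_simps if_True if_False split: if_split)
  qed
  have inc: "norm (F (Suc n) z - F n z) \<le> (1/3) ^ Suc n" if "z \<in> L" for n z
  proof -
    have "norm (F (Suc n) z - F n z) = (1/3) ^ Suc n * norm (f (C (Suc n)) z)"
      by (simp add: F_simps step_def norm_mult norm_power norm_divide)
    also have "\<dots> \<le> (1/3) ^ Suc n * 1" using fL[OF that] by (intro mult_left_mono) auto
    finally show ?thesis by simp
  qed
  \<comment> \<open>Geometric series: everything after stage n sums to at most half of
    3^(-n).\<close>
  have diff: "norm (F (n + k) z - F n z) \<le> (1/3) ^ n / 2 * (1 - (1/3) ^ k)" if "z \<in> L" for n k z
  proof (induction k)
    case (Suc k)
    have "norm (F (n + Suc k) z - F n z) \<le> norm (F (Suc (n + k)) z - F (n + k) z) + norm (F (n + k) z - F n z)"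
      using norm_triangle_ineq[of "F (Suc (n + k)) z - F (n + k) z" "F (n + k) z - F n z"] by simp
    also have "\<dots> \<le> (1/3) ^ Suc (n + k) + (1/3) ^ n / 2 * (1 - (1/3) ^ k)"
      by (intro add_mono inc[OF that] Suc)
    also have "\<dots> = (1/3) ^ n / 2 * (1 - (1/3) ^ Suc k)" by (simp add: power_add field_simps)
    finally show ?case .
  qed simp
  have diff': "norm (F m z - F n z) \<le> (1/3) ^ n / 2" if "z \<in> L" "n \<le> m" for n m z
  proof -
    have "norm (F m z - F n z) \<le> (1/3) ^ n / 2 * (1 - (1/3) ^ (m - n))"
      using diff[OF that(1), of n "m - n"] that(2) by simp
    also have "\<dots> \<le> (1/3) ^ n / 2 * 1" by (intro mult_left_mono) auto
    finally show ?thesis by simp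
  qed
  have "\<exists>l. (\<lambda>n. F n z) \<longlonglongrightarrow> l" if z: "z \<in> L" for z
  proof -
    have "Cauchy (\<lambda>n. F n z)"
    proof (rule CauchyI)
      fix e :: real assume "e > 0"
      then obtain N where N: "(1/3) ^ N < e" using real_arch_pow_inv[of e "1/3"] by auto
      have "norm (F m z - F n z) < e" if "N \<le> m" "N \<le> n" for m n
      proof -
        have "norm (F m z - F n z) \<le> norm (F m z - F N z) + norm (F n z - F N z)"
          using norm_triangle_ineq4[of "F m z - F N z" "F n z - F N z"] by simp
        also have "\<dots> \<le> (1/3) ^ N / 2 + (1/3) ^ N / 2" by (intro add_mono diff'[OF z] that)
        finally show ?thesis using N by simp
      qed
      then show "\<exists>M. \<forall>m\<ge>M. \<forall>n\<ge>M. norm (F m z - F n z) < e" by blast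
    qed
    then show ?thesis using Cauchy_convergent convergent_def by blast
  qed
  then obtain G where G: "\<And>z. z \<in> L \<Longrightarrow> (\<lambda>n. F n z) \<longlonglongrightarrow> G z" by metis
  have GF: "norm (G z - F n z) \<le> (1/3) ^ n" if z: "z \<in> L" for z n
  proof -
    have "norm (G z - F n z) \<le> (1/3) ^ n / 2"
    proof (rule tendsto_upperbound)
      show "(\<lambda>m. norm (F m z - F n z)) \<longlonglongrightarrow> norm (G z - F n z)"
        by (intro tendsto_intros G[OF z])
      show "\<forall>\<^sub>F m in sequentially. norm (F m z - F n z) \<le> (1/3) ^ n / 2"
        using eventually_ge_at_top[of n] by eventually_elim (rule diff'[OF z])
    qed simp
    also have "\<dots> \<le> (1/3) ^ n" by simp
    finally show ?thesis .
  qed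
  have "\<exists>(x, y)\<in>T. norm (G x - G y) > B * norm (x - y)" for B
  proof -
    obtain n where n: "real n > \<bar>B\<bar>" using reals_Archimedean2 by blast
    then have n0: "n \<noteq> 0" by auto
    let ?x = "x (C n)" and ?y = "y (C n)"
    have L: "?x \<in> L" "?y \<in> L" "?x \<noteq> ?y" using T[OF xy[of "C n"]] by auto
    have low: "norm (F n ?x - F n ?y) \<ge> (1/3) ^ n * D n"
      using Fgood[of "n - 1"] n0 by (simp add: good_def)
    \<comment> \<open>The tail divided by 3^(-n)/2 lies in \<open>U\<close>, so almost maximality
      applies to it at the n-th pair. It can destroy at most 2/3 of the hump of height 3^(-n)
      \<open>D n\<close>.\<close>
    have tail: "norm ((G ?x - F n ?x) - (G ?y - F n ?y)) \<le> (1/3) ^ n / 2 * (4/3 * D n)"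
    proof (rule tendsto_upperbound)
      show "(\<lambda>m. norm ((F m ?x - F n ?x) - (F m ?y - F n ?y))) \<longlonglongrightarrow> norm ((G ?x - F n ?x) - (G ?y - F n ?y))"
        by (intro tendsto_intros G L)
      show "\<forall>\<^sub>F m in sequentially. norm ((F m ?x - F n ?x) - (F m ?y - F n ?y)) \<le> (1/3) ^ n / 2 * (4/3 * D n)"
        using eventually_ge_at_top[of n]
      proof eventually_elim
        fix m assume m: "n \<le> m"
        define a :: real where "a = (1/3) ^ n / 2"
        have "a > 0" by (simp add: a_def)
        define g where "g z = 0 + complex_of_real (1/a) * (F m z + (-1) * F n z)" for z
        have "g \<in> V" unfolding g_def[abs_def] by (intro V V0 FV)
        moreover have "norm (g z) \<le> 1" if "z \<in> L" for z
        proof -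
          have "norm (g z) = norm (F m z - F n z) / a" using \<open>a > 0\<close> by (simp add: g_def norm_divide)
          then show ?thesis using diff'[OF that m] \<open>a > 0\<close> by (simp add: a_def[symmetric])
        qed
        ultimately have "norm (g ?x - g ?y) \<le> 4/3 * D n" unfolding D_def by (intro max) (simp add: U_def)
        moreover have "g ?x - g ?y = ((F m ?x - F n ?x) - (F m ?y - F n ?y)) / complex_of_real a"
          by (simp add: g_def diff_divide_distrib)
        then have "norm (g ?x - g ?y) = norm ((F m ?x - F n ?x) - (F m ?y - F n ?y)) / a"
          using \<open>a > 0\<close> by (simp only: norm_divide norm_of_real abs_of_pos)
        ultimately show "norm ((F m ?x - F n ?x) - (F m ?y - F n ?y)) \<le> (1/3) ^ n / 2 * (4/3 * D n)"
          using \<open>a > 0\<close> by (simp add: a_def[symmetric] pos_divide_le_eq mult.commute)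
      qed
    qed simp
    have "F n ?x - F n ?y = (G ?x - G ?y) - ((G ?x - F n ?x) - (G ?y - F n ?y))" by simp
    then have "norm (F n ?x - F n ?y) \<le> norm (G ?x - G ?y) + norm ((G ?x - F n ?x) - (G ?y - F n ?y))"
      by (metis norm_triangle_ineq4)
    moreover have "(1/3) ^ n / 2 * (4/3 * D n) = 2/3 * ((1/3) ^ n * D n)" "(1/3) ^ n / 3 * D n = 1/3 * ((1/3) ^ n * D n)"
      by simp_all
    ultimately have "norm (G ?x - G ?y) \<ge> (1/3) ^ n / 3 * D n" using low tail by linarith
    moreover have "(1/3) ^ n / 3 * D n > (1/3) ^ n / 3 * (C n * norm (?x - ?y))"
      unfolding D_def by (intro mult_strict_left_mono big) simp
    moreover have "(1/3) ^ n / 3 * (C n * norm (?x - ?y)) = real n * norm (?x - ?y)"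
      by (simp add: C_def power_divide)
    moreover have "B * norm (?x - ?y) \<le> real n * norm (?x - ?y)" using n by (intro mult_right_mono) auto
    ultimately have "norm (G ?x - G ?y) > B * norm (?x - ?y)" by linarith
    with xy show ?thesis by blast
  qed
  with FV GF show ?thesis by blast
qed

section \<open>Limits of solutions in the sense of distributions\<close>

lemma integration_by_parts_iter:
  fixes f \<psi> :: "real^'n::finite \<Rightarrow> complex"
  assumes X: "open X" and K: "compact K" "K \<subseteq> X" and f: "f \<in> smooth_fns X" and \<psi>: "\<psi> \<in> test_fns_in K"
  shows "(LINT y|lborel. f y * iter_deriv is \<psi> y) = (-1) ^ length is * (LINT y|lborel. iter_deriv is f y * \<psi> y)"
  using f
proof (induction "is" arbitrary: f rule: rev_induct)
  case (snoc i "is")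
  note f = \<open>f \<in> smooth_fns X\<close>
  have perm: "iter_deriv (is @ [i]) \<psi> y = iter_deriv (i # is) \<psi> y" for y
    by (rule iter_deriv_permute[of _ UNIV]) (use \<psi> in \<open>auto simp: test_fns_in_def\<close>)
  have "(LINT y|lborel. f y * iter_deriv (is @ [i]) \<psi> y) = (LINT y|lborel. f y * partial_deriv i (iter_deriv is \<psi>) y)"
    unfolding perm by simp
  also have "\<dots> = - (LINT y|lborel. partial_deriv i f y * iter_deriv is \<psi> y)"
    by (rule integration_by_parts[OF X K f test_fns_in_iter_deriv[OF compact_imp_closed[OF K(1)] \<psi>]])
  also have "\<dots> = - ((-1) ^ length is * (LINT y|lborel. iter_deriv is (partial_deriv i f) y * \<psi> y))"
    by (simp only: snoc.IH[OF smooth_partial_deriv[OF f]])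
  finally show ?case by (simp add: iter_deriv_append)
qed simp

lemma distr_diff_op_lst:
  "distr_diff_op P u \<phi> = (\<Sum>\<alpha>\<in>Poly_Mapping.keys P. co P \<alpha> * ((-1) ^ mdeg \<alpha> * u (iter_deriv (lst \<alpha>) \<phi>)))"
  by (simp add: distr_diff_op_def co_def mderiv_lst)

text \<open>With all derivatives on the test function, uniform convergence of the functions alone
  carries the equation to the limit.\<close>

lemma distr_diff_op_limit:
  fixes P :: "'n::finite cpoly" and G :: "real^'n \<Rightarrow> complex"
  assumes X: "open X" and F: "\<And>n. F n \<in> zero_sols P X"
    and G: "bounded_supp B (cball 0 R) G" and lim: "\<And>n z. z \<in> X \<Longrightarrow> norm (G z - F n z) \<le> (1/3) ^ n"
    and \<phi>: "\<phi> \<in> test_fns X"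
  shows "distr_diff_op P (\<lambda>\<phi>. LINT x|lborel. G x * \<phi> x) \<phi> = 0"
proof -
  obtain K where K: "compact K" "K \<subseteq> X" "\<phi> \<in> test_fns_in K" using \<phi> by (auto simp: test_fns_def)
  note cl = compact_imp_closed[OF K(1)]
  have sF: "F n \<in> smooth_fns X" and PF: "\<And>x. x \<in> X \<Longrightarrow> diff_op P (F n) x = 0" for n
    using F[of n] by (auto simp: zero_sols_def)
  have lim1: "(\<lambda>n. LINT x|lborel. F n x * iter_deriv is \<phi> x) \<longlonglongrightarrow> (LINT x|lborel. G x * iter_deriv is \<phi> x)" for "is"
  proof -
    have t: "iter_deriv is \<phi> \<in> test_fns_in K" by (rule test_fns_in_iter_deriv[OF cl K(3)])
    obtain D where D: "D \<ge> 0" "\<And>x. norm (iter_deriv is \<phi> x) \<le> D" using test_bounded[OF K(1) t] by blast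
    have iF: "integrable lborel (\<lambda>x. F n x * iter_deriv is \<phi> x)" for n
      by (rule test_integrable[OF K(1) smooth_mult_test[OF X cl K(2) sF t]])
    have iG: "integrable lborel (\<lambda>x. G x * iter_deriv is \<phi> x)"
      by (rule bounded_supp_integrable_bound(1)[OF G test_measurable[OF t] D(2)])
    have le: "norm ((LINT x|lborel. F n x * iter_deriv is \<phi> x) - (LINT x|lborel. G x * iter_deriv is \<phi> x))
      \<le> (1/3) ^ n * (D * measure lborel K)" for n
    proof -
      have "(LINT x|lborel. F n x * iter_deriv is \<phi> x) - (LINT x|lborel. G x * iter_deriv is \<phi> x)
        = (LINT x|lborel. F n x * iter_deriv is \<phi> x - G x * iter_deriv is \<phi> x)"
        using iF iG by simp
      also have "norm \<dots> \<le> (LINT x|lborel. ((1/3) ^ n * D) * indicator K x)"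
      proof (rule Bochner_Integration.integral_norm_bound_integral)
        show "integrable lborel (\<lambda>x. F n x * iter_deriv is \<phi> x - G x * iter_deriv is \<phi> x)"
          using iF iG by simp
        show "integrable lborel (\<lambda>x. ((1/3) ^ n * D) * indicat_real K x)"
          by (intro integrable_mult_right integrable_real_indicator)
            (use K(1) emeasure_compact_finite[OF K(1)] in \<open>auto intro: borel_compact\<close>)
        fix x
        show "norm (F n x * iter_deriv is \<phi> x - G x * iter_deriv is \<phi> x) \<le> ((1/3) ^ n * D) * indicator K x"
        proof (cases "x \<in> K")
          case True
          have "norm (F n x * iter_deriv is \<phi> x - G x * iter_deriv is \<phi> x) = norm (G x - F n x) * norm (iter_deriv is \<phi> x)"
            by (metis left_diff_distrib norm_minus_commute norm_mult)
          also have "\<dots> \<le> (1/3) ^ n * D" by (intro mult_mono lim D(2)) (use True K(2) in auto)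
          finally show ?thesis using True by simp
        next
          case False
          then show ?thesis using t by (simp add: test_fns_in_def)
        qed
      qed
      finally show ?thesis by (simp add: mult.assoc)
    qed
    have "(\<lambda>n. (1/3::real) ^ n * (D * measure lborel K)) \<longlonglongrightarrow> 0"
      by (intro tendsto_mult_left_zero LIMSEQ_power_zero) simp
    from Lim_null_comparison[OF always_eventually[OF allI[OF le]] this] show ?thesis
      by (rule LIM_zero_cancel)
  qed
  have "(\<Sum>\<alpha>\<in>Poly_Mapping.keys P. co P \<alpha> * ((-1) ^ mdeg \<alpha> * (LINT x|lborel. F n x * iter_deriv (lst \<alpha>) \<phi> x))) = 0" for n
  proof -
    have sign: "(-1) ^ m * ((-1) ^ m * y) = y" for m and y :: complex
      by (cases "even m") auto
    have int: "integrable lborel (\<lambda>x. iter_deriv is (F n) x * \<phi> x)" for "is"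
      by (rule test_integrable[OF K(1) smooth_mult_test[OF X cl K(2) iter_deriv_smooth[OF sF] K(3)]])
    have "(\<Sum>\<alpha>\<in>Poly_Mapping.keys P. co P \<alpha> * ((-1) ^ mdeg \<alpha> * (LINT x|lborel. F n x * iter_deriv (lst \<alpha>) \<phi> x)))
      = (\<Sum>\<alpha>\<in>Poly_Mapping.keys P. (LINT x|lborel. co P \<alpha> * (iter_deriv (lst \<alpha>) (F n) x * \<phi> x)))"
      by (simp only: integration_by_parts_iter[OF X K(1,2) sF K(3)] length_lst sign integral_mult_right_zero)
    also have "\<dots> = (LINT x|lborel. (\<Sum>\<alpha>\<in>Poly_Mapping.keys P. co P \<alpha> * (iter_deriv (lst \<alpha>) (F n) x * \<phi> x)))"
      by (rule Bochner_Integration.integral_sum[symmetric]) (intro integrable_mult_right int)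
    also have "\<dots> = (LINT x|lborel. diff_op P (F n) x * \<phi> x)"
      by (simp add: diff_op_lst sum_distrib_right mult.assoc)
    also have "(\<lambda>x. diff_op P (F n) x * \<phi> x) = (\<lambda>x. 0)"
      using PF K(2,3) by (fastforce simp: test_fns_in_def)
    finally show ?thesis by simp
  qed
  moreover have "(\<lambda>n. \<Sum>\<alpha>\<in>Poly_Mapping.keys P. co P \<alpha> * ((-1) ^ mdeg \<alpha> * (LINT x|lborel. F n x * iter_deriv (lst \<alpha>) \<phi> x)))
    \<longlonglongrightarrow> distr_diff_op P (\<lambda>\<phi>. LINT x|lborel. G x * \<phi> x) \<phi>"
    unfolding distr_diff_op_lst by (rule tendsto_sum, rule tendsto_mult_left, rule tendsto_mult_left, rule lim1)
  ultimately have "(\<lambda>n::nat. 0) \<longlonglongrightarrow> distr_diff_op P (\<lambda>\<phi>. LINT x|lborel. G x * \<phi> x) \<phi>"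
    by (simp only:)
  from LIMSEQ_unique[OF this tendsto_const] show ?thesis .
qed

lemma distribution_on_function:
  fixes G :: "real^'n::finite \<Rightarrow> complex"
  assumes G: "bounded_supp B (cball 0 R) G"
  shows "distribution_on X (\<lambda>\<phi>. LINT x|lborel. G x * \<phi> x)"
proof -
  have int: "integrable lborel (\<lambda>x. G x * \<phi> x)" if "\<phi> \<in> test_fns X" for \<phi>
  proof -
    obtain K where K: "compact K" "\<phi> \<in> test_fns_in K" using \<open>\<phi> \<in> test_fns X\<close> by (auto simp: test_fns_def)
    obtain D where "\<And>x. norm (\<phi> x) \<le> D" using test_bounded[OF K] by blast
    then show ?thesis by (rule bounded_supp_integrable_bound(1)[OF G test_measurable[OF K(2)]])
  qed
  have "norm (LINT x|lborel. G x * \<phi> x) \<le> (B * measure lborel (cball (0::real^'n) R)) * Cr_norm K 0 \<phi>"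
    if K: "compact K" and \<phi>: "\<phi> \<in> test_fns_in K" for K \<phi>
  proof -
    have s: "\<phi> \<in> smooth_fns UNIV" using \<phi> by (simp add: test_fns_in_def)
    have "norm (\<phi> x) \<le> Cr_norm K 0 \<phi>" for x
    proof (cases "x \<in> K")
      case True
      then show ?thesis using Cr_norm_ge[OF s open_UNIV K, of "[]" 0 x] by simp
    next
      case False
      then show ?thesis using Cr_norm_nonneg[OF s open_UNIV K] \<phi> by (simp add: test_fns_in_def)
    qed
    from bounded_supp_integrable_bound(2)[OF G test_measurable[OF \<phi>] this]
    show ?thesis by (simp add: mult_ac)
  qed
  then show ?thesis
    unfolding distribution_on_def using int by (auto simp: distrib_left mult.left_commute[of _ "_::complex"])
qed

text \<open>Translated mollifiers are test functions, so \<open>F\<close> and \<open>g\<close> have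
  equal averages at small scales, and continuity compares these with the values at
  \<open>x\<close>.\<close>

lemma continuous_eq_if_integrals_eq:
  fixes F g :: "real^'n::finite \<Rightarrow> complex"
  assumes X: "open X" and F: "continuous_on X F" and g: "continuous_on X g"
    and eq: "\<And>\<phi>. \<phi> \<in> test_fns X \<Longrightarrow> (LINT y|lborel. F y * \<phi> y) = (LINT y|lborel. g y * \<phi> y)"
    and x: "x \<in> X"
  shows "F x = g x"
proof (rule ccontr)
  obtain \<rho> :: "real^'n \<Rightarrow> real" where \<rho>: "mollifier \<rho>" using ex_mollifier by blast
  assume "F x \<noteq> g x"
  define e where "e = norm (F x - g x) / 3"
  have e: "e > 0" using \<open>F x \<noteq> g x\<close> by (simp add: e_def)
  obtain r where r: "r > 0" "cball x r \<subseteq> X" using X x open_contains_cball by blast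
  obtain d1 where d1: "d1 > 0" "\<And>y. y \<in> X \<Longrightarrow> dist y x < d1 \<Longrightarrow> dist (F y) (F x) < e"
    using F x e unfolding continuous_on_iff by blast
  obtain d2 where d2: "d2 > 0" "\<And>y. y \<in> X \<Longrightarrow> dist y x < d2 \<Longrightarrow> dist (g y) (g x) < e"
    using g x e unfolding continuous_on_iff by blast
  define \<delta> where "\<delta> = min r (min d1 d2 / 2)"
  have \<delta>: "\<delta> > 0" using r d1 d2 by (simp add: \<delta>_def)
  have sub: "cball x \<delta> \<subseteq> X" using r by (auto simp: \<delta>_def)
  have near: "y \<in> X \<and> dist y x < d1 \<and> dist y x < d2" if "y \<in> cball x \<delta>" for y
    using that sub d1(1) d2(1) by (auto simp: \<delta>_def dist_commute)
  have "norm (F x - conv F (moll \<rho> \<delta>) x) \<le> e"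
    by (rule moll_approx[OF \<rho> \<delta> continuous_on_subset[OF F sub]])
      (use near d1(2) in \<open>force simp: dist_norm norm_minus_commute\<close>)
  moreover have "norm (g x - conv g (moll \<rho> \<delta>) x) \<le> e"
    by (rule moll_approx[OF \<rho> \<delta> continuous_on_subset[OF g sub]])
      (use near d2(2) in \<open>force simp: dist_norm norm_minus_commute\<close>)
  moreover have "conv F (moll \<rho> \<delta>) x = conv g (moll \<rho> \<delta>) x"
  proof -
    have "(\<lambda>y. moll \<rho> \<delta> (x + (-1) *\<^sub>R y)) \<in> test_fns_in (cball x \<delta>)"
      by (rule test_fns_in_affine[OF moll_test[OF \<rho> \<delta>]]) (auto simp: dist_norm norm_minus_commute)
    then have "(\<lambda>y. moll \<rho> \<delta> (x - y)) \<in> test_fns X"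
      unfolding test_fns_def using sub by (intro UN_I[of "cball x \<delta>"]) auto
    from eq[OF this] show ?thesis by (simp add: conv_def)
  qed
  ultimately have "norm (F x - g x) \<le> e + e"
    using norm_triangle_ineq4[of "F x - conv F (moll \<rho> \<delta>) x" "g x - conv g (moll \<rho> \<delta>) x"] by simp
  then show False using e by (simp add: e_def)
qed

lemma zero_sols_linear:
  assumes X: "open X" and "f \<in> zero_sols P X" "g \<in> zero_sols P X"
  shows "(\<lambda>z. f z + c * g z) \<in> zero_sols P X"
proof -
  have s: "f \<in> smooth_fns X" "g \<in> smooth_fns X" using assms by (auto simp: zero_sols_def)
  have "diff_op P (\<lambda>z. f z + c * g z) x = diff_op P f x + c * diff_op P g x" if "x \<in> X" for x
    unfolding diff_op_lst iter_deriv_add[OF X s(1) smooth_cmult[OF X s(2)] that] iter_deriv_cmult[OF X s(2) that]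
    by (simp add: distrib_left sum.distrib sum_distrib_left mult_ac)
  then show ?thesis using assms smooth_add[OF X s(1) smooth_cmult[OF X s(2)]] by (auto simp: zero_sols_def)
qed

lemma zero_sols_subset: "f \<in> zero_sols P X \<Longrightarrow> X' \<subseteq> X \<Longrightarrow> f \<in> zero_sols P X'"
  unfolding zero_sols_def using smooth_subset by blast

text \<open>If no constant works, \<open>gliding_hump\<close> gives a uniform limit of solutions on
  \<open>L\<close> with unbounded difference quotients. This limit solves the equation on the
  interior of \<open>L\<close> as a distribution, so by hypoellipticity it is smooth there, hence
  Lipschitz on balls in a compact subset: a contradiction. Difference quotients are used because
  they depend on values only and so survive uniform limits.\<close>

lemma hypoelliptic_Lipschitz:
  fixes P :: "'n::finite cpoly"
  assumes hyp: "hypoelliptic P" and Y: "open Y" and L: "compact L" "L \<subseteq> Y"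
    and L': "compact L'" and r: "r > 0" "\<And>x. x \<in> L' \<Longrightarrow> cball x r \<subseteq> interior L"
  shows "\<exists>C. \<forall>f\<in>zero_sols P Y. \<forall>x\<in>L'. \<forall>y\<in>cball x r. (\<forall>z\<in>L. norm (f z) \<le> 1) \<longrightarrow> norm (f x - f y) \<le> C * norm (x - y)"
proof (rule ccontr)
  assume neg: "\<not> ?thesis"
  define X where "X = interior L"
  have X: "open X" "X \<subseteq> L" "X \<subseteq> Y" using L(2) interior_subset[of L] by (auto simp: X_def)
  define T where "T = {(x, y). x \<in> L' \<and> y \<in> cball x r \<and> x \<noteq> y}"
  have T: "x \<in> X \<and> y \<in> X \<and> x \<noteq> y" if "(x, y) \<in> T" for x y
    using that r(2)[of x] r(1) by (auto simp: T_def X_def)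
  have "\<exists>F G. (\<forall>n. F n \<in> zero_sols P Y) \<and> (\<forall>n. \<forall>z\<in>L. norm (G z - F n z) \<le> (1/3) ^ n) \<and>
    (\<forall>C. \<exists>(x, y)\<in>T. norm (G x - G y) > C * norm (x - y))"
  proof (rule gliding_hump)
    show "(\<lambda>_. 0) \<in> zero_sols P Y"
      using Y by (auto simp: zero_sols_def diff_op_lst iter_deriv_const)
    show "(\<lambda>z. f z + c * g z) \<in> zero_sols P Y" if "f \<in> zero_sols P Y" "g \<in> zero_sols P Y" for f g c
      by (rule zero_sols_linear[OF Y that])
    show "x \<in> L \<and> y \<in> L \<and> x \<noteq> y" if "(x, y) \<in> T" for x y using T[OF that] X(2) by blast
    fix C
    from neg obtain f x y where *: "f \<in> zero_sols P Y" "x \<in> L'" "y \<in> cball x r" "\<forall>z\<in>L. norm (f z) \<le> 1"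
      "\<not> norm (f x - f y) \<le> C * norm (x - y)" by blast
    then have "x \<noteq> y" by auto
    then have "(x, y) \<in> T" using * by (simp add: T_def)
    with * show "\<exists>f\<in>zero_sols P Y. \<exists>(x, y)\<in>T. (\<forall>z\<in>L. norm (f z) \<le> 1) \<and> norm (f x - f y) > C * norm (x - y)"
      by (intro bexI[of _ f] bexI[of _ "(x, y)"]) auto
  qed
  then obtain F G0 where F: "\<And>n. F n \<in> zero_sols P Y" and G0: "\<And>n z. z \<in> L \<Longrightarrow> norm (G0 z - F n z) \<le> (1/3) ^ n"
    and big: "\<And>C. \<exists>(x, y)\<in>T. norm (G0 x - G0 y) > C * norm (x - y)" by blast
  have Fc: "continuous_on L (F n)" for n
    using F[of n] continuous_on_subset[OF smooth_continuous_on[of "F n" Y "[]"] L(2)] by (simp add: zero_sols_def)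
  have "uniform_limit L F G0 sequentially"
  proof (rule uniform_limitI)
    fix e :: real assume "e > 0"
    then obtain N where N: "(1/3) ^ N < e" using real_arch_pow_inv[of e "1/3"] by auto
    show "\<forall>\<^sub>F n in sequentially. \<forall>z\<in>L. dist (F n z) (G0 z) < e"
      using eventually_ge_at_top[of N]
    proof eventually_elim
      fix n assume "N \<le> n"
      then have "(1/3::real) ^ n \<le> (1/3) ^ N" by (intro power_decreasing) auto
      then have "(1/3::real) ^ n < e" using N by linarith
      then show "\<forall>z\<in>L. dist (F n z) (G0 z) < e"
        using le_less_trans[OF G0[of _ n]] by (simp add: dist_norm norm_minus_commute)
    qed
  qed
  then have Gc: "continuous_on L G0"
    by (rule uniform_limit_theorem[rotated]) (auto simp: Fc)
  \<comment> \<open>The limit is controlled only on \<open>L\<close>; cutting it off there makes it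
    a bounded measurable function, hence a distribution.\<close>
  define G where "G z = indicator L z *\<^sub>R G0 z" for z
  have GG: "G z = G0 z" if "z \<in> L" for z using that by (simp add: G_def)
  obtain R where R: "L \<subseteq> cball 0 R"
    using compact_imp_bounded[OF L(1)] unfolding bounded_pos by (auto simp: subset_iff)
  obtain B where B: "B > 0" "\<And>z. z \<in> L \<Longrightarrow> norm (G0 z) \<le> B"
    using compact_imp_bounded[OF compact_continuous_image[OF Gc L(1)]] unfolding bounded_pos by auto
  have Gb: "bounded_supp B (cball 0 R) G"
    unfolding bounded_supp_def
  proof (intro conjI allI impI)
    show "G \<in> borel_measurable borel" unfolding G_def[abs_def]
      by (intro borel_measurable_continuous_on_indicator Gc) (use L(1) in \<open>auto intro: borel_compact\<close>)
    show "norm (G x) \<le> B" for x using B by (auto simp: G_def indicator_def)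
    show "G x = 0" if "x \<notin> cball 0 R" for x using that R by (auto simp: G_def indicator_def)
  qed simp
  let ?u = "\<lambda>\<phi>. LINT x|lborel. G x * \<phi> x"
  have "distr_diff_op P ?u \<phi> = 0" if "\<phi> \<in> test_fns X" for \<phi>
  proof (rule distr_diff_op_limit[OF X(1) _ Gb _ that])
    show "F n \<in> zero_sols P X" for n by (rule zero_sols_subset[OF F X(3)])
    show "norm (G z - F n z) \<le> (1/3) ^ n" if "z \<in> X" for n z
      using G0[of z n] GG[of z] X(2) that by auto
  qed
  then have "smooth_distr X (distr_diff_op P ?u)"
    unfolding smooth_distr_def using X(1) by (intro bexI[of _ "\<lambda>_. 0"]) auto
  then have "smooth_distr X ?u"
    using hyp X(1) distribution_on_function[OF Gb] unfolding hypoelliptic_def by blast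
  then obtain g where g: "g \<in> smooth_fns X" and ug: "\<And>\<phi>. \<phi> \<in> test_fns X \<Longrightarrow> ?u \<phi> = (LINT x|lborel. g x * \<phi> x)"
    unfolding smooth_distr_def by blast
  have "continuous_on X G"
    by (rule continuous_on_cong[THEN iffD1, OF refl _ continuous_on_subset[OF Gc X(2)]]) (use GG X(2) in auto)
  then have eq: "G0 x = g x" if "x \<in> X" for x
    using continuous_eq_if_integrals_eq[OF X(1) _ _ ug that] smooth_continuous_on[OF g, of "[]"] GG X(2) that by auto
  \<comment> \<open>A compact subset of \<open>X\<close> that contains every pair from
    \<open>T\<close>, so one bound for the gradient of \<open>g\<close> serves all of them.\<close>
  define S where "S = (\<Union>x\<in>L'. cball x r)"
  have S: "compact S" "S \<subseteq> X"
  proof -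
    have "S = {x + y | x y. x \<in> L' \<and> y \<in> cball 0 r}"
      unfolding S_def by (auto simp: dist_norm) (metis add.commute diff_add_cancel norm_minus_commute)
    then show "compact S" by (simp only: compact_sums[OF L' compact_cball])
    show "S \<subseteq> X" using r(2) by (auto simp: S_def X_def)
  qed
  have "\<exists>b. \<forall>x\<in>S. norm (partial_deriv i g x) \<le> b" for i
  proof -
    have "continuous_on S (partial_deriv i g)"
      using continuous_on_subset[OF smooth_continuous_on[OF g, of "[i]"] S(2)] by simp
    from compact_imp_bounded[OF compact_continuous_image[OF this S(1)]]
    show ?thesis unfolding bounded_iff by auto
  qed
  then obtain b where b: "\<And>i x. x \<in> S \<Longrightarrow> norm (partial_deriv i g x) \<le> b i" by metis
  define b0 where "b0 = (\<Sum>i\<in>UNIV. \<bar>b i\<bar>)"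
  have b0: "norm (partial_deriv i g x) \<le> b0" if "x \<in> S" for i x
  proof -
    have "norm (partial_deriv i g x) \<le> \<bar>b i\<bar>" using b[OF that, of i] by linarith
    also have "\<dots> \<le> b0" unfolding b0_def by (rule member_le_sum) auto
    finally show ?thesis .
  qed
  obtain x y where xy: "(x, y) \<in> T" "norm (G0 x - G0 y) > (real CARD('n) * b0) * norm (x - y)"
    using big[of "real CARD('n) * b0"] by blast
  have "norm (g x - g y) \<le> real CARD('n) * b0 * norm (x - y)"
  proof (rule differentiable_Lipschitz[of "cball x r"])
    show "g differentiable at z" if "z \<in> cball x r" for z
      using smooth_differentiable[OF X(1) g] r(2)[of x] xy(1) that by (auto simp: T_def X_def)
    show "norm (partial_deriv i g z) \<le> b0" if "z \<in> cball x r" for z i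
      using that xy(1) by (intro b0) (auto simp: S_def T_def)
  qed (use xy(1) r(1) in \<open>auto simp: T_def\<close>)
  then show False using xy eq T[OF xy(1)] by simp
qed

text \<open>The Lipschitz constant bounds the difference quotients in the coordinate directions and
  hence the partial derivatives; homogeneity removes the normalisation of \<open>f\<close> on
  \<open>L\<close>.\<close>

lemma hypoelliptic_estimate:
  fixes P :: "'n::finite cpoly"
  assumes hyp: "hypoelliptic P" and Y: "open Y" and L: "compact L" "L \<subseteq> Y"
    and L': "compact L'" "L' \<subseteq> interior L"
  shows "\<exists>C\<ge>1. \<forall>f\<in>zero_sols P Y. Cr_norm L' 1 f \<le> C * Cr_norm L 0 f"
proof -
  obtain e where e: "e > 0" "(\<Union>x\<in>L'. ball x e) \<subseteq> interior L"
    using compact_subset_open_imp_ball_epsilon_subset[OF L'(1) open_interior L'(2)] by blast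
  define r where "r = e / 2"
  have r: "r > 0" "cball x r \<subseteq> interior L" if "x \<in> L'" for x
    using e that by (force simp: r_def)+
  have "r > 0" using e(1) by (simp add: r_def)
  obtain C where C: "\<forall>f\<in>zero_sols P Y. \<forall>x\<in>L'. \<forall>y\<in>cball x r. (\<forall>z\<in>L. norm (f z) \<le> 1) \<longrightarrow> norm (f x - f y) \<le> C * norm (x - y)"
    using hypoelliptic_Lipschitz[OF hyp Y L L'(1) \<open>r > 0\<close> r(2)] by blast
  have pd: "norm (partial_deriv i f x) \<le> C" if f: "f \<in> zero_sols P Y" and x: "x \<in> L'" and b: "\<forall>z\<in>L. norm (f z) \<le> 1" for f x i
  proof -
    have "x \<in> Y" using x L'(2) L(2) interior_subset[of L] by blast
    have df: "f differentiable (at x)"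
      using f smooth_differentiable[OF Y _ \<open>x \<in> Y\<close>] by (simp add: zero_sols_def)
    let ?p = "\<lambda>h. f (x + h *\<^sub>R axis i 1)"
    have "(?p has_vector_derivative partial_deriv i f (x + 0 *\<^sub>R axis i 1)) (at 0 within UNIV)"
      by (rule has_derivative_along) (simp add: df)
    then have "((\<lambda>h. norm (?p h - ?p 0 - h *\<^sub>R partial_deriv i f x) / \<bar>h\<bar>) \<longlongrightarrow> 0) (at 0)"
      by (simp add: has_vector_derivative_def has_derivative_at diff_diff_eq)
    then have lim: "((\<lambda>h. C + norm (?p h - ?p 0 - h *\<^sub>R partial_deriv i f x) / \<bar>h\<bar>) \<longlongrightarrow> C + 0) (at 0)"
      by (intro tendsto_add tendsto_const)
    have "norm (partial_deriv i f x) \<le> C + 0"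
    proof (rule tendsto_lowerbound[OF lim])
      have "norm (partial_deriv i f x) \<le> C + norm (?p h - ?p 0 - h *\<^sub>R partial_deriv i f x) / \<bar>h\<bar>"
        if "h \<noteq> 0" "\<bar>h\<bar> < r" for h
      proof -
        have "x + h *\<^sub>R axis i 1 \<in> cball x r" using that(2) by (simp add: dist_norm)
        then have "norm (f x - ?p h) \<le> C * norm (x - (x + h *\<^sub>R axis i 1))"
          using C f x b by blast
        then have 1: "norm (?p h - ?p 0) \<le> C * \<bar>h\<bar>" by (simp add: norm_minus_commute)
        have "\<bar>h\<bar> * norm (partial_deriv i f x) = norm ((?p h - ?p 0) - (?p h - ?p 0 - h *\<^sub>R partial_deriv i f x))"
          by simp
        also have "\<dots> \<le> C * \<bar>h\<bar> + norm (?p h - ?p 0 - h *\<^sub>R partial_deriv i f x)"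
          using norm_triangle_ineq4 1 by (rule order_trans[OF _ add_right_mono])
        finally show ?thesis using that(1) by (simp add: field_simps)
      qed
      then show "\<forall>\<^sub>F h in at 0. norm (partial_deriv i f x) \<le> C + norm (?p h - ?p 0 - h *\<^sub>R partial_deriv i f x) / \<bar>h\<bar>"
        using \<open>r > 0\<close> unfolding eventually_at by (intro exI[of _ r]) auto
    qed simp
    then show ?thesis by simp
  qed
  define C1 where "C1 = max 1 C"
  have "Cr_norm L' 1 f \<le> C1 * Cr_norm L 0 f" if f: "f \<in> zero_sols P Y" for f
  proof -
    have s: "f \<in> smooth_fns Y" using f by (simp add: zero_sols_def)
    let ?N = "Cr_norm L 0 f"
    have N0: "?N \<ge> 0" by (rule Cr_norm_nonneg[OF s Y L])
    have fN: "norm (f z) \<le> ?N" if "z \<in> L" for z using Cr_norm_ge[OF s Y L, of "[]" 0 z] that by simp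
    have pdN: "norm (partial_deriv i f x) \<le> C1 * ?N" if x: "x \<in> L'" for x i
    proof -
      \<comment> \<open>Rescaling by any positive a above the norm, since the norm itself may be 0;
        afterwards a decreases to the norm.\<close>
      have bound: "norm (partial_deriv i f x) \<le> C1 * a" if a: "a > 0" "?N \<le> a" for a
      proof -
        have xY: "x \<in> Y" using x L'(2) L(2) interior_subset[of L] by blast
        let ?g = "\<lambda>z. 0 + complex_of_real (1/a) * f z"
        have "(\<lambda>_. 0) \<in> zero_sols P Y"
          using Y by (auto simp: zero_sols_def diff_op_lst iter_deriv_const)
        then have g: "?g \<in> zero_sols P Y" by (rule zero_sols_linear[OF Y _ f])
        have gb: "\<forall>z\<in>L. norm (?g z) \<le> 1"
        proof
          fix z assume "z \<in> L"
          then have "norm (f z) \<le> a" using fN a(2) by force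
          then show "norm (?g z) \<le> 1" using a(1) by (simp add: norm_mult norm_divide)
        qed
        have "partial_deriv i ?g x = complex_of_real (1/a) * partial_deriv i f x"
          using partial_deriv_cmult[OF smooth_differentiable[OF Y s xY]] by (simp only: add_0)
        then have "norm (partial_deriv i f x) / a = norm (partial_deriv i ?g x)"
          using a(1) by (simp only: norm_mult) (simp add: norm_divide)
        also have "\<dots> \<le> C" by (rule pd[OF g x gb])
        also have "\<dots> \<le> C1" by (simp add: C1_def)
        finally show ?thesis using a(1) by (simp add: field_simps)
      qed
      show ?thesis
      proof (rule field_le_epsilon)
        fix d :: real assume "d > 0"
        have "C1 > 0" by (simp add: C1_def)
        have "norm (partial_deriv i f x) \<le> C1 * (?N + d / C1)"
          by (rule bound) (use N0 \<open>d > 0\<close> \<open>C1 > 0\<close> in \<open>auto intro: add_nonneg_pos\<close>)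
        then show "norm (partial_deriv i f x) \<le> C1 * ?N + d" using \<open>C1 > 0\<close> by (simp add: distrib_left)
      qed
    qed
    show ?thesis
    proof (rule Cr_norm_le)
      show "0 \<le> C1 * ?N" using N0 by (simp add: C1_def)
      fix "is" :: "'n list" and x assume len: "length is \<le> 1" and x: "x \<in> L'"
      show "norm (iter_deriv is f x) \<le> C1 * ?N"
      proof (cases "is")
        case Nil
        have "norm (f x) \<le> 1 * ?N" using fN x L'(2) interior_subset[of L] by auto
        also have "\<dots> \<le> C1 * ?N" using N0 by (intro mult_right_mono) (auto simp: C1_def)
        finally show ?thesis using Nil by simp
      next
        case (Cons i js)
        then show ?thesis using len pdN[OF x] by simp
      qed
    qed
  qed
  moreover have "C1 \<ge> 1" by (simp add: C1_def)
  ultimately show ?thesis by blast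
qed

text \<open>The general result is applied to an intermediate set L' around \<open>K\<close> inside
  the interior of \<open>L\<close>; the a priori estimate then trades the first derivatives on L'
  for the sup norm on \<open>L\<close>. Its constant is absorbed by running the general result with
  \<epsilon> / (2 C1), at the price of the factor (2 C1)^s in \<open>C\<close>.\<close>

lemma runge_hypoelliptic:
  fixes P :: "'n::finite cpoly"
  assumes P: "P \<noteq> 0" and hyp: "hypoelliptic P" and K: "compact K" "convex K" and Y: "open Y"
    and L: "compact L" "L \<subseteq> Y" "K \<subseteq> interior L" and M: "compact M"
  shows "runge_approximable P K Y L M 0 0 0"
proof -
  obtain e where e: "e > 0" "(\<Union>x\<in>K. ball x e) \<subseteq> interior L"
    using compact_subset_open_imp_ball_epsilon_subset[OF K(1) open_interior L(3)] by blast
  define L' where "L' = {x + y | x y. x \<in> K \<and> y \<in> cball 0 (e/2)}"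
  have L'c: "compact L'" unfolding L'_def by (rule compact_sums[OF K(1) compact_cball])
  have L'i: "L' \<subseteq> interior L"
  proof
    fix z assume "z \<in> L'"
    then obtain x y where "z = x + y" "x \<in> K" "norm y \<le> e/2" by (auto simp: L'_def)
    then have "z \<in> ball x e" using e(1) by (simp add: dist_norm)
    then show "z \<in> interior L" using e(2) \<open>x \<in> K\<close> by blast
  qed
  have KL': "K \<subseteq> interior L'"
  proof
    fix x assume x: "x \<in> K"
    have "ball x (e/2) \<subseteq> L'"
    proof
      fix z assume "z \<in> ball x (e/2)"
      then have "z = x + (z - x)" "z - x \<in> cball 0 (e/2)" by (auto simp: dist_norm norm_minus_commute)
      then show "z \<in> L'" unfolding L'_def using x by blast
    qed
    then show "x \<in> interior L'" using e(1) by (intro interiorI[of "ball x (e/2)"]) auto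
  qed
  have L'L: "L' \<subseteq> L" using L'i interior_subset[of L] by blast
  obtain C1 where C1: "C1 \<ge> 1" "\<And>f. f \<in> zero_sols P Y \<Longrightarrow> Cr_norm L' 1 f \<le> C1 * Cr_norm L 0 f"
    using hypoelliptic_estimate[OF hyp Y L(1,2) L'c L'i] by blast
  have L'Y: "L' \<subseteq> Y" using L'L L(2) by blast
  obtain s C where sC: "s > 0" "C > 0" and app: "\<forall>f\<in>zero_sols P Y. \<forall>\<epsilon>::real. 0 < \<epsilon> \<and> \<epsilon> < 1 \<longrightarrow>
       (\<exists>h\<in>zero_sols P UNIV. Cr_norm K 0 (\<lambda>x. f x - h x) \<le> \<epsilon> * Cr_norm L' (0 + 1) f \<and>
          Cr_norm M 0 h \<le> C / \<epsilon> powr s * Cr_norm L' 0 f)"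
    using runge_general[OF P K Y L'c L'Y KL' M, of 0 0] unfolding runge_approximable_def by blast
  show ?thesis
    unfolding runge_approximable_def
  proof (rule exI[of _ s], rule exI[of _ "C * (2 * C1) powr s"], intro conjI ballI allI impI; (elim conjE)?)
    show "0 < C * (2 * C1) powr s" using sC C1 by simp
    fix f and \<epsilon> :: real assume f: "f \<in> zero_sols P Y" and \<epsilon>: "0 < \<epsilon>" "\<epsilon> < 1"
    have s: "f \<in> smooth_fns Y" using f by (simp add: zero_sols_def)
    note nn = Cr_norm_nonneg[OF s Y L(1,2)]
    have \<epsilon>': "0 < \<epsilon> / (2 * C1)" "\<epsilon> / (2 * C1) < 1" using \<epsilon> C1(1) by (auto simp: field_simps)
    obtain h where h: "h \<in> zero_sols P UNIV"
      "Cr_norm K 0 (\<lambda>x. f x - h x) \<le> \<epsilon> / (2 * C1) * Cr_norm L' 1 f"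
      "Cr_norm M 0 h \<le> C / (\<epsilon> / (2 * C1)) powr s * Cr_norm L' 0 f"
      using app f \<epsilon>' by (metis add_0)
    have "\<epsilon> / (2 * C1) * Cr_norm L' 1 f \<le> \<epsilon> / (2 * C1) * (C1 * Cr_norm L 0 f)"
      by (intro mult_left_mono C1(2) f) (use \<epsilon>'(1) in simp)
    also have "\<dots> = \<epsilon> * Cr_norm L 0 f / 2" using C1(1) by simp
    also have "\<dots> \<le> \<epsilon> * Cr_norm L 0 f" using nn[of 0] \<epsilon> by simp
    finally have 1: "Cr_norm K 0 (\<lambda>x. f x - h x) \<le> \<epsilon> * Cr_norm L 0 f" using h(2) by linarith
    have "Cr_norm L' 0 f \<le> Cr_norm L 0 f"
      by (rule Cr_norm_le[OF _ nn]) (use Cr_norm_ge[OF s Y L(1,2)] L'L in blast)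
    then have "C / (\<epsilon> / (2 * C1)) powr s * Cr_norm L' 0 f \<le> C / (\<epsilon> / (2 * C1)) powr s * Cr_norm L 0 f"
      using sC by (intro mult_left_mono) auto
    moreover have "C / (\<epsilon> / (2 * C1)) powr s = C * (2 * C1) powr s / \<epsilon> powr s"
      using \<epsilon> C1(1) by (simp add: powr_divide)
    ultimately have 2: "Cr_norm M 0 h \<le> C * (2 * C1) powr s / \<epsilon> powr s * Cr_norm L 0 f" using h(3) by simp
    show "\<exists>h\<in>zero_sols P UNIV. Cr_norm K 0 (\<lambda>x. f x - h x) \<le> \<epsilon> * Cr_norm L 0 f \<and>
          Cr_norm M 0 h \<le> C * (2 * C1) powr s / \<epsilon> powr s * Cr_norm L 0 f"
      using h(1) 1 2 by blast
  qed fact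
qed

theorem theorem1p1:
  fixes P :: "'n::finite cpoly" and K Y :: "(real^'n) set"
  assumes "P \<noteq> 0"
    and "compact K" and "convex K" and "open Y" and "K \<subseteq> Y"
  shows "(\<forall>L M r1 r2. compact L \<and> L \<subseteq> Y \<and> K \<subseteq> interior L \<and> compact M \<longrightarrow>
            (\<exists>s C. s > 0 \<and> C > 0 \<and>
              (\<forall>f\<in>zero_sols P Y. \<forall>\<epsilon>::real. 0 < \<epsilon> \<and> \<epsilon> < 1 \<longrightarrow>
                (\<exists>h\<in>zero_sols P UNIV.
                   Cr_norm K r1 (\<lambda>x. f x - h x) \<le> \<epsilon> * Cr_norm L (r1 + 1) f \<and>
                   Cr_norm M r2 h \<le> C / \<epsilon> powr s * Cr_norm L 0 f))))
       \<and> (hypoelliptic P \<longrightarrow>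
          (\<forall>L M. compact L \<and> L \<subseteq> Y \<and> K \<subseteq> interior L \<and> compact M \<longrightarrow>
            (\<exists>s C. s > 0 \<and> C > 0 \<and>
              (\<forall>f\<in>zero_sols P Y. \<forall>\<epsilon>::real. 0 < \<epsilon> \<and> \<epsilon> < 1 \<longrightarrow>
                (\<exists>h\<in>zero_sols P UNIV.
                   Cr_norm K 0 (\<lambda>x. f x - h x) \<le> \<epsilon> * Cr_norm L 0 f \<and>
                   Cr_norm M 0 h \<le> C / \<epsilon> powr s * Cr_norm L 0 f)))))"
  using runge_general[OF assms(1-4)] runge_hypoelliptic[OF assms(1) _ assms(2-4)]
  unfolding runge_approximable_def by simp

end
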